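(* If $G$ is a chordal graph, then the Stanley-Reisner ideal $\mathcal{N}(\Delta_1(G))$ has a $2$-linear resolution over any field of characteristic $2$. Conversely, if $\Gamma$ is a simplicial complex such that $\mathcal{N}(\Gamma)$ has a $2$-linear resolution over a field of characteristic $2$, then $\Gamma=\Delta_1(\Gamma^{[1]})$ and $\Gamma^{[1]}$ is chordal.
   Context: Graphs are finite and simple; a graph $G$ is regarded as a simplicial complex of dimension at most $1$ on its vertex set. A graph is chordal if every cycle of length greater than $3$ has a chord. A simplicial complex $\Gamma$ on a finite vertex set $V(\Gamma)=\{x_1,\ldots,x_n\}$ is a collection of subsets of $V(\Gamma)$ (faces) closed under taking subsets; a face $F$ has dimension $|F|-1$. The pure $1$-skeleton $\Gamma^{[1]}$ is the complex, on the same vertex set, whose facets are the $1$-dimensional faces of $\Gamma$ (i.e. a graph on $V(\Gamma)$). The $1$-closure $\Delta_1(G)$ of a graph $G$ is the simplicial complex on $V(G)$ whose $1$-faces are exactly the edges of $G$, which contains all subsets of $V(G)$ with at most $1$ element, and for which a subset of $V(G)$ with more than $2$ elements is a face if and only if all its $2$-element subsets are edges of $G$ (this is the clique complex of $G$). The Stanley-Reisner ideal $\mathcal{N}(\Gamma)$ over a field $k$ is the ideal of $R=k[x_1,\ldots,x_n]$ generated by the square-free monomials $x_{i_1}\cdots x_{i_r}$ such that $\{x_{i_1},\ldots,x_{i_r}\}$ is not a face of $\Gamma$. A monomial ideal $I\subseteq R$ has a minimal graded free resolution $0\to\bigoplus_j R(-j)^{\beta_{m,j}(I)}\to\cdots\to\bigoplus_j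 R(-j)^{\beta_{0,j}(I)}\to I\to 0$, with graded Betti numbers $\beta_{i,j}(I)$; $I$ has a $t$-linear resolution over $k$ if $\beta_{i,j}(I)=0$ for all $j\neq i+t$. *)

theory Defs
  imports "Jordan_Normal_Form.Matrix_Kernel" "HOL-Library.Poly_Mapping"
begin

section \<open>Graphs and simplicial complexes\<close>

text \<open>A graph is given by its vertex set \<open>V\<close> and its set \<open>E\<close> of edges, each edge being
  a two-element set of vertices.\<close>

definition simple_graph :: "'v set \<Rightarrow> 'v set set \<Rightarrow> bool" where
  "simple_graph V E \<longleftrightarrow> finite V \<and> (\<forall>e\<in>E. e \<subseteq> V \<and> card e = 2)"

text \<open>A cycle is listed by its distinct vertices; the last vertex is joined to the first.\<close>

definition cycle_edges :: "'v list \<Rightarrow> 'v set set" where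
  "cycle_edges c = {{c ! i, c ! (Suc i mod length c)} | i. i < length c}"

definition is_cycle :: "'v set set \<Rightarrow> 'v list \<Rightarrow> bool" where
  "is_cycle E c \<longleftrightarrow> 3 \<le> length c \<and> distinct c \<and> cycle_edges c \<subseteq> E"

definition has_chord :: "'v set set \<Rightarrow> 'v list \<Rightarrow> bool" where
  "has_chord E c \<longleftrightarrow> (\<exists>e\<in>E. e \<subseteq> set c \<and> e \<notin> cycle_edges c)"

definition chordal :: "'v set set \<Rightarrow> bool" where
  "chordal E \<longleftrightarrow> (\<forall>c. is_cycle E c \<and> length c > 3 \<longrightarrow> has_chord E c)"

text \<open>The vertices of \<open>V\<close> are not required to be faces.\<close>

definition simplicial_complex :: "'v set \<Rightarrow> 'v set set \<Rightarrow> bool" where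
  "simplicial_complex V \<Gamma> \<longleftrightarrow>
     finite V \<and> (\<forall>F\<in>\<Gamma>. F \<subseteq> V) \<and> (\<forall>F\<in>\<Gamma>. \<forall>H. H \<subseteq> F \<longrightarrow> H \<in> \<Gamma>)"

text \<open>The edge set of the pure 1-skeleton, which is a graph on the vertex set of the complex.\<close>

definition pure_1_skeleton :: "'v set set \<Rightarrow> 'v set set" where
  "pure_1_skeleton \<Gamma> = {F \<in> \<Gamma>. card F = 2}"

definition one_closure :: "'v set \<Rightarrow> 'v set set \<Rightarrow> 'v set set" where
  "one_closure V E = {F. F \<subseteq> V \<and>
     (card F \<le> 1 \<or>
      card F = 2 \<and> F \<in> E \<or>
      card F > 2 \<and> (\<forall>e. e \<subseteq> F \<and> card e = 2 \<longrightarrow> e \<in> E))}"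


section \<open>The polynomial ring and the Stanley-Reisner ideal\<close>

text \<open>A monomial is its exponent vector, and a polynomial maps monomials to coefficients;
  multiplication of polynomials is the convolution product of \<^typ>\<open>'a \<Rightarrow>\<^sub>0 'b\<close>.\<close>

type_synonym ('v, 'k) mpoly = "('v \<Rightarrow>\<^sub>0 nat) \<Rightarrow>\<^sub>0 'k"

text \<open>The subring of the polynomials in the variables indexed by \<open>V\<close>.\<close>

definition poly_ring :: "'v set \<Rightarrow> ('v, 'k::zero) mpoly set" where
  "poly_ring V = {p. \<forall>m \<in> Poly_Mapping.keys p. Poly_Mapping.keys m \<subseteq> V}"

definition mdeg :: "('v \<Rightarrow>\<^sub>0 nat) \<Rightarrow> nat" where
  "mdeg m = (\<Sum>v\<in>Poly_Mapping.keys m. Poly_Mapping.lookup m v)"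

definition squarefree_monom :: "'v set \<Rightarrow> ('v, 'k::zero_neq_one) mpoly" where
  "squarefree_monom F = Poly_Mapping.single (\<Sum>v\<in>F. Poly_Mapping.single v 1) 1"

definition ideal_gen ::
  "'v set \<Rightarrow> ('v, 'k::comm_ring_1) mpoly set \<Rightarrow> ('v, 'k) mpoly set" where
  "ideal_gen V S = {(\<Sum>s\<in>T. c s * s) | T c. finite T \<and> T \<subseteq> S \<and> (\<forall>s\<in>T. c s \<in> poly_ring V)}"

definition stanley_reisner_ideal ::
  "'v set \<Rightarrow> 'v set set \<Rightarrow> ('v, 'k::comm_ring_1) mpoly set" where
  "stanley_reisner_ideal V \<Gamma> = ideal_gen V {squarefree_monom F | F. F \<subseteq> V \<and> F \<notin> \<Gamma>}"


section \<open>Minimal graded free resolutions\<close>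

text \<open>Elements of the free module of rank \<open>n\<close> over the polynomial ring in the variables \<open>V\<close>.\<close>

definition free_module :: "'v set \<Rightarrow> nat \<Rightarrow> ('v, 'k::zero) mpoly vec set" where
  "free_module V n = {x \<in> carrier_vec n. \<forall>i<n. x $ i \<in> poly_ring V}"

text \<open>A list \<open>[d\<^sub>0, \<dots>, d\<^sub>r\<^sub>-\<^sub>1]\<close> of degrees stands for the graded free module
  \<open>R(-d\<^sub>0) \<oplus> \<dots> \<oplus> R(-d\<^sub>r\<^sub>-\<^sub>1)\<close>, whose \<open>c\<close>-th basis vector has degree \<open>d\<^sub>c\<close>.  A matrix describes
  a degree-0 homomorphism from the module with shifts \<open>ds\<close> to the one with shifts \<open>es\<close> iff the
  \<open>(r,c)\<close> entry is homogeneous of degree \<open>ds ! c - es ! r\<close> (and is zero if this is negative).\<close>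

definition graded_hom ::
  "'v set \<Rightarrow> nat list \<Rightarrow> nat list \<Rightarrow> ('v, 'k::zero) mpoly mat \<Rightarrow> bool" where
  "graded_hom V ds es A \<longleftrightarrow> A \<in> carrier_mat (length es) (length ds) \<and>
     (\<forall>r<length es. \<forall>c<length ds. A $$ (r, c) \<in> poly_ring V \<and>
        (\<forall>m \<in> Poly_Mapping.keys (A $$ (r, c)). mdeg m + es ! r = ds ! c))"

text \<open>The complex \<open>0 \<rightarrow> F\<^sub>n \<rightarrow> \<dots> \<rightarrow> F\<^sub>1 \<rightarrow> F\<^sub>0 \<rightarrow> I \<rightarrow> 0\<close>, where \<open>F\<^sub>i\<close> has the shifts \<open>d i\<close>.
  The matrix \<open>\<phi> 0\<close> is the augmentation, with the ideal \<open>I\<close> regarded inside \<open>R = R(0)\<close>, and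
  \<open>\<phi> (i + 1)\<close> is the map from \<open>F\<^sub>i\<^sub>+\<^sub>1\<close> to \<open>F\<^sub>i\<close>.  Exactness at \<open>F\<^sub>n\<close>, i.e. injectivity of its
  outgoing map, is the case \<open>i = n\<close> of the exactness condition.\<close>

definition graded_free_resolution ::
  "'v set \<Rightarrow> ('v, 'k::comm_ring_1) mpoly set \<Rightarrow> nat \<Rightarrow> (nat \<Rightarrow> nat list) \<Rightarrow>
     (nat \<Rightarrow> ('v, 'k) mpoly mat) \<Rightarrow> bool" where
  "graded_free_resolution V I n d \<phi> \<longleftrightarrow>
     (\<forall>i>n. d i = []) \<and>
     graded_hom V (d 0) [0] (\<phi> 0) \<and>
     (\<forall>i. graded_hom V (d (Suc i)) (d i) (\<phi> (Suc i))) \<and>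
     (\<lambda>x. (\<phi> 0 *\<^sub>v x) $ 0) ` free_module V (length (d 0)) = I \<and>
     (\<forall>i. (\<lambda>x. \<phi> (Suc i) *\<^sub>v x) ` free_module V (length (d (Suc i))) =
            mat_kernel (\<phi> i) \<inter> free_module V (length (d i)))"

text \<open>Minimality: every map \<open>F\<^sub>i\<^sub>+\<^sub>1 \<rightarrow> F\<^sub>i\<close> has its image in \<open>\<mm> F\<^sub>i\<close> for the ideal \<open>\<mm>\<close> generated
  by the variables, i.e. no matrix entry has a nonzero constant term.\<close>

definition minimal_graded_free_resolution ::
  "'v set \<Rightarrow> ('v, 'k::comm_ring_1) mpoly set \<Rightarrow> nat \<Rightarrow> (nat \<Rightarrow> nat list) \<Rightarrow>
     (nat \<Rightarrow> ('v, 'k) mpoly mat) \<Rightarrow> bool" where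
  "minimal_graded_free_resolution V I n d \<phi> \<longleftrightarrow>
     graded_free_resolution V I n d \<phi> \<and>
     (\<forall>i. \<forall>r<length (d i). \<forall>c<length (d (Suc i)).
        Poly_Mapping.lookup (\<phi> (Suc i) $$ (r, c)) 0 = 0)"

text \<open>\<open>\<beta> i j\<close> is the number of summands \<open>R(-j)\<close> of \<open>F\<^sub>i\<close> in a minimal graded free resolution.
  Such resolutions are unique up to isomorphism, so a given ideal has at most one \<open>\<beta>\<close>.\<close>

definition has_graded_betti_numbers ::
  "'v set \<Rightarrow> ('v, 'k::comm_ring_1) mpoly set \<Rightarrow> (nat \<Rightarrow> nat \<Rightarrow> nat) \<Rightarrow> bool" where
  "has_graded_betti_numbers V I \<beta> \<longleftrightarrow>
     (\<exists>n d \<phi>. minimal_graded_free_resolution V I n d \<phi> \<and> (\<forall>i j. \<beta> i j = count_list (d i) j))"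

definition has_linear_resolution ::
  "nat \<Rightarrow> 'v set \<Rightarrow> ('v, 'k::comm_ring_1) mpoly set \<Rightarrow> bool" where
  "has_linear_resolution t V I \<longleftrightarrow>
     (\<exists>\<beta>. has_graded_betti_numbers V I \<beta> \<and> (\<forall>i j. j \<noteq> i + t \<longrightarrow> \<beta> i j = 0))"

end

theory Submission
  imports Defs
begin

text \<open>
  A linear resolution is treated as a sequence of matrices whose entries are homogeneous of the
  degree of the generators for the augmentation and linear for all further maps
  (\<open>has_linear_resolution_iff\<close>).

  For a chordal graph such matrices are built by induction on the vertices.  Let \<open>s\<close> be a
  simplicial vertex, \<open>W\<close> the set of its non-neighbours, \<open>J\<close> the ideal of the graph without \<open>s\<close>, and \<open>P\<close>
  the ideal generated by the variables in \<open>W\<close>.  The ideal of the whole graph, generated by the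
  products of two distinct nonadjacent vertices, is \<open>J + x\<^sub>s P\<close>.  The variable \<open>x\<^sub>s\<close> does not occur in \<open>J\<close>, and \<open>J \<subseteq> P\<close>
  because the neighbours of \<open>s\<close> form a clique.  Hence \<open>0 \<rightarrow> J(-1) \<rightarrow> J \<oplus> P(-1) \<rightarrow> J + x\<^sub>s P \<rightarrow> 0\<close> is
  exact, and a mapping cone turns a 2-linear resolution of \<open>J\<close> and a 1-linear resolution of \<open>P\<close> into a
  2-linear resolution of \<open>J + x\<^sub>s P\<close> (\<open>linear_resolution_cone\<close>).  The Koszul resolution of \<open>P\<close> arises
  from the same lemma by adjoining the variables one by one.  Simplicial vertices exist by Dirac's
  theorem (\<open>chordal_simplicial_vertex\<close>).

  Conversely, generators of degree 2 force every nonface to contain a pair that is a nonface, so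
  the complex is the 1-closure of its skeleton.  A linear resolution moreover leaves no Koszul
  homology of the ideal outside the linear strand: a Koszul cycle above the degree of the strand
  can be pushed along the resolution until it visibly bounds (\<open>koszul_cycle_bounds\<close>).  A chordless
  cycle on \<open>n > 3\<close> vertices contradicts this, because the first cohomology of the circle yields a
  Koszul cycle, indexed by sets of size \<open>n - 3\<close> with coefficients of degree 3, that does not bound
  (\<open>linear_resolution_no_induced_cycle\<close>).  In characteristic 2 the Koszul complex can be written
  without signs.
\<close>

section \<open>Polynomials and their homogeneous components\<close>

definition indet :: "'v \<Rightarrow> ('v, 'k::comm_ring_1) mpoly" where
  "indet v = Poly_Mapping.single (Poly_Mapping.single v 1) 1"

lemma lookup_single_mult:
  fixes p :: "'m::cancel_comm_monoid_add \<Rightarrow>\<^sub>0 'k::comm_ring_1"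
  shows "Poly_Mapping.lookup (Poly_Mapping.single a c * p) (a + m) = c * Poly_Mapping.lookup p m"
proof -
  have "Poly_Mapping.lookup (Poly_Mapping.single a c * p) (a + m) =
    Sum_any (\<lambda>l. (c * Sum_any (\<lambda>q. Poly_Mapping.lookup p q when a + m = l + q)) when a = l)"
    by (simp add: lookup_mult lookup_single when_mult)
  then show ?thesis by simp
qed

lemma single_add_minus_single:
  "v \<in> Poly_Mapping.keys m \<Longrightarrow> Poly_Mapping.single v 1 + (m - Poly_Mapping.single v 1) = m"
  for m :: "'v \<Rightarrow>\<^sub>0 nat"
  by (intro poly_mapping_eqI)
    (auto simp: lookup_add lookup_minus lookup_single when_def in_keys_iff)

lemma lookup_indet_mult:
  "Poly_Mapping.lookup (indet v * p) m =
     (if v \<in> Poly_Mapping.keys m then Poly_Mapping.lookup p (m - Poly_Mapping.single v 1) else 0)"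
proof (cases "v \<in> Poly_Mapping.keys m")
  case True
  then show ?thesis
    using lookup_single_mult[of "Poly_Mapping.single v 1" 1 p "m - Poly_Mapping.single v 1"]
    by (simp add: indet_def single_add_minus_single[OF True] del: One_nat_def)
next
  case False
  have "m \<notin> Poly_Mapping.keys (indet v * p)"
  proof
    assume "m \<in> Poly_Mapping.keys (indet v * p)"
    then obtain q where "m = Poly_Mapping.single v 1 + q"
      using keys_mult[of "indet v" p] unfolding indet_def by (auto split: if_splits)
    then show False using False by (simp add: in_keys_iff lookup_add)
  qed
  then show ?thesis using False by (simp add: in_keys_iff)
qed

lemma lookup_indet_mult_single:
  "Poly_Mapping.lookup (indet v * p) (Poly_Mapping.single v 1 + m) = Poly_Mapping.lookup p m"
  unfolding indet_def lookup_single_mult by simp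

lemma indet_mult_eq_0D: "indet v * p = 0 \<Longrightarrow> p = 0"
  by (metis lookup_indet_mult_single lookup_zero poly_mapping_eqI)

lemma poly_eq_sum_single:
  "p = (\<Sum>m\<in>Poly_Mapping.keys p. Poly_Mapping.single m (Poly_Mapping.lookup p m))"
  by (intro poly_mapping_eqI) (auto simp: lookup_sum lookup_single when_def in_keys_iff)

definition restrict_monoms :: "('m \<Rightarrow> bool) \<Rightarrow> ('m \<Rightarrow>\<^sub>0 'b::zero) \<Rightarrow> 'm \<Rightarrow>\<^sub>0 'b" where
  "restrict_monoms B p = Poly_Mapping.mapp (\<lambda>m c. c when B m) p"

lemma lookup_restrict_monoms:
  "Poly_Mapping.lookup (restrict_monoms B p) m = (Poly_Mapping.lookup p m when B m)"
  by (auto simp: restrict_monoms_def lookup_mapp when_def in_keys_iff)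

lemma keys_restrict_monoms:
  "Poly_Mapping.keys (restrict_monoms B p) = {m \<in> Poly_Mapping.keys p. B m}"
  by (auto simp: in_keys_iff lookup_restrict_monoms when_def split: if_splits)

lemma mdeg_superset:
  "finite A \<Longrightarrow> Poly_Mapping.keys m \<subseteq> A \<Longrightarrow> mdeg m = (\<Sum>v\<in>A. Poly_Mapping.lookup m v)"
  unfolding mdeg_def by (intro sum.mono_neutral_left) (auto simp: in_keys_iff)

lemma mdeg_add: "mdeg (m + n) = mdeg m + mdeg n"
proof -
  let ?A = "Poly_Mapping.keys m \<union> Poly_Mapping.keys n"
  have "mdeg (m + n) = (\<Sum>v\<in>?A. Poly_Mapping.lookup (m + n) v)"
    using keys_add[of m n] by (intro mdeg_superset) auto
  also have "\<dots> = (\<Sum>v\<in>?A. Poly_Mapping.lookup m v) + (\<Sum>v\<in>?A. Poly_Mapping.lookup n v)"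
    by (simp add: lookup_add sum.distrib)
  also have "\<dots> = mdeg m + mdeg n"
    by (subst (1 2) mdeg_superset[where A = ?A]) auto
  finally show ?thesis .
qed

lemma mdeg_0 [simp]: "mdeg 0 = 0"
  by (simp add: mdeg_def)

lemma mdeg_single [simp]: "mdeg (Poly_Mapping.single v k) = k"
  by (simp add: mdeg_def)

definition homog_comp :: "nat \<Rightarrow> ('v, 'k::zero) mpoly \<Rightarrow> ('v, 'k) mpoly" where
  "homog_comp k = restrict_monoms (\<lambda>m. mdeg m = k)"

lemma lookup_homog_comp:
  "Poly_Mapping.lookup (homog_comp k p) m = (Poly_Mapping.lookup p m when mdeg m = k)"
  by (simp add: homog_comp_def lookup_restrict_monoms)

lemma homog_comp_0 [simp]: "homog_comp k 0 = 0"
  by (intro poly_mapping_eqI) (simp add: lookup_homog_comp)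

lemma homog_comp_sum: "homog_comp k (sum f A) = (\<Sum>a\<in>A. homog_comp k (f a))"
  by (intro poly_mapping_eqI) (auto simp: lookup_homog_comp lookup_sum when_def)

text \<open>A homogeneous factor shifts degrees, so it commutes with taking homogeneous components.  This
  is what lets arbitrary solutions of homogeneous linear systems be replaced by homogeneous ones.\<close>

lemma homog_comp_mult:
  fixes a p :: "('v, 'k::comm_ring_1) mpoly"
  assumes "\<forall>m\<in>Poly_Mapping.keys a. mdeg m = d"
  shows "homog_comp (d + k) (a * p) = a * homog_comp k p"
proof (rule poly_mapping_eqI)
  fix m
  have *: "Poly_Mapping.lookup a l * Sum_any (\<lambda>q. Poly_Mapping.lookup (homog_comp k p) q when m = l + q)
    = (if mdeg m = d + k then Poly_Mapping.lookup a l * Sum_any (\<lambda>q. Poly_Mapping.lookup p q when m = l + q)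
       else 0)" for l
  proof (cases "Poly_Mapping.lookup a l = 0")
    case False
    then have l: "mdeg l = d" using assms by (simp add: in_keys_iff)
    have "(Poly_Mapping.lookup (homog_comp k p) q when m = l + q) =
      (if mdeg m = d + k then (Poly_Mapping.lookup p q when m = l + q) else 0)" for q
      using l by (auto simp: lookup_homog_comp mdeg_add when_def)
    then show ?thesis by (cases "mdeg m = d + k") simp_all
  qed simp
  show "Poly_Mapping.lookup (homog_comp (d + k) (a * p)) m = Poly_Mapping.lookup (a * homog_comp k p) m"
    by (subst lookup_homog_comp, unfold lookup_mult *) (auto simp: when_def)
qed

lemma homog_comp_eq_self:
  "(\<forall>m\<in>Poly_Mapping.keys p. mdeg m = k) \<Longrightarrow> homog_comp k p = p"
  by (intro poly_mapping_eqI) (auto simp: lookup_homog_comp when_def in_keys_iff)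

lemma poly_ring_0 [simp]: "0 \<in> poly_ring V"
  and poly_ring_1 [simp]: "(1 :: ('v, 'k::comm_ring_1) mpoly) \<in> poly_ring V"
  by (auto simp: poly_ring_def)

lemma poly_ring_indet [simp]: "v \<in> V \<Longrightarrow> indet v \<in> poly_ring V"
  by (auto simp: poly_ring_def indet_def)

lemma poly_ring_add [intro, simp]: "p \<in> poly_ring V \<Longrightarrow> q \<in> poly_ring V \<Longrightarrow> p + q \<in> poly_ring V"
  unfolding poly_ring_def using keys_add[of p q] by blast

lemma poly_ring_uminus [simp]:
  "- p \<in> poly_ring V \<longleftrightarrow> p \<in> poly_ring V" for p :: "('v, 'k::comm_ring_1) mpoly"
  by (simp add: poly_ring_def in_keys_iff)

lemma poly_ring_mult [intro, simp]:
  fixes p q :: "('v, 'k::comm_ring_1) mpoly"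
  assumes "p \<in> poly_ring V" "q \<in> poly_ring V"
  shows "p * q \<in> poly_ring V"
  unfolding poly_ring_def
proof (intro CollectI ballI)
  fix m assume "m \<in> Poly_Mapping.keys (p * q)"
  then obtain a b where "m = a + b" "a \<in> Poly_Mapping.keys p" "b \<in> Poly_Mapping.keys q"
    using keys_mult[of p q] by blast
  then show "Poly_Mapping.keys m \<subseteq> V"
    using assms keys_add[of a b] unfolding poly_ring_def by blast
qed

lemma poly_ring_sum [intro]: "(\<And>a. a \<in> A \<Longrightarrow> f a \<in> poly_ring V) \<Longrightarrow> sum f A \<in> poly_ring V"
  by (induction A rule: infinite_finite_induct) auto

lemma poly_ring_restrict [simp]: "p \<in> poly_ring V \<Longrightarrow> restrict_monoms B p \<in> poly_ring V"
  by (auto simp: poly_ring_def keys_restrict_monoms)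

lemma poly_ring_homog_comp [simp]: "p \<in> poly_ring V \<Longrightarrow> homog_comp k p \<in> poly_ring V"
  by (simp add: homog_comp_def)

section \<open>Squarefree monomial ideals as support conditions\<close>

definition set_monom :: "'v set \<Rightarrow> 'v \<Rightarrow>\<^sub>0 nat" where
  "set_monom F = (\<Sum>v\<in>F. Poly_Mapping.single v 1)"

lemma squarefree_monom_eq: "squarefree_monom F = Poly_Mapping.single (set_monom F) 1"
  by (simp add: squarefree_monom_def set_monom_def)

lemma lookup_set_monom: "finite F \<Longrightarrow> Poly_Mapping.lookup (set_monom F) v = (if v \<in> F then 1 else 0)"
  by (simp add: set_monom_def lookup_sum lookup_single when_def)

lemma keys_set_monom [simp]: "finite F \<Longrightarrow> Poly_Mapping.keys (set_monom F) = F"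
  by (auto simp: in_keys_iff lookup_set_monom split: if_splits)

lemma set_monom_insert:
  "finite F \<Longrightarrow> v \<notin> F \<Longrightarrow> set_monom (insert v F) = Poly_Mapping.single v 1 + set_monom F"
  by (simp add: set_monom_def)

lemma set_monom_minus_single:
  assumes "finite F" "v \<in> F"
  shows "set_monom F - Poly_Mapping.single v 1 = set_monom (F - {v})"
  using assms by (intro poly_mapping_eqI)
    (auto simp: lookup_minus lookup_set_monom lookup_single when_def)

lemma mdeg_set_monom: "finite F \<Longrightarrow> mdeg (set_monom F) = card F"
  by (simp add: mdeg_def lookup_set_monom)

text \<open>A squarefree monomial ideal is spanned by monomials, and whether a monomial belongs to it
  depends only on its set of variables.  Such ideals are handled below through the predicate
  \<open>Q\<close> on these sets, which turns sums, colon ideals and inclusions into propositional logic.\<close>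

definition support_ideal :: "'v set \<Rightarrow> ('v set \<Rightarrow> bool) \<Rightarrow> ('v, 'k::zero) mpoly set" where
  "support_ideal V Q = {p \<in> poly_ring V. \<forall>m\<in>Poly_Mapping.keys p. Q (Poly_Mapping.keys m)}"

lemma support_ideal_True: "support_ideal V (\<lambda>_. True) = poly_ring V"
  by (simp add: support_ideal_def)

lemma support_ideal_False: "support_ideal V (\<lambda>_. False) = {0}"
  by (auto simp: support_ideal_def simp flip: keys_eq_empty)

lemma keys_add_nat: "Poly_Mapping.keys (m + n) = Poly_Mapping.keys m \<union> Poly_Mapping.keys n"
  for m n :: "'v \<Rightarrow>\<^sub>0 nat"
  by (auto simp: in_keys_iff lookup_add)

text \<open>A polynomial all of whose monomials are divisible by some generator is written as a
  combination of generators by choosing one divisor \<open>g m\<close> for each monomial \<open>m\<close> and collecting the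
  terms with the same choice.\<close>

lemma ideal_gen_squarefree:
  assumes fin: "\<And>F. F \<in> \<F> \<Longrightarrow> finite F" "\<And>F. F \<in> \<F> \<Longrightarrow> F \<subseteq> V"
  shows "ideal_gen V {squarefree_monom F | F. F \<in> \<F>} =
    (support_ideal V (\<lambda>A. \<exists>F\<in>\<F>. F \<subseteq> A) :: ('v, 'k::comm_ring_1) mpoly set)"
proof (intro equalityI subsetI)
  fix p :: "('v, 'k) mpoly"
  assume "p \<in> ideal_gen V {squarefree_monom F | F. F \<in> \<F>}"
  then obtain T c where T: "finite T" "T \<subseteq> {squarefree_monom F | F. F \<in> \<F>}"
    "\<forall>s\<in>T. c s \<in> poly_ring V" and p: "p = (\<Sum>s\<in>T. c s * s)"
    unfolding ideal_gen_def by blast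
  have "c s * s \<in> poly_ring V \<and> (\<forall>m\<in>Poly_Mapping.keys (c s * s). \<exists>F\<in>\<F>. F \<subseteq> Poly_Mapping.keys m)"
    if s: "s \<in> T" for s
  proof -
    obtain F where F: "F \<in> \<F>" "s = squarefree_monom F" using T s by blast
    then have "s \<in> poly_ring V" using fin[of F] by (auto simp: poly_ring_def squarefree_monom_eq)
    moreover have "\<exists>F\<in>\<F>. F \<subseteq> Poly_Mapping.keys m" if m: "m \<in> Poly_Mapping.keys (c s * s)" for m
    proof -
      obtain a where "m = a + set_monom F"
        using m keys_mult[of "c s" s] F by (auto simp: squarefree_monom_eq)
      then show ?thesis using F fin by (auto simp: keys_add_nat)
    qed
    ultimately show ?thesis using T s by blast
  qed
  note cs = this
  show "p \<in> support_ideal V (\<lambda>A. \<exists>F\<in>\<F>. F \<subseteq> A)"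
    unfolding support_ideal_def
  proof (intro CollectI conjI ballI)
    show "p \<in> poly_ring V" unfolding p using cs by blast
    fix m assume "m \<in> Poly_Mapping.keys p"
    then obtain s where "s \<in> T" "m \<in> Poly_Mapping.keys (c s * s)"
      using keys_sum[of "\<lambda>s. c s * s" T] unfolding p by fast
    then show "\<exists>F\<in>\<F>. F \<subseteq> Poly_Mapping.keys m" using cs by blast
  qed
next
  fix p :: "('v, 'k) mpoly"
  assume p: "p \<in> support_ideal V (\<lambda>A. \<exists>F\<in>\<F>. F \<subseteq> A)"
  then obtain g where g: "\<And>m. m \<in> Poly_Mapping.keys p \<Longrightarrow> g m \<in> \<F> \<and> g m \<subseteq> Poly_Mapping.keys m"
    unfolding support_ideal_def by simp metis
  define h :: "('v \<Rightarrow>\<^sub>0 nat) \<Rightarrow> ('v, 'k) mpoly" where "h m = squarefree_monom (g m)" for m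
  define q where "q m = Poly_Mapping.single (m - set_monom (g m)) (Poly_Mapping.lookup p m)" for m
  define c where "c s = (\<Sum>m\<in>{m \<in> Poly_Mapping.keys p. h m = s}. q m)" for s
  have q: "q m * h m = Poly_Mapping.single m (Poly_Mapping.lookup p m)"
    and q': "q m \<in> poly_ring V" if m: "m \<in> Poly_Mapping.keys p" for m
  proof -
    have "m - set_monom (g m) + set_monom (g m) = m"
      using g[OF m] fin(1)[of "g m"]
      by (intro poly_mapping_eqI) (auto simp: lookup_add lookup_minus lookup_set_monom in_keys_iff)
    then show "q m * h m = Poly_Mapping.single m (Poly_Mapping.lookup p m)"
      unfolding q_def h_def squarefree_monom_eq mult_single by simp
    have "Poly_Mapping.keys (m - set_monom (g m)) \<subseteq> Poly_Mapping.keys m"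
      by (auto simp: in_keys_iff lookup_minus)
    then show "q m \<in> poly_ring V"
      using p m unfolding q_def support_ideal_def poly_ring_def by auto
  qed
  have "p = (\<Sum>m\<in>Poly_Mapping.keys p. Poly_Mapping.single m (Poly_Mapping.lookup p m))"
    by (rule poly_eq_sum_single)
  also have "\<dots> = (\<Sum>m\<in>Poly_Mapping.keys p. q m * h m)" by (intro sum.cong) (simp_all add: q)
  also have "\<dots> = (\<Sum>s\<in>h ` Poly_Mapping.keys p. \<Sum>m\<in>{m \<in> Poly_Mapping.keys p. h m = s}. q m * h m)"
    by (rule sum.image_gen) simp
  also have "\<dots> = (\<Sum>s\<in>h ` Poly_Mapping.keys p. c s * s)"
    unfolding c_def sum_distrib_right by (intro sum.cong) auto
  finally have "p = (\<Sum>s\<in>h ` Poly_Mapping.keys p. c s * s)" .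
  moreover have "c s \<in> poly_ring V" for s unfolding c_def by (intro poly_ring_sum q') simp
  moreover have "h ` Poly_Mapping.keys p \<subseteq> {squarefree_monom F | F. F \<in> \<F>}"
    using g by (auto simp: h_def)
  ultimately show "p \<in> ideal_gen V {squarefree_monom F | F. F \<in> \<F>}"
    unfolding ideal_gen_def by (intro CollectI exI[of _ "h ` Poly_Mapping.keys p"] exI[of _ c]) simp
qed

section \<open>Free modules and homogeneous matrices\<close>

lemma free_module_carrier: "x \<in> free_module V n \<Longrightarrow> x \<in> carrier_vec n"
  by (simp add: free_module_def)

lemma free_module_minus [intro]:
  fixes x y :: "('v, 'k::comm_ring_1) mpoly vec"
  assumes "x \<in> free_module V n" "y \<in> free_module V n"
  shows "x - y \<in> free_module V n"
  using assms poly_ring_add[of "x $ i" V "- y $ i" for i]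
  by (auto simp: free_module_def)

lemma free_module_unit [simp]: "unit_vec n j \<in> (free_module V n :: ('v, 'k::comm_ring_1) mpoly vec set)"
  by (auto simp: free_module_def unit_vec_def)

lemma free_module_smult [intro]:
  fixes p :: "('v, 'k::comm_ring_1) mpoly"
  shows "p \<in> poly_ring V \<Longrightarrow> x \<in> free_module V n \<Longrightarrow> p \<cdot>\<^sub>v x \<in> free_module V n"
  by (auto simp: free_module_def)

lemma free_module_append:
  "a \<in> free_module V n \<Longrightarrow> b \<in> free_module V m \<Longrightarrow> a @\<^sub>v b \<in> free_module V (n + m)"
  by (auto simp: free_module_def)

lemma free_module_appendE:
  assumes "x \<in> free_module V (n + m)"
  obtains a b where "a \<in> free_module V n" "b \<in> free_module V m" "x = a @\<^sub>v b"
proof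
  show "vec_first x n \<in> free_module V n" "vec_last x m \<in> free_module V m"
    using assms by (auto simp: free_module_def vec_first_def vec_last_def)
  show "x = vec_first x n @\<^sub>v vec_last x m"
    using assms by (simp add: free_module_def)
qed

lemma free_module_0 [simp]: "free_module V 0 = {0\<^sub>v 0}"
  by (auto simp: free_module_def)

definition homog_mat :: "'v set \<Rightarrow> nat \<Rightarrow> nat \<Rightarrow> nat \<Rightarrow> ('v, 'k::zero) mpoly mat \<Rightarrow> bool" where
  "homog_mat V d nr nc A \<longleftrightarrow> A \<in> carrier_mat nr nc \<and>
     (\<forall>i<nr. \<forall>j<nc. A $$ (i, j) \<in> poly_ring V \<and> (\<forall>m\<in>Poly_Mapping.keys (A $$ (i, j)). mdeg m = d))"

lemma homog_mat_carrier: "homog_mat V d nr nc A \<Longrightarrow> A \<in> carrier_mat nr nc"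
  by (simp add: homog_mat_def)

lemma homog_mat_dims:
  assumes "homog_mat V d nr nc A"
  shows "dim_row A = nr" "dim_col A = nc"
  using assms by (auto simp: homog_mat_def)

lemma graded_hom_replicate:
  "graded_hom V (replicate nc (d + e)) (replicate nr e) A \<longleftrightarrow> homog_mat V d nr nc A"
  by (auto simp: graded_hom_def homog_mat_def)

lemma mult_mat_vec_index:
  fixes A :: "'a::comm_semiring_0 mat"
  assumes "A \<in> carrier_mat nr nc" "x \<in> carrier_vec nc" "i < nr"
  shows "(A *\<^sub>v x) $ i = (\<Sum>j<nc. A $$ (i, j) * x $ j)"
  using assms by (auto simp: scalar_prod_def atLeast0LessThan intro!: sum.cong)

lemma mult_mat_unit_vec:
  fixes A :: "'a::comm_semiring_1 mat"
  assumes "A \<in> carrier_mat nr nc" "j < nc"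
  shows "A *\<^sub>v unit_vec nc j = col A j"
  using assms by (intro eq_vecI) auto

lemma homog_mat_mult_vec:
  fixes A :: "('v, 'k::comm_ring_1) mpoly mat"
  assumes A: "homog_mat V d nr nc A" and x: "x \<in> free_module V nc"
  shows "A *\<^sub>v x \<in> free_module V nr"
  unfolding free_module_def
proof (intro CollectI conjI allI impI)
  show "A *\<^sub>v x \<in> carrier_vec nr" 
    by (rule mult_mat_vec_carrier[OF homog_mat_carrier[OF A] free_module_carrier[OF x]])
  fix i assume i: "i < nr"
  have "(A *\<^sub>v x) $ i = (\<Sum>j<nc. A $$ (i, j) * x $ j)"
    by (rule mult_mat_vec_index[OF homog_mat_carrier[OF A] free_module_carrier[OF x] i])
  also have "\<dots> \<in> poly_ring V"
  proof (intro poly_ring_sum poly_ring_mult)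
    fix j assume "j \<in> {..<nc}"
    then show "A $$ (i, j) \<in> poly_ring V" "x $ j \<in> poly_ring V"
      using A x i by (simp_all add: homog_mat_def free_module_def)
  qed
  finally show "(A *\<^sub>v x) $ i \<in> poly_ring V" .
qed

lemma homog_comp_mult_mat_vec:
  fixes A :: "('v, 'k::comm_ring_1) mpoly mat"
  assumes A: "homog_mat V d nr nc A" and x: "x \<in> carrier_vec nc"
  shows "A *\<^sub>v map_vec (homog_comp k) x = map_vec (homog_comp (d + k)) (A *\<^sub>v x)"
proof (rule eq_vecI)
  fix i assume "i < dim_vec (map_vec (homog_comp (d + k)) (A *\<^sub>v x))"
  then have i: "i < nr" using A by (auto simp: homog_mat_def)
  have "(A *\<^sub>v map_vec (homog_comp k) x) $ i = (\<Sum>j<nc. A $$ (i, j) * homog_comp k (x $ j))"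
    using mult_mat_vec_index[OF homog_mat_carrier[OF A], of "map_vec (homog_comp k) x" i] x i
    by simp
  also have "\<dots> = (\<Sum>j<nc. homog_comp (d + k) (A $$ (i, j) * x $ j))"
    using A i by (intro sum.cong) (auto simp: homog_comp_mult homog_mat_def)
  also have "\<dots> = homog_comp (d + k) ((A *\<^sub>v x) $ i)"
    using mult_mat_vec_index[OF homog_mat_carrier[OF A] x i] by (simp only: homog_comp_sum)
  finally show "(A *\<^sub>v map_vec (homog_comp k) x) $ i = map_vec (homog_comp (d + k)) (A *\<^sub>v x) $ i"
    using i A by (auto simp: homog_mat_def)
qed (use A in \<open>auto simp: homog_mat_def\<close>)

text \<open>If the columns of a homogeneous matrix lie in the image of another one, taking the component
  of the expected degree in arbitrary preimages gives a homogeneous factorization.\<close>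

lemma homogeneous_lift:
  fixes A B :: "('v, 'k::comm_ring_1) mpoly mat"
  assumes B: "homog_mat V d nr n B" and A: "homog_mat V (d + e) nr nc A"
    and img: "\<And>j. j < nc \<Longrightarrow> \<exists>y\<in>free_module V n. col A j = B *\<^sub>v y"
  shows "\<exists>C. homog_mat V e n nc C \<and> B * C = A"
proof -
  obtain y where y: "\<And>j. j < nc \<Longrightarrow> y j \<in> free_module V n \<and> col A j = B *\<^sub>v y j"
    using img by metis
  define C where "C = mat n nc (\<lambda>(i, j). homog_comp e (y j $ i))"
  have C: "homog_mat V e n nc C"
    using y by (auto simp: homog_mat_def C_def free_module_def homog_comp_def keys_restrict_monoms)
  have "B * C = A"
  proof (rule mat_col_eqI)
    fix j assume "j < dim_col A"
    then have j: "j < nc" using homog_mat_dims[OF A] by simp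
    have "col C j = map_vec (homog_comp e) (y j)"
      using j y[OF j] by (intro eq_vecI) (auto simp: C_def free_module_def)
    then have "col (B * C) j = B *\<^sub>v map_vec (homog_comp e) (y j)"
      using j B C by (simp add: col_mult2[of B nr n C nc] homog_mat_def)
    also have "\<dots> = map_vec (homog_comp (d + e)) (col A j)"
      using homog_comp_mult_mat_vec[OF B, of "y j" e] y[OF j] by (simp add: free_module_def)
    also have "\<dots> = col A j"
      using A j by (intro eq_vecI) (auto simp: homog_mat_def homog_comp_eq_self)
    finally show "col (B * C) j = col A j" .
  qed (use A B C in \<open>auto simp: homog_mat_def\<close>)
  with C show ?thesis by blast
qed

lemma homog_mat_zero [simp]: "homog_mat V d nr nc (0\<^sub>m nr nc)"
  by (simp add: homog_mat_def)

lemma homog_mat_uminus: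
  "homog_mat V d nr nc A \<Longrightarrow> homog_mat V d nr nc (- A)" for A :: "('v, 'k::comm_ring_1) mpoly mat"
  by (auto simp: homog_mat_def)

lemma homog_mat_one: "homog_mat V 0 n n (1\<^sub>m n :: ('v, 'k::comm_ring_1) mpoly mat)"
  by (auto simp: homog_mat_def)

lemma homog_mat_indet_smult:
  fixes A :: "('v, 'k::comm_ring_1) mpoly mat"
  assumes "homog_mat V d nr nc A" "x \<in> V"
  shows "homog_mat V (Suc d) nr nc (indet x \<cdot>\<^sub>m A)"
  unfolding homog_mat_def
proof (intro conjI allI impI ballI)
  show "indet x \<cdot>\<^sub>m A \<in> carrier_mat nr nc" using assms by (simp add: homog_mat_def)
  fix i j assume ij: "i < nr" "j < nc"
  then have e: "(indet x \<cdot>\<^sub>m A) $$ (i, j) = indet x * A $$ (i, j)"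
    using homog_mat_dims[OF assms(1)] by simp
  show "(indet x \<cdot>\<^sub>m A) $$ (i, j) \<in> poly_ring V"
    unfolding e using assms ij by (intro poly_ring_mult) (auto simp: homog_mat_def)
  fix m assume "m \<in> Poly_Mapping.keys ((indet x \<cdot>\<^sub>m A) $$ (i, j))"
  then obtain q where "m = Poly_Mapping.single x 1 + q" "q \<in> Poly_Mapping.keys (A $$ (i, j))"
    unfolding e using keys_mult[of "indet x" "A $$ (i, j)"] by (auto simp: indet_def split: if_splits)
  then show "mdeg m = Suc d" using assms ij by (simp add: mdeg_add homog_mat_def)
qed

lemma homog_mat_four_block:
  assumes "homog_mat V d nr1 nc1 A" "homog_mat V d nr1 nc2 B"
    "homog_mat V d nr2 nc1 C" "homog_mat V d nr2 nc2 D"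
  shows "homog_mat V d (nr1 + nr2) (nc1 + nc2) (four_block_mat A B C D)"
  unfolding homog_mat_def
proof (intro conjI allI impI)
  show "four_block_mat A B C D \<in> carrier_mat (nr1 + nr2) (nc1 + nc2)"
    using assms by (simp add: homog_mat_def)
  fix i j assume ij: "i < nr1 + nr2" "j < nc1 + nc2"
  have bounds: "i < nr1 \<or> i - nr1 < nr2" "j < nc1 \<or> j - nc1 < nc2" using ij by auto
  have e: "four_block_mat A B C D $$ (i, j) =
    (if i < nr1 then if j < nc1 then A $$ (i, j) else B $$ (i, j - nc1)
     else if j < nc1 then C $$ (i - nr1, j) else D $$ (i - nr1, j - nc1))"
    using ij by (simp add: homog_mat_dims[OF assms(1)] homog_mat_dims[OF assms(4)])
  show "four_block_mat A B C D $$ (i, j) \<in> poly_ring V"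
    "\<forall>m\<in>Poly_Mapping.keys (four_block_mat A B C D $$ (i, j)). mdeg m = d"
    unfolding e using assms ij bounds by (auto simp: homog_mat_def)
qed

lemma homog_mat_append_rows:
  assumes "homog_mat V d nr1 nc A" "homog_mat V d nr2 nc B"
  shows "homog_mat V d (nr1 + nr2) nc (A @\<^sub>r B)"
  using homog_mat_four_block[OF assms(1) homog_mat_zero[of V d nr1 0] assms(2) homog_mat_zero[of V d nr2 0]]
    by (simp add: append_rows_def homog_mat_dims[OF assms(1)] homog_mat_dims[OF assms(2)])

lemma smult_mat_mult_vec:
  fixes A :: "'a::comm_ring_1 mat"
  assumes "A \<in> carrier_mat nr nc" "x \<in> carrier_vec nc"
  shows "(k \<cdot>\<^sub>m A) *\<^sub>v x = k \<cdot>\<^sub>v (A *\<^sub>v x)"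
  using assms by (intro eq_vecI) (auto simp: scalar_prod_def sum_distrib_left mult.assoc)

lemma mult_mat_smult_vec:
  fixes A :: "'a::comm_ring_1 mat"
  assumes "A \<in> carrier_mat nr nc" "x \<in> carrier_vec nc"
  shows "A *\<^sub>v (k \<cdot>\<^sub>v x) = k \<cdot>\<^sub>v (A *\<^sub>v x)"
  using assms by (intro eq_vecI) (auto simp: scalar_prod_def sum_distrib_left mult.left_commute)

lemma uminus_mat_mult_vec:
  fixes A :: "'a::comm_ring_1 mat"
  assumes "A \<in> carrier_mat nr nc" "x \<in> carrier_vec nc"
  shows "(- A) *\<^sub>v x = - (A *\<^sub>v x)"
  using assms by (intro eq_vecI) (auto simp: scalar_prod_def sum_negf)

lemma zero_mat_mult_vec:
  fixes x :: "'a::comm_ring_1 vec"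
  shows "x \<in> carrier_vec nc \<Longrightarrow> 0\<^sub>m nr nc *\<^sub>v x = 0\<^sub>v nr"
  by (intro eq_vecI) (auto simp: scalar_prod_def)

lemma mult_mat_minus_vec:
  fixes A :: "'a::comm_ring_1 mat"
  assumes "A \<in> carrier_mat nr nc" "x \<in> carrier_vec nc" "y \<in> carrier_vec nc"
  shows "A *\<^sub>v (x - y) = A *\<^sub>v x - A *\<^sub>v y"
  using assms by (intro eq_vecI) (auto simp: scalar_prod_def sum_subtractf right_diff_distrib)

section \<open>Linear resolutions as sequences of matrices of linear forms\<close>

text \<open>A resolution with all shifts of \<open>F\<^sub>i\<close> equal to \<open>i + t\<close> is determined by the ranks \<open>r i\<close> and by
  matrices with entries of degree \<open>t\<close> for the augmentation and of degree 1 for all other maps.\<close>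

definition linear_free_resolution ::
  "'v set \<Rightarrow> nat \<Rightarrow> ('v, 'k::comm_ring_1) mpoly set \<Rightarrow> (nat \<Rightarrow> nat) \<Rightarrow>
     (nat \<Rightarrow> ('v, 'k) mpoly mat) \<Rightarrow> bool" where
  "linear_free_resolution V t I r \<phi> \<longleftrightarrow>
     (\<exists>n. \<forall>i>n. r i = 0) \<and>
     homog_mat V t 1 (r 0) (\<phi> 0) \<and>
     (\<forall>i. homog_mat V 1 (r i) (r (Suc i)) (\<phi> (Suc i))) \<and>
     (\<lambda>x. (\<phi> 0 *\<^sub>v x) $ 0) ` free_module V (r 0) = I \<and>
     (\<forall>i. (\<lambda>x. \<phi> (Suc i) *\<^sub>v x) ` free_module V (r (Suc i)) =
            mat_kernel (\<phi> i) \<inter> free_module V (r i))"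

text \<open>Entries of degree 1 have no constant term, so a resolution of this form is minimal.\<close>

lemma has_linear_resolution_iff:
  "has_linear_resolution t V I \<longleftrightarrow> (\<exists>r \<phi>. linear_free_resolution V t I r \<phi>)"
proof
  assume "has_linear_resolution t V I"
  then obtain \<beta> n d \<phi> where *: "minimal_graded_free_resolution V I n d \<phi>"
    "\<forall>i j. \<beta> i j = count_list (d i) j" "\<forall>i j. j \<noteq> i + t \<longrightarrow> \<beta> i j = 0"
    unfolding has_linear_resolution_def has_graded_betti_numbers_def by blast
  have d: "d i = replicate (length (d i)) (i + t)" for i
    using *(2,3) by (intro replicate_eqI) (auto simp: count_list_0_iff)
  have g: "graded_free_resolution V I n d \<phi>"
    using *(1) by (simp add: minimal_graded_free_resolution_def)
  have g0: "graded_hom V (d 0) [0] (\<phi> 0)"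
    and gS: "graded_hom V (d (Suc i)) (d i) (\<phi> (Suc i))" for i
    using g by (auto simp: graded_free_resolution_def)
  have "homog_mat V t 1 (length (d 0)) (\<phi> 0)"
    using graded_hom_replicate[of V "length (d 0)" t 0 1 "\<phi> 0"] g0 d[of 0] by simp
  moreover have "homog_mat V 1 (length (d i)) (length (d (Suc i))) (\<phi> (Suc i))" for i
    using graded_hom_replicate[of V "length (d (Suc i))" 1 "i + t" "length (d i)" "\<phi> (Suc i)"]
      gS[of i] d[of i] d[of "Suc i"] by simp
  ultimately have "linear_free_resolution V t I (\<lambda>i. length (d i)) \<phi>"
    using g by (auto simp: linear_free_resolution_def graded_free_resolution_def)
  then show "\<exists>r \<phi>. linear_free_resolution V t I r \<phi>" by blast
next
  assume "\<exists>r \<phi>. linear_free_resolution V t I r \<phi>"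
  then obtain r \<phi> where l: "linear_free_resolution V t I r \<phi>" by blast
  then obtain n where n: "\<forall>i>n. r i = 0" by (auto simp: linear_free_resolution_def)
  define d where "d i = replicate (r i) (i + t)" for i
  have "graded_hom V (d 0) [0] (\<phi> 0)"
    using graded_hom_replicate[of V "r 0" t 0 1 "\<phi> 0"] l by (simp add: linear_free_resolution_def d_def)
  moreover have "graded_hom V (d (Suc i)) (d i) (\<phi> (Suc i))" for i
    using graded_hom_replicate[of V "r (Suc i)" 1 "i + t" "r i" "\<phi> (Suc i)"] l
    by (simp add: linear_free_resolution_def d_def)
  ultimately have "graded_free_resolution V I n d \<phi>"
    using l n by (simp add: graded_free_resolution_def linear_free_resolution_def d_def)
  moreover have "Poly_Mapping.lookup (\<phi> (Suc i) $$ (a, b)) 0 = 0"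
    if "a < length (d i)" "b < length (d (Suc i))" for i a b
  proof -
    have "\<forall>m\<in>Poly_Mapping.keys (\<phi> (Suc i) $$ (a, b)). mdeg m = 1"
      using l that by (auto simp: linear_free_resolution_def homog_mat_def d_def)
    then have "0 \<notin> Poly_Mapping.keys (\<phi> (Suc i) $$ (a, b))" by fastforce
    then show ?thesis by (simp add: in_keys_iff)
  qed
  ultimately have "minimal_graded_free_resolution V I n d \<phi>"
    by (simp add: minimal_graded_free_resolution_def)
  then have "has_graded_betti_numbers V I (\<lambda>i j. count_list (d i) j)"
    unfolding has_graded_betti_numbers_def by blast
  moreover have "\<forall>i j. j \<noteq> i + t \<longrightarrow> count_list (d i) j = 0"
    by (auto simp: d_def count_list_0_iff)
  ultimately show "has_linear_resolution t V I" unfolding has_linear_resolution_def by blast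
qed

lemma linear_free_resolutionD:
  assumes "linear_free_resolution V t I r \<phi>"
  shows "homog_mat V t 1 (r 0) (\<phi> 0)" "homog_mat V 1 (r i) (r (Suc i)) (\<phi> (Suc i))"
    "p \<in> I \<longleftrightarrow> (\<exists>x\<in>free_module V (r 0). p = (\<phi> 0 *\<^sub>v x) $ 0)"
  using assms by (auto simp: linear_free_resolution_def)

lemma linear_free_resolution_exact:
  assumes l: "linear_free_resolution V t I r \<phi>" and x: "x \<in> free_module V (r i)"
  shows "\<phi> i *\<^sub>v x = 0\<^sub>v (dim_row (\<phi> i)) \<longleftrightarrow> (\<exists>y\<in>free_module V (r (Suc i)). x = \<phi> (Suc i) *\<^sub>v y)"
proof -
  have "x \<in> (\<lambda>x. \<phi> (Suc i) *\<^sub>v x) ` free_module V (r (Suc i)) \<longleftrightarrow>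
      x \<in> mat_kernel (\<phi> i) \<inter> free_module V (r i)"
    using l by (simp add: linear_free_resolution_def)
  moreover have "dim_col (\<phi> i) = r i"
    using l by (cases i) (auto simp: linear_free_resolution_def homog_mat_def)
  ultimately show ?thesis using x by (auto simp: mat_kernel_def free_module_def)
qed

lemma linear_free_resolutionI:
  fixes \<phi> :: "nat \<Rightarrow> ('v, 'k::comm_ring_1) mpoly mat"
  assumes "\<forall>i>n. r i = 0"
    and h: "homog_mat V t 1 (r 0) (\<phi> 0)" "\<And>i. homog_mat V 1 (r i) (r (Suc i)) (\<phi> (Suc i))"
    and I: "\<And>p. p \<in> I \<longleftrightarrow> (\<exists>x\<in>free_module V (r 0). p = (\<phi> 0 *\<^sub>v x) $ 0)"
    and ex: "\<And>i x. x \<in> free_module V (r i) \<Longrightarrow> \<phi> i *\<^sub>v x = 0\<^sub>v (dim_row (\<phi> i)) \<longleftrightarrow>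
      (\<exists>y\<in>free_module V (r (Suc i)). x = \<phi> (Suc i) *\<^sub>v y)"
  shows "linear_free_resolution V t I r \<phi>"
  unfolding linear_free_resolution_def
proof (intro conjI exI[of _ n])
  show "\<forall>i>n. r i = 0" by fact
  show "homog_mat V t 1 (r 0) (\<phi> 0)" by fact
  show "\<forall>i. homog_mat V 1 (r i) (r (Suc i)) (\<phi> (Suc i))" using h(2) by blast
  show "(\<lambda>x. (\<phi> 0 *\<^sub>v x) $ 0) ` free_module V (r 0) = I" using I by auto
  show "\<forall>i. (\<lambda>x. \<phi> (Suc i) *\<^sub>v x) ` free_module V (r (Suc i)) =
    mat_kernel (\<phi> i) \<inter> free_module V (r i)"
  proof
    fix i
    have "dim_col (\<phi> i) = r i" using h(1) h(2)[of "i - 1"] by (cases i) (auto simp: homog_mat_def)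
    then have "x \<in> mat_kernel (\<phi> i) \<longleftrightarrow> \<phi> i *\<^sub>v x = 0\<^sub>v (dim_row (\<phi> i))" if "x \<in> free_module V (r i)" for x
      using that by (simp add: mat_kernel_def free_module_def)
    then show "(\<lambda>x. \<phi> (Suc i) *\<^sub>v x) ` free_module V (r (Suc i)) = mat_kernel (\<phi> i) \<inter> free_module V (r i)"
      using ex[of _ i] homog_mat_mult_vec[OF h(2)[of i]] by blast
  qed
qed

lemma append_rows_mult_vec:
  fixes A B :: "'a::comm_ring_1 mat"
  assumes A: "A \<in> carrier_mat nr1 nc" and B: "B \<in> carrier_mat nr2 nc" and x: "x \<in> carrier_vec nc"
  shows "(A @\<^sub>r B) *\<^sub>v x = (A *\<^sub>v x) @\<^sub>v (B *\<^sub>v x)"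
proof -
  have x0: "x @\<^sub>v 0\<^sub>v 0 = x" using x by (intro eq_vecI) auto
  have d: "dim_row A = nr1" "dim_row B = nr2" using A B by auto
  have z: "0\<^sub>m n 0 *\<^sub>v (0\<^sub>v 0 :: 'a vec) = 0\<^sub>v n" for n by (rule zero_mat_mult_vec) simp
  have "(A @\<^sub>r B) *\<^sub>v (x @\<^sub>v 0\<^sub>v 0) =
    (A *\<^sub>v x + 0\<^sub>m nr1 0 *\<^sub>v 0\<^sub>v 0) @\<^sub>v (B *\<^sub>v x + 0\<^sub>m nr2 0 *\<^sub>v 0\<^sub>v 0)"
    unfolding append_rows_def d
    by (rule four_block_mat_mult_vec[OF A zero_carrier_mat B zero_carrier_mat x zero_carrier_vec])
  then show ?thesis
    unfolding x0 z using mult_mat_vec_carrier[OF A x] mult_mat_vec_carrier[OF B x] by simp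
qed

lemma mult_mat_zero_vec:
  fixes A :: "'a::comm_ring_1 mat"
  shows "A \<in> carrier_mat nr nc \<Longrightarrow> A *\<^sub>v 0\<^sub>v nc = 0\<^sub>v nr"
  by (intro eq_vecI) (auto simp: scalar_prod_def)

lemma append_vec_0 [simp]: "0\<^sub>v 0 @\<^sub>v x = x"
  by (intro eq_vecI) auto

lemma vec_minus_eq_0_iff:
  fixes u w :: "'a::ab_group_add vec"
  assumes "u \<in> carrier_vec n" "w \<in> carrier_vec n"
  shows "u - w = 0\<^sub>v n \<longleftrightarrow> u = w"
  using assms by (auto simp: vec_eq_iff)

lemma vec_diff_diff_self:
  fixes u w :: "'a::ab_group_add vec"
  assumes "u \<in> carrier_vec n" "w \<in> carrier_vec n"
  shows "u - (u - w) = w"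
  using assms by (intro eq_vecI) auto

lemma append_vec_zero: "0\<^sub>v n @\<^sub>v 0\<^sub>v m = 0\<^sub>v (n + m)"
  by (intro eq_vecI) auto

section \<open>Mapping cones of linear resolutions\<close>

text \<open>The inclusion \<open>J \<subseteq> P\<close> extends to a chain map between the resolutions, since each map is lifted
  along an exact complex.  The shifts \<open>t + s + i\<close> and \<open>t + i\<close> of the free modules differ by \<open>s\<close> in
  every homological degree, so all its entries can be chosen homogeneous of degree \<open>s\<close>.\<close>

lemma chain_map_lift:
  fixes \<phi> \<psi> :: "nat \<Rightarrow> ('v, 'k::comm_ring_1) mpoly mat"
  assumes A: "linear_free_resolution V (t + s) J rA \<phi>" and B: "linear_free_resolution V t P rB \<psi>"
    and JP: "J \<subseteq> P"
  obtains \<alpha> where "\<And>i. homog_mat V s (rB i) (rA i) (\<alpha> i)" "\<psi> 0 * \<alpha> 0 = \<phi> 0"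
    "\<And>i. \<psi> (Suc i) * \<alpha> (Suc i) = \<alpha> i * \<phi> (Suc i)"
proof -
  note hA = linear_free_resolutionD(1,2)[OF A] and hB = linear_free_resolutionD(1,2)[OF B]
  have cB: "\<psi> i \<in> carrier_mat (dim_row (\<psi> i)) (rB i)" for i
    using hB by (cases i) (auto simp: homog_mat_def)
  \<comment> \<open>Besides commutativity in degree 0, \<open>Q\<close> carries the vanishing that makes the next lifting possible.\<close>
  define Q where "Q n \<alpha> \<longleftrightarrow> homog_mat V s (rB n) (rA n) \<alpha> \<and> (n = 0 \<longrightarrow> \<psi> 0 * \<alpha> = \<phi> 0) \<and>
    (\<forall>v\<in>free_module V (rA (Suc n)). \<psi> n *\<^sub>v (\<alpha> *\<^sub>v (\<phi> (Suc n) *\<^sub>v v)) = 0\<^sub>v (dim_row (\<psi> n)))" for n \<alpha>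
  have comp: "\<phi> i *\<^sub>v (\<phi> (Suc i) *\<^sub>v v) = 0\<^sub>v (dim_row (\<phi> i))" if "v \<in> free_module V (rA (Suc i))" for i v
    using linear_free_resolution_exact[OF A] homog_mat_mult_vec[OF hA(2) that] that by blast
  have "\<exists>\<alpha>. Q 0 \<alpha>"
  proof -
    have "\<exists>y\<in>free_module V (rB 0). col (\<phi> 0) j = \<psi> 0 *\<^sub>v y" if j: "j < rA 0" for j
    proof -
      have "(\<phi> 0 *\<^sub>v unit_vec (rA 0) j) $ 0 \<in> J"
        using linear_free_resolutionD(3)[OF A] free_module_unit by blast
      then obtain y where y: "y \<in> free_module V (rB 0)"
        "(\<phi> 0 *\<^sub>v unit_vec (rA 0) j) $ 0 = (\<psi> 0 *\<^sub>v y) $ 0"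
        using JP linear_free_resolutionD(3)[OF B] by blast
      have "col (\<phi> 0) j = \<psi> 0 *\<^sub>v y"
        using y(2) homog_mat_dims[OF hA(1)] homog_mat_dims[OF hB(1)]
          mult_mat_unit_vec[OF homog_mat_carrier[OF hA(1)] j]
        by (intro eq_vecI) auto
      with y(1) show ?thesis by blast
    qed
    then obtain \<alpha> where \<alpha>: "homog_mat V s (rB 0) (rA 0) \<alpha>" "\<psi> 0 * \<alpha> = \<phi> 0"
      using homogeneous_lift[OF hB(1) hA(1)] by blast
    have "\<psi> 0 *\<^sub>v (\<alpha> *\<^sub>v (\<phi> 1 *\<^sub>v v)) = 0\<^sub>v (dim_row (\<psi> 0))" if v: "v \<in> free_module V (rA 1)" for v
      using assoc_mult_mat_vec[OF homog_mat_carrier[OF hB(1)] homog_mat_carrier[OF \<alpha>(1)],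
          of "\<phi> 1 *\<^sub>v v"] comp[of v 0] v free_module_carrier[OF homog_mat_mult_vec[OF hA(2)[of 0], of v]]
        homog_mat_dims[OF hA(1)] homog_mat_dims[OF hB(1)]
      by (simp add: \<alpha>(2))
    then show ?thesis using \<alpha> unfolding Q_def by auto
  qed
  moreover have "\<exists>\<alpha>'. Q (Suc n) \<alpha>' \<and> \<psi> (Suc n) * \<alpha>' = \<alpha> * \<phi> (Suc n)" if q: "Q n \<alpha>" for n \<alpha>
  proof -
    have \<alpha>: "homog_mat V s (rB n) (rA n) \<alpha>" using q by (simp add: Q_def)
    note c = homog_mat_carrier[OF \<alpha>] homog_mat_carrier[OF hA(2)[of n]] homog_mat_carrier[OF hB(2)[of n]]
    have colA: "col (\<alpha> * \<phi> (Suc n)) j = \<alpha> *\<^sub>v (\<phi> (Suc n) *\<^sub>v unit_vec (rA (Suc n)) j)"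
      if "j < rA (Suc n)" for j
      using col_mult2[OF c(1,2) that] mult_mat_unit_vec[OF c(2) that] by simp
    have im: "\<exists>y\<in>free_module V (rB (Suc n)). \<alpha> *\<^sub>v (\<phi> (Suc n) *\<^sub>v v) = \<psi> (Suc n) *\<^sub>v y"
      if v: "v \<in> free_module V (rA (Suc n))" for v
      using q v linear_free_resolution_exact[OF B, of "\<alpha> *\<^sub>v (\<phi> (Suc n) *\<^sub>v v)" n]
        homog_mat_mult_vec[OF \<alpha> homog_mat_mult_vec[OF hA(2) v]] by (auto simp: Q_def)
    have "homog_mat V (1 + s) (rB n) (rA (Suc n)) (\<alpha> * \<phi> (Suc n))"
      unfolding homog_mat_def
    proof (intro conjI allI impI)
      show "\<alpha> * \<phi> (Suc n) \<in> carrier_mat (rB n) (rA (Suc n))" using c by simp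
      fix i j assume ij: "i < rB n" "j < rA (Suc n)"
      then have e: "(\<alpha> * \<phi> (Suc n)) $$ (i, j) = (\<Sum>l<rA n. \<alpha> $$ (i, l) * \<phi> (Suc n) $$ (l, j))"
        using c by (auto simp: scalar_prod_def atLeast0LessThan intro!: sum.cong)
      have p: "\<alpha> $$ (i, l) \<in> poly_ring V" "\<phi> (Suc n) $$ (l, j) \<in> poly_ring V"
        "\<forall>m\<in>Poly_Mapping.keys (\<alpha> $$ (i, l)). mdeg m = s"
        "\<forall>m\<in>Poly_Mapping.keys (\<phi> (Suc n) $$ (l, j)). mdeg m = 1" if "l < rA n" for l
        using \<alpha> hA(2)[of n] ij that unfolding homog_mat_def by blast+
      show "(\<alpha> * \<phi> (Suc n)) $$ (i, j) \<in> poly_ring V" unfolding e using p by auto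
      show "\<forall>m\<in>Poly_Mapping.keys ((\<alpha> * \<phi> (Suc n)) $$ (i, j)). mdeg m = 1 + s"
      proof
        fix m assume "m \<in> Poly_Mapping.keys ((\<alpha> * \<phi> (Suc n)) $$ (i, j))"
        then obtain l where l: "l < rA n" "m \<in> Poly_Mapping.keys (\<alpha> $$ (i, l) * \<phi> (Suc n) $$ (l, j))"
          unfolding e using keys_sum[of "\<lambda>l. \<alpha> $$ (i, l) * \<phi> (Suc n) $$ (l, j)" "{..<rA n}"] by blast
        then obtain a b where "m = a + b" "a \<in> Poly_Mapping.keys (\<alpha> $$ (i, l))"
          "b \<in> Poly_Mapping.keys (\<phi> (Suc n) $$ (l, j))"
          using keys_mult by blast
        then show "mdeg m = 1 + s" using p[OF l(1)] by (simp add: mdeg_add)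
      qed
    qed
    moreover have "\<exists>y\<in>free_module V (rB (Suc n)). col (\<alpha> * \<phi> (Suc n)) j = \<psi> (Suc n) *\<^sub>v y"
      if "j < rA (Suc n)" for j
      unfolding colA[OF that] by (rule im) simp
    ultimately obtain \<alpha>' where \<alpha>': "homog_mat V s (rB (Suc n)) (rA (Suc n)) \<alpha>'"
      "\<psi> (Suc n) * \<alpha>' = \<alpha> * \<phi> (Suc n)"
      using homogeneous_lift[OF hB(2)[of n], of s "rA (Suc n)" "\<alpha> * \<phi> (Suc n)"] by blast
    have "\<psi> (Suc n) *\<^sub>v (\<alpha>' *\<^sub>v (\<phi> (Suc (Suc n)) *\<^sub>v v)) = 0\<^sub>v (dim_row (\<psi> (Suc n)))"
      if v: "v \<in> free_module V (rA (Suc (Suc n)))" for v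
    proof -
      let ?w = "\<phi> (Suc (Suc n)) *\<^sub>v v"
      have w: "?w \<in> carrier_vec (rA (Suc n))"
        using homog_mat_mult_vec[OF hA(2) v] by (rule free_module_carrier)
      have "\<psi> (Suc n) *\<^sub>v (\<alpha>' *\<^sub>v ?w) = \<alpha> *\<^sub>v (\<phi> (Suc n) *\<^sub>v ?w)"
        using assoc_mult_mat_vec[OF c(3) homog_mat_carrier[OF \<alpha>'(1)] w]
          assoc_mult_mat_vec[OF c(1,2) w] by (simp add: \<alpha>'(2))
      also have "\<dots> = \<alpha> *\<^sub>v 0\<^sub>v (rA n)"
        using comp[OF v] homog_mat_dims[OF hA(2)[of n]] by simp
      also have "\<dots> = 0\<^sub>v (dim_row (\<psi> (Suc n)))"
        using mult_mat_zero_vec[OF c(1)] homog_mat_dims[OF hB(2)[of n]] by simp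
      finally show ?thesis .
    qed
    then show ?thesis using \<alpha>' unfolding Q_def by blast
  qed
  ultimately obtain \<alpha> where "\<forall>n. Q n (\<alpha> n) \<and> \<psi> (Suc n) * \<alpha> (Suc n) = \<alpha> n * \<phi> (Suc n)"
    using dependent_nat_choice[of Q "\<lambda>n \<alpha> \<alpha>'. \<psi> (Suc n) * \<alpha>' = \<alpha> * \<phi> (Suc n)"] by blast
  then show thesis using that[of \<alpha>] unfolding Q_def by blast
qed

text \<open>Multiplication by the variable \<open>x\<close> is injective modulo \<open>J\<close>, so \<open>J \<inter> x P = x J\<close> and there is an
  exact sequence \<open>0 \<rightarrow> J(-1) \<rightarrow> J \<oplus> P(-1) \<rightarrow> J + x P \<rightarrow> 0\<close> with maps \<open>a \<mapsto> (x a, a)\<close> and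
  \<open>(j, p) \<mapsto> j - x p\<close>.  If \<open>A\<close> and \<open>B\<close> resolve \<open>J\<close> and \<open>P\<close>, and \<open>\<alpha> : A \<rightarrow> B\<close> lifts the inclusion, then the
  mapping cone, with modules \<open>A\<^sub>i\<^sub>-\<^sub>1 \<oplus> A\<^sub>i \<oplus> B\<^sub>i\<close> and differential
  \<open>(a, b, c) \<mapsto> (\<phi> a, x a - \<phi> b, \<alpha> a - \<psi> c)\<close>, resolves \<open>J + x P\<close>.  Its three summands in homological
  degree \<open>i\<close> are all generated in degree \<open>i + t + 1\<close>, so linearity is preserved.\<close>

lemma linear_resolution_cone:
  fixes J P :: "('v, 'k::comm_ring_1) mpoly set"
  assumes A: "linear_free_resolution V (Suc t) J rA \<phi>" and B: "linear_free_resolution V t P rB \<psi>"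
    and x: "x \<in> V" and JP: "J \<subseteq> P"
    and colon: "\<And>p. p \<in> poly_ring V \<Longrightarrow> indet x * p \<in> J \<Longrightarrow> p \<in> J"
  shows "\<exists>r \<theta>. linear_free_resolution V (Suc t) {j - indet x * p | j p. j \<in> J \<and> p \<in> P} r \<theta>"
proof -
  note hA = linear_free_resolutionD(1,2)[OF A] and hB = linear_free_resolutionD(1,2)[OF B]
  note imA = linear_free_resolutionD(3)[OF A] and imB = linear_free_resolutionD(3)[OF B]
  note exA = linear_free_resolution_exact[OF A] and exB = linear_free_resolution_exact[OF B]
  obtain \<alpha> where h\<alpha>: "\<And>i. homog_mat V 1 (rB i) (rA i) (\<alpha> i)" and \<alpha>0: "\<psi> 0 * \<alpha> 0 = \<phi> 0"
    and \<alpha>S: "\<And>i. \<psi> (Suc i) * \<alpha> (Suc i) = \<alpha> i * \<phi> (Suc i)"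
    using chain_map_lift[of V t 1 J rA \<phi> P rB \<psi>] A B JP by auto
  note carA = homog_mat_carrier[OF hA(1)] homog_mat_carrier[OF hA(2)]
  note carB = homog_mat_carrier[OF hB(1)] homog_mat_carrier[OF hB(2)]
  note car\<alpha> = homog_mat_carrier[OF h\<alpha>]
  note fmc = free_module_carrier
  \<comment> \<open>The primed data extend \<open>A\<close> by \<open>A\<^sub>-\<^sub>1 = 0\<close>, so that \<open>rA' i\<close> is the rank of \<open>A\<^sub>i\<^sub>-\<^sub>1\<close> and \<open>\<phi>' i\<close> leads to it.\<close>
  define rA' where "rA' i = (case i of 0 \<Rightarrow> 0 | Suc k \<Rightarrow> rA k)" for i
  define \<phi>' where "\<phi>' i = (case i of 0 \<Rightarrow> 0\<^sub>m 0 (rA 0) | Suc k \<Rightarrow> \<phi> (Suc k))" for i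
  define r where "r i = rA' i + (rA i + rB i)" for i
  define M where "M i = (indet x \<cdot>\<^sub>m 1\<^sub>m (rA i)) @\<^sub>r \<alpha> i" for i
  define D where "D i = four_block_mat (- \<phi> (Suc i)) (0\<^sub>m (rA i) (rB (Suc i)))
    (0\<^sub>m (rB i) (rA (Suc i))) (- \<psi> (Suc i))" for i
  define \<theta> where "\<theta> i = (case i of
      0 \<Rightarrow> four_block_mat (\<phi> 0) (- (indet x \<cdot>\<^sub>m \<psi> 0)) (0\<^sub>m 0 (rA 0)) (0\<^sub>m 0 (rB 0))
    | Suc k \<Rightarrow> four_block_mat (\<phi>' k) (0\<^sub>m (rA' k) (rA (Suc k) + rB (Suc k))) (M k) (D k))" for i
  have h\<phi>': "homog_mat V 1 (rA' i) (rA i) (\<phi>' i)" for i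
    using hA(2)[of "i - 1"] by (cases i) (simp_all add: rA'_def \<phi>'_def)
  note car\<phi>' = homog_mat_carrier[OF h\<phi>']
  have hM: "homog_mat V 1 (rA i + rB i) (rA i) (M i)" for i
    unfolding M_def using homog_mat_indet_smult[OF homog_mat_one x] h\<alpha>
    by (intro homog_mat_append_rows) simp_all
  have hD: "homog_mat V 1 (rA i + rB i) (rA (Suc i) + rB (Suc i)) (D i)" for i
    unfolding D_def using hA(2) hB(2) by (intro homog_mat_four_block homog_mat_uminus) simp_all
  have h\<theta>0: "homog_mat V (Suc t) 1 (r 0) (\<theta> 0)"
    using homog_mat_four_block[OF hA(1) homog_mat_uminus[OF homog_mat_indet_smult[OF hB(1) x]]
      homog_mat_zero homog_mat_zero, of 0] by (simp add: \<theta>_def r_def rA'_def)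
  have h\<theta>S: "homog_mat V 1 (r i) (r (Suc i)) (\<theta> (Suc i))" for i
    using homog_mat_four_block[OF h\<phi>' homog_mat_zero hM hD, of i] by (simp add: \<theta>_def r_def rA'_def)

  have \<theta>0: "\<theta> 0 *\<^sub>v (b @\<^sub>v c) = \<phi> 0 *\<^sub>v b - indet x \<cdot>\<^sub>v (\<psi> 0 *\<^sub>v c)"
    if b: "b \<in> carrier_vec (rA 0)" and c: "c \<in> carrier_vec (rB 0)" for b c
  proof -
    have "\<theta> 0 *\<^sub>v (b @\<^sub>v c) = (\<phi> 0 *\<^sub>v b + (- (indet x \<cdot>\<^sub>m \<psi> 0)) *\<^sub>v c) @\<^sub>v
      (0\<^sub>m 0 (rA 0) *\<^sub>v b + 0\<^sub>m 0 (rB 0) *\<^sub>v c)"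
      unfolding \<theta>_def nat.case four_block_mat_mult_vec[OF carA(1)
          uminus_carrier_mat[OF smult_carrier_mat[OF carB(1)]] zero_carrier_mat zero_carrier_mat b c] ..
    also have "\<dots> = \<phi> 0 *\<^sub>v b - indet x \<cdot>\<^sub>v (\<psi> 0 *\<^sub>v c)"
      unfolding zero_mat_mult_vec[OF b] zero_mat_mult_vec[OF c]
        uminus_mat_mult_vec[OF smult_carrier_mat[OF carB(1)] c] smult_mat_mult_vec[OF carB(1) c]
      using carA(1) carB(1) b c by (intro eq_vecI) auto
    finally show ?thesis .
  qed
  have \<theta>S: "\<theta> (Suc i) *\<^sub>v (a @\<^sub>v (b @\<^sub>v c)) =
      (\<phi>' i *\<^sub>v a) @\<^sub>v ((indet x \<cdot>\<^sub>v a - \<phi> (Suc i) *\<^sub>v b) @\<^sub>v (\<alpha> i *\<^sub>v a - \<psi> (Suc i) *\<^sub>v c))"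
    if a: "a \<in> carrier_vec (rA i)" and b: "b \<in> carrier_vec (rA (Suc i))" and c: "c \<in> carrier_vec (rB (Suc i))"
    for i a b c
  proof -
    have bc: "b @\<^sub>v c \<in> carrier_vec (rA (Suc i) + rB (Suc i))" using b c by simp
    have 1: "M i *\<^sub>v a = (indet x \<cdot>\<^sub>v a) @\<^sub>v (\<alpha> i *\<^sub>v a)"
      unfolding M_def append_rows_mult_vec[OF smult_carrier_mat[OF one_carrier_mat] car\<alpha> a]
        smult_mat_mult_vec[OF one_carrier_mat a] one_mult_mat_vec[OF a] ..
    have 2: "D i *\<^sub>v (b @\<^sub>v c) = (- (\<phi> (Suc i) *\<^sub>v b)) @\<^sub>v (- (\<psi> (Suc i) *\<^sub>v c))"
      unfolding D_def four_block_mat_mult_vec[OF uminus_carrier_mat[OF carA(2)] zero_carrier_mat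
          zero_carrier_mat uminus_carrier_mat[OF carB(2)] b c]
        uminus_mat_mult_vec[OF carA(2) b] uminus_mat_mult_vec[OF carB(2) c]
        zero_mat_mult_vec[OF b] zero_mat_mult_vec[OF c]
      using mult_mat_vec_carrier[OF carA(2) b] mult_mat_vec_carrier[OF carB(2) c] by simp
    have "\<theta> (Suc i) *\<^sub>v (a @\<^sub>v (b @\<^sub>v c)) = (\<phi>' i *\<^sub>v a + 0\<^sub>v (rA' i)) @\<^sub>v (M i *\<^sub>v a + D i *\<^sub>v (b @\<^sub>v c))"
      unfolding \<theta>_def nat.case
        four_block_mat_mult_vec[OF car\<phi>' zero_carrier_mat homog_mat_carrier[OF hM] homog_mat_carrier[OF hD] a bc]
        zero_mat_mult_vec[OF bc] ..
    also have "\<dots> = (\<phi>' i *\<^sub>v a) @\<^sub>v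
        ((indet x \<cdot>\<^sub>v a + - (\<phi> (Suc i) *\<^sub>v b)) @\<^sub>v (\<alpha> i *\<^sub>v a + - (\<psi> (Suc i) *\<^sub>v c)))"
      unfolding 1 2 using a mult_mat_vec_carrier[OF carA(2) b] mult_mat_vec_carrier[OF carB(2) c]
        mult_mat_vec_carrier[OF car\<phi>' a] mult_mat_vec_carrier[OF car\<alpha> a]
      by (simp add: append_vec_add[of _ "rA i" _ _ "rB i"])
    also have "\<dots> = (\<phi>' i *\<^sub>v a) @\<^sub>v
        ((indet x \<cdot>\<^sub>v a - \<phi> (Suc i) *\<^sub>v b) @\<^sub>v (\<alpha> i *\<^sub>v a - \<psi> (Suc i) *\<^sub>v c))"
      using a mult_mat_vec_carrier[OF carA(2) b] mult_mat_vec_carrier[OF carB(2) c]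
        mult_mat_vec_carrier[OF car\<alpha> a]
      by (simp add: minus_add_uminus_vec[of _ "rA i"] minus_add_uminus_vec[of _ "rB i"])
    finally show ?thesis .
  qed
  have rSuc: "r (Suc i) = rA i + (rA (Suc i) + rB (Suc i))" for i by (simp add: r_def rA'_def)
  have splitS: "\<exists>a\<in>free_module V (rA i). \<exists>b\<in>free_module V (rA (Suc i)). \<exists>c\<in>free_module V (rB (Suc i)).
      z = a @\<^sub>v (b @\<^sub>v c)" if z: "z \<in> free_module V (r (Suc i))" for i and z :: "('v, 'k) mpoly vec"
  proof -
    obtain a w where a: "a \<in> free_module V (rA i)" and w: "w \<in> free_module V (rA (Suc i) + rB (Suc i))"
      and zaw: "z = a @\<^sub>v w"
      using free_module_appendE[OF z[unfolded rSuc]] .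
    obtain b c where "b \<in> free_module V (rA (Suc i))" "c \<in> free_module V (rB (Suc i))" "w = b @\<^sub>v c"
      using free_module_appendE[OF w] .
    with a zaw show ?thesis by blast
  qed
  have joinS: "a @\<^sub>v (b @\<^sub>v c) \<in> free_module V (r (Suc i))"
    if "a \<in> free_module V (rA i)" "b \<in> free_module V (rA (Suc i))" "c \<in> free_module V (rB (Suc i))" for i a b c
    unfolding rSuc using that by (intro free_module_append)
  have split0: "\<exists>b\<in>free_module V (rA 0). \<exists>c\<in>free_module V (rB 0). z = b @\<^sub>v c"
    if "z \<in> free_module V (r 0)" for z :: "('v, 'k) mpoly vec"
  proof -
    have "z \<in> free_module V (rA 0 + rB 0)" using that by (simp add: r_def rA'_def)
    then obtain b c where "b \<in> free_module V (rA 0)" "c \<in> free_module V (rB 0)" "z = b @\<^sub>v c"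
      by (rule free_module_appendE)
    then show ?thesis by blast
  qed
  have join0: "b @\<^sub>v c \<in> free_module V (r 0)"
    if "b \<in> free_module V (rA 0)" "c \<in> free_module V (rB 0)" for b c
    unfolding r_def rA'_def using free_module_append[OF that] by simp
  have compA: "\<phi> i *\<^sub>v (\<phi> (Suc i) *\<^sub>v v) = 0\<^sub>v (dim_row (\<phi> i))"
    if "v \<in> free_module V (rA (Suc i))" for i v
    using exA homog_mat_mult_vec[OF hA(2) that] that by blast
  have compB: "\<psi> i *\<^sub>v (\<psi> (Suc i) *\<^sub>v v) = 0\<^sub>v (dim_row (\<psi> i))"
    if "v \<in> free_module V (rB (Suc i))" for i v
    using exB homog_mat_mult_vec[OF hB(2) that] that by blast
  have \<alpha>0': "\<psi> 0 *\<^sub>v (\<alpha> 0 *\<^sub>v v) = \<phi> 0 *\<^sub>v v" if "v \<in> carrier_vec (rA 0)" for v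
    using assoc_mult_mat_vec[OF carB(1) car\<alpha> that] \<alpha>0 by simp
  have \<alpha>S': "\<psi> (Suc i) *\<^sub>v (\<alpha> (Suc i) *\<^sub>v v) = \<alpha> i *\<^sub>v (\<phi> (Suc i) *\<^sub>v v)"
    if "v \<in> carrier_vec (rA (Suc i))" for v i
    using assoc_mult_mat_vec[OF carB(2) car\<alpha> that] assoc_mult_mat_vec[OF car\<alpha> carA(2) that] \<alpha>S[of i] by simp
  have dims: "dim_row (\<phi> 0) = 1" "dim_row (\<psi> 0) = 1" "\<And>i. dim_row (\<phi> (Suc i)) = rA i"
    "\<And>i. dim_row (\<psi> (Suc i)) = rB i"
    using homog_mat_dims[OF hA(1)] homog_mat_dims[OF hB(1)] homog_mat_dims[OF hA(2)] homog_mat_dims[OF hB(2)]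
    by blast+
  \<comment> \<open>Once the first component of a cycle of the cone is a boundary \<open>\<phi> a'\<close>, exactness of \<open>A\<close> and \<open>B\<close>
      shows that the other two have the form required of the image of \<open>(a', b'', c'')\<close>.\<close>
  have solveA: "\<exists>b''\<in>free_module V (rA (Suc i)). b = indet x \<cdot>\<^sub>v a' - \<phi> (Suc i) *\<^sub>v b''"
    if b: "b \<in> free_module V (rA i)" and a': "a' \<in> free_module V (rA i)"
      and e: "\<phi> i *\<^sub>v b = indet x \<cdot>\<^sub>v (\<phi> i *\<^sub>v a')" for i a' b
  proof -
    have c: "\<phi> i \<in> carrier_mat (dim_row (\<phi> i)) (rA i)" using carA by (cases i) auto
    have xa: "indet x \<cdot>\<^sub>v a' \<in> free_module V (rA i)" using a' x by auto
    have "\<phi> i *\<^sub>v (indet x \<cdot>\<^sub>v a' - b) = indet x \<cdot>\<^sub>v (\<phi> i *\<^sub>v a') - \<phi> i *\<^sub>v b"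
      using mult_mat_minus_vec[OF c fmc[OF xa] fmc[OF b]] mult_mat_smult_vec[OF c fmc[OF a']] by simp
    also have "\<dots> = 0\<^sub>v (dim_row (\<phi> i))"
      using mult_mat_vec_carrier[OF c fmc[OF b]] by (simp add: e[symmetric])
    finally obtain b'' where b'': "b'' \<in> free_module V (rA (Suc i))" "indet x \<cdot>\<^sub>v a' - b = \<phi> (Suc i) *\<^sub>v b''"
      using exA[OF free_module_minus[OF xa b]] by blast
    then show ?thesis using vec_diff_diff_self[OF fmc[OF xa] fmc[OF b]] by metis
  qed
  have solveB: "\<exists>c''\<in>free_module V (rB (Suc i)). c = \<alpha> i *\<^sub>v a' - \<psi> (Suc i) *\<^sub>v c''"
    if c: "c \<in> free_module V (rB i)" and a': "a' \<in> free_module V (rA i)"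
      and e: "\<psi> i *\<^sub>v c = \<psi> i *\<^sub>v (\<alpha> i *\<^sub>v a')" for i a' c
  proof -
    have cB: "\<psi> i \<in> carrier_mat (dim_row (\<psi> i)) (rB i)" using carB by (cases i) auto
    have xa: "\<alpha> i *\<^sub>v a' \<in> free_module V (rB i)" by (rule homog_mat_mult_vec[OF h\<alpha> a'])
    have "\<psi> i *\<^sub>v (\<alpha> i *\<^sub>v a' - c) = 0\<^sub>v (dim_row (\<psi> i))"
      using mult_mat_minus_vec[OF cB fmc[OF xa] fmc[OF c]] mult_mat_vec_carrier[OF cB fmc[OF c]]
      by (simp add: e[symmetric])
    then obtain c'' where "c'' \<in> free_module V (rB (Suc i))" "\<alpha> i *\<^sub>v a' - c = \<psi> (Suc i) *\<^sub>v c''"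
      using exB[OF free_module_minus[OF xa c]] by blast
    then show ?thesis using vec_diff_diff_self[OF fmc[OF xa] fmc[OF c]] by metis
  qed
  have backA: "\<phi> i *\<^sub>v (indet x \<cdot>\<^sub>v a' - \<phi> (Suc i) *\<^sub>v b'') = indet x \<cdot>\<^sub>v (\<phi> i *\<^sub>v a')"
    if a': "a' \<in> free_module V (rA i)" and b'': "b'' \<in> free_module V (rA (Suc i))" for i a' b''
  proof -
    have c: "\<phi> i \<in> carrier_mat (dim_row (\<phi> i)) (rA i)" using carA by (cases i) auto
    have xa: "indet x \<cdot>\<^sub>v a' \<in> carrier_vec (rA i)" using fmc[OF a'] by simp
    show ?thesis
      using mult_mat_minus_vec[OF c xa mult_mat_vec_carrier[OF carA(2) fmc[OF b'']]]
        mult_mat_smult_vec[OF c fmc[OF a']] compA[OF b''] mult_mat_vec_carrier[OF c fmc[OF a']] by simp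
  qed
  have backB: "\<psi> i *\<^sub>v (\<alpha> i *\<^sub>v a' - \<psi> (Suc i) *\<^sub>v c'') = \<psi> i *\<^sub>v (\<alpha> i *\<^sub>v a')"
    if a': "a' \<in> free_module V (rA i)" and c'': "c'' \<in> free_module V (rB (Suc i))" for i a' c''
  proof -
    have c: "\<psi> i \<in> carrier_mat (dim_row (\<psi> i)) (rB i)" using carB by (cases i) auto
    have xa: "\<alpha> i *\<^sub>v a' \<in> carrier_vec (rB i)" using mult_mat_vec_carrier[OF car\<alpha> fmc[OF a']] .
    show ?thesis
      using mult_mat_minus_vec[OF c xa mult_mat_vec_carrier[OF carB(2) fmc[OF c'']]]
        compB[OF c''] mult_mat_vec_carrier[OF c xa] by simp
  qed

  obtain n where n: "\<forall>i>n. rA i = 0"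
    using A[unfolded linear_free_resolution_def, THEN conjunct1] by (elim exE)
  obtain m where m: "\<forall>i>m. rB i = 0"
    using B[unfolded linear_free_resolution_def, THEN conjunct1] by (elim exE)
  have "linear_free_resolution V (Suc t) {j - indet x * p | j p. j \<in> J \<and> p \<in> P} r \<theta>"
  proof (rule linear_free_resolutionI)
    show "\<forall>i>Suc (n + m). r i = 0" using n m by (simp add: r_def rA'_def split: nat.split)
    show "homog_mat V (Suc t) 1 (r 0) (\<theta> 0)" "homog_mat V 1 (r i) (r (Suc i)) (\<theta> (Suc i))" for i
      by (fact h\<theta>0 h\<theta>S)+
  next
    have aug: "(\<theta> 0 *\<^sub>v (b @\<^sub>v c)) $ 0 = (\<phi> 0 *\<^sub>v b) $ 0 - indet x * (\<psi> 0 *\<^sub>v c) $ 0"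
      if "b \<in> free_module V (rA 0)" "c \<in> free_module V (rB 0)" for b c
      using \<theta>0[OF fmc fmc, OF that] dims by simp
    fix q :: "('v, 'k) mpoly"
    show "q \<in> {j - indet x * p | j p. j \<in> J \<and> p \<in> P} \<longleftrightarrow>
      (\<exists>z\<in>free_module V (r 0). q = (\<theta> 0 *\<^sub>v z) $ 0)"
    proof
      assume "q \<in> {j - indet x * p | j p. j \<in> J \<and> p \<in> P}"
      then obtain j p where jp: "j \<in> J" "p \<in> P" "q = j - indet x * p" by blast
      obtain b where b: "b \<in> free_module V (rA 0)" "j = (\<phi> 0 *\<^sub>v b) $ 0"
        using imA[THEN iffD1, OF jp(1)] by (elim bexE)
      obtain c where c: "c \<in> free_module V (rB 0)" "p = (\<psi> 0 *\<^sub>v c) $ 0"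
        using imB[THEN iffD1, OF jp(2)] by (elim bexE)
      have "q = (\<theta> 0 *\<^sub>v (b @\<^sub>v c)) $ 0" unfolding aug[OF b(1) c(1)] jp(3) b(2) c(2) ..
      then show "\<exists>z\<in>free_module V (r 0). q = (\<theta> 0 *\<^sub>v z) $ 0" by (rule bexI[OF _ join0[OF b(1) c(1)]])
    next
      assume "\<exists>z\<in>free_module V (r 0). q = (\<theta> 0 *\<^sub>v z) $ 0"
      then obtain z where z: "z \<in> free_module V (r 0)" "q = (\<theta> 0 *\<^sub>v z) $ 0" by (elim bexE)
      obtain b c where bc: "b \<in> free_module V (rA 0)" "c \<in> free_module V (rB 0)" "z = b @\<^sub>v c"
        using split0[OF z(1)] by (elim bexE)
      have "(\<phi> 0 *\<^sub>v b) $ 0 \<in> J" by (rule imA[THEN iffD2], rule bexI[OF refl bc(1)])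
      moreover have "(\<psi> 0 *\<^sub>v c) $ 0 \<in> P" by (rule imB[THEN iffD2], rule bexI[OF refl bc(2)])
      moreover have "q = (\<phi> 0 *\<^sub>v b) $ 0 - indet x * (\<psi> 0 *\<^sub>v c) $ 0"
        unfolding z(2) bc(3) by (rule aug[OF bc(1,2)])
      ultimately show "q \<in> {j - indet x * p | j p. j \<in> J \<and> p \<in> P}" by blast
    qed
  next
    fix i and z :: "('v, 'k) mpoly vec" assume z: "z \<in> free_module V (r i)"
    show "\<theta> i *\<^sub>v z = 0\<^sub>v (dim_row (\<theta> i)) \<longleftrightarrow> (\<exists>y\<in>free_module V (r (Suc i)). z = \<theta> (Suc i) *\<^sub>v y)"
    proof (cases i)
      case 0
      obtain b c where b: "b \<in> free_module V (rA 0)" and c: "c \<in> free_module V (rB 0)" and zbc: "z = b @\<^sub>v c"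
        using split0[OF z[unfolded 0]] by (elim bexE)
      have dim: "dim_row (\<theta> i) = 1" using homog_mat_dims[OF h\<theta>0] 0 by simp
      have eq: "\<theta> 1 *\<^sub>v (a' @\<^sub>v (b'' @\<^sub>v c'')) =
          (indet x \<cdot>\<^sub>v a' - \<phi> 1 *\<^sub>v b'') @\<^sub>v (\<alpha> 0 *\<^sub>v a' - \<psi> 1 *\<^sub>v c'')"
        if "a' \<in> free_module V (rA 0)" "b'' \<in> free_module V (rA 1)" "c'' \<in> free_module V (rB 1)" for a' b'' c''
      proof -
        have "\<phi>' 0 *\<^sub>v a' = 0\<^sub>v 0" by (simp add: \<phi>'_def zero_mat_mult_vec[OF fmc[OF that(1)]])
        then show ?thesis
          using \<theta>S[of a' 0 b'' c''] fmc[OF that(1)] fmc[OF that(2)] fmc[OF that(3)]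
          by (metis One_nat_def append_vec_0)
      qed
      have carphi: "\<phi> 0 *\<^sub>v b \<in> carrier_vec 1" "indet x \<cdot>\<^sub>v (\<psi> 0 *\<^sub>v c) \<in> carrier_vec 1"
        using mult_mat_vec_carrier[OF carA(1) fmc[OF b]] mult_mat_vec_carrier[OF carB(1) fmc[OF c]] by simp_all
      have ker: "\<theta> i *\<^sub>v z = 0\<^sub>v (dim_row (\<theta> i)) \<longleftrightarrow> \<phi> 0 *\<^sub>v b = indet x \<cdot>\<^sub>v (\<psi> 0 *\<^sub>v c)"
        unfolding zbc 0 dim[unfolded 0] \<theta>0[OF fmc[OF b] fmc[OF c]] by (rule vec_minus_eq_0_iff[OF carphi])
      show ?thesis
      proof
        assume "\<theta> i *\<^sub>v z = 0\<^sub>v (dim_row (\<theta> i))"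
        then have e: "\<phi> 0 *\<^sub>v b = indet x \<cdot>\<^sub>v (\<psi> 0 *\<^sub>v c)" using ker by blast
        have "indet x * (\<psi> 0 *\<^sub>v c) $ 0 = (\<phi> 0 *\<^sub>v b) $ 0" unfolding e using dims by simp
        then have "indet x * (\<psi> 0 *\<^sub>v c) $ 0 \<in> J" by (intro imA[THEN iffD2] bexI[OF _ b])
        moreover have "(\<psi> 0 *\<^sub>v c) $ 0 \<in> poly_ring V"
          using homog_mat_mult_vec[OF hB(1) c] by (simp add: free_module_def)
        \<comment> \<open>This is the step \<open>J \<inter> x P = x J\<close>.\<close>
        ultimately have "(\<psi> 0 *\<^sub>v c) $ 0 \<in> J" by (rule colon[rotated])
        then obtain a' where a': "a' \<in> free_module V (rA 0)" "(\<psi> 0 *\<^sub>v c) $ 0 = (\<phi> 0 *\<^sub>v a') $ 0"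
          using imA[THEN iffD1] by blast
        have psi: "\<psi> 0 *\<^sub>v c = \<phi> 0 *\<^sub>v a'" using a'(2) dims by (intro eq_vecI) auto
        obtain b'' where b'': "b'' \<in> free_module V (rA 1)" "b = indet x \<cdot>\<^sub>v a' - \<phi> 1 *\<^sub>v b''"
          using solveA[OF b a'(1) e[unfolded psi]] unfolding One_nat_def by blast
        obtain c'' where c'': "c'' \<in> free_module V (rB 1)" "c = \<alpha> 0 *\<^sub>v a' - \<psi> 1 *\<^sub>v c''"
          using solveB[OF c a'(1) psi[folded \<alpha>0'[OF fmc[OF a'(1)]]]] unfolding One_nat_def by blast
        have "z = \<theta> 1 *\<^sub>v (a' @\<^sub>v (b'' @\<^sub>v c''))"
          unfolding eq[OF a'(1) b''(1) c''(1)] zbc using b''(2) c''(2) by simp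
        then show "\<exists>y\<in>free_module V (r (Suc i)). z = \<theta> (Suc i) *\<^sub>v y"
          using joinS[of a' 0 b'' c''] a'(1) b''(1) c''(1) unfolding 0 One_nat_def by blast
      next
        assume "\<exists>y\<in>free_module V (r (Suc i)). z = \<theta> (Suc i) *\<^sub>v y"
        then obtain y where yr: "y \<in> free_module V (r (Suc 0))" and zy: "z = \<theta> 1 *\<^sub>v y"
          unfolding 0 One_nat_def by (elim bexE)
        obtain a' b'' c'' where a': "a' \<in> free_module V (rA 0)" and b'': "b'' \<in> free_module V (rA 1)"
          and c'': "c'' \<in> free_module V (rB 1)" and y: "y = a' @\<^sub>v (b'' @\<^sub>v c'')"
          using splitS[OF yr] unfolding One_nat_def by (elim bexE)
        have "b @\<^sub>v c = (indet x \<cdot>\<^sub>v a' - \<phi> 1 *\<^sub>v b'') @\<^sub>v (\<alpha> 0 *\<^sub>v a' - \<psi> 1 *\<^sub>v c'')"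
          using zy zbc eq[OF a' b'' c''] y by simp
        then have "b = indet x \<cdot>\<^sub>v a' - \<phi> 1 *\<^sub>v b''" "c = \<alpha> 0 *\<^sub>v a' - \<psi> 1 *\<^sub>v c''"
          using append_vec_eq[of b "rA 0" "indet x \<cdot>\<^sub>v a' - \<phi> 1 *\<^sub>v b''"] fmc[OF b] fmc[OF a']
            mult_mat_vec_carrier[OF carA(2)[of 0], of b''] fmc[OF b''] by auto
        then show "\<theta> i *\<^sub>v z = 0\<^sub>v (dim_row (\<theta> i))"
          unfolding ker using backA[of a' 0 b''] backB[of a' 0 c''] a' b'' c'' \<alpha>0'[OF fmc[OF a']] by simp
      qed
    next
      case (Suc k)
      obtain a b c where a: "a \<in> free_module V (rA k)" and b: "b \<in> free_module V (rA i)"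
        and c: "c \<in> free_module V (rB i)" and zabc: "z = a @\<^sub>v (b @\<^sub>v c)"
        using splitS[OF z[unfolded Suc]] unfolding Suc by (elim bexE)
      have dim: "dim_row (\<theta> i) = rA' k + (rA k + rB k)"
        using homog_mat_dims[OF h\<theta>S[of k]] Suc by (simp add: r_def)
      have cars: "\<phi>' k *\<^sub>v a \<in> carrier_vec (rA' k)" "\<phi> i *\<^sub>v b \<in> carrier_vec (rA k)"
        "\<psi> i *\<^sub>v c \<in> carrier_vec (rB k)" "\<alpha> k *\<^sub>v a \<in> carrier_vec (rB k)"
        "indet x \<cdot>\<^sub>v a \<in> carrier_vec (rA k)"
        using mult_mat_vec_carrier[OF car\<phi>' fmc[OF a]] mult_mat_vec_carrier[OF car\<alpha> fmc[OF a]]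
          mult_mat_vec_carrier[OF carA(2)[of k], of b] mult_mat_vec_carrier[OF carB(2)[of k], of c]
          fmc[OF a] fmc[OF b] fmc[OF c] Suc by auto
      have \<theta>z: "\<theta> i *\<^sub>v z = (\<phi>' k *\<^sub>v a) @\<^sub>v
          ((indet x \<cdot>\<^sub>v a - \<phi> i *\<^sub>v b) @\<^sub>v (\<alpha> k *\<^sub>v a - \<psi> i *\<^sub>v c))"
        using \<theta>S[of a k b c] fmc[OF a] fmc[OF b] fmc[OF c] Suc zabc by simp
      have ker: "\<theta> i *\<^sub>v z = 0\<^sub>v (dim_row (\<theta> i)) \<longleftrightarrow>
          \<phi>' k *\<^sub>v a = 0\<^sub>v (rA' k) \<and> indet x \<cdot>\<^sub>v a = \<phi> i *\<^sub>v b \<and> \<alpha> k *\<^sub>v a = \<psi> i *\<^sub>v c"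
        unfolding \<theta>z dim append_vec_zero[symmetric]
          append_vec_eq[OF cars(1) zero_carrier_vec]
          append_vec_eq[OF minus_carrier_vec[OF cars(5,2)] zero_carrier_vec]
          vec_minus_eq_0_iff[OF cars(5,2)] vec_minus_eq_0_iff[OF cars(4,3)] ..
      \<comment> \<open>For \<open>k = 0\<close> the cone has no row for \<open>\<phi> 0\<close>, but \<open>\<phi> 0 a = 0\<close> still follows from
          \<open>x a = \<phi> b\<close>, because \<open>x\<close> is not a zero divisor.\<close>
      have ker': "\<theta> i *\<^sub>v z = 0\<^sub>v (dim_row (\<theta> i)) \<longleftrightarrow>
          \<phi> k *\<^sub>v a = 0\<^sub>v (dim_row (\<phi> k)) \<and> indet x \<cdot>\<^sub>v a = \<phi> i *\<^sub>v b \<and> \<alpha> k *\<^sub>v a = \<psi> i *\<^sub>v c"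
      proof (cases k)
        case 0
        have "\<phi>' k *\<^sub>v a = 0\<^sub>v (rA' k)"
          unfolding 0 \<phi>'_def rA'_def nat.case by (rule zero_mat_mult_vec) (use fmc[OF a] 0 in simp)
        moreover have "\<phi> k *\<^sub>v a = 0\<^sub>v (dim_row (\<phi> k))" if e: "indet x \<cdot>\<^sub>v a = \<phi> i *\<^sub>v b"
        proof -
          have ca: "a \<in> carrier_vec (rA 0)" using fmc[OF a] 0 by simp
          have "indet x \<cdot>\<^sub>v (\<phi> 0 *\<^sub>v a) = \<phi> 0 *\<^sub>v (\<phi> i *\<^sub>v b)"
            using mult_mat_smult_vec[OF carA(1) ca, of "indet x"] e by simp
          also have "\<dots> = 0\<^sub>v 1" using compA[of b 0] b Suc 0 dims by simp
          finally have "indet x * (\<phi> 0 *\<^sub>v a) $ 0 = 0" using dims by (auto simp: vec_eq_iff)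
          then have "(\<phi> 0 *\<^sub>v a) $ 0 = 0" by (rule indet_mult_eq_0D)
          then show ?thesis using dims 0 by (intro eq_vecI) auto
        qed
        ultimately show ?thesis unfolding ker by blast
      next
        case (Suc l)
        then show ?thesis unfolding ker by (simp add: \<phi>'_def rA'_def dims)
      qed
      have eq: "\<theta> (Suc i) *\<^sub>v (a' @\<^sub>v (b'' @\<^sub>v c'')) = (\<phi> i *\<^sub>v a') @\<^sub>v
          ((indet x \<cdot>\<^sub>v a' - \<phi> (Suc i) *\<^sub>v b'') @\<^sub>v (\<alpha> i *\<^sub>v a' - \<psi> (Suc i) *\<^sub>v c''))"
        if "a' \<in> free_module V (rA i)" "b'' \<in> free_module V (rA (Suc i))"
          "c'' \<in> free_module V (rB (Suc i))" for a' b'' c''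
        using \<theta>S[of a' i b'' c''] fmc[OF that(1)] fmc[OF that(2)] fmc[OF that(3)] Suc
        by (simp add: \<phi>'_def)
      show ?thesis
      proof
        assume "\<theta> i *\<^sub>v z = 0\<^sub>v (dim_row (\<theta> i))"
        then have k: "\<phi> k *\<^sub>v a = 0\<^sub>v (dim_row (\<phi> k))" "indet x \<cdot>\<^sub>v a = \<phi> i *\<^sub>v b" "\<alpha> k *\<^sub>v a = \<psi> i *\<^sub>v c"
          using ker' by blast+
        obtain a' where a': "a' \<in> free_module V (rA i)" "a = \<phi> i *\<^sub>v a'"
          using exA[OF a] k(1) Suc by blast
        obtain b'' where b'': "b'' \<in> free_module V (rA (Suc i))" "b = indet x \<cdot>\<^sub>v a' - \<phi> (Suc i) *\<^sub>v b''"
          using solveA[OF b a'(1)] k(2) a'(2) by auto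
        have "\<psi> i *\<^sub>v c = \<psi> i *\<^sub>v (\<alpha> i *\<^sub>v a')"
          using k(3) a' \<alpha>S'[of a' k] fmc[OF a'(1)] Suc by simp
        then obtain c'' where c'': "c'' \<in> free_module V (rB (Suc i))" "c = \<alpha> i *\<^sub>v a' - \<psi> (Suc i) *\<^sub>v c''"
          using solveB[OF c a'(1)] by blast
        have "z = \<theta> (Suc i) *\<^sub>v (a' @\<^sub>v (b'' @\<^sub>v c''))"
          unfolding eq[OF a'(1) b''(1) c''(1)] zabc using a'(2) b''(2) c''(2) by simp
        then show "\<exists>y\<in>free_module V (r (Suc i)). z = \<theta> (Suc i) *\<^sub>v y"
          using joinS[OF a'(1) b''(1) c''(1)] by blast
      next
        assume "\<exists>y\<in>free_module V (r (Suc i)). z = \<theta> (Suc i) *\<^sub>v y"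
        then obtain y where yr: "y \<in> free_module V (r (Suc i))" and y: "z = \<theta> (Suc i) *\<^sub>v y" by (elim bexE)
        obtain a' b'' c'' where a': "a' \<in> free_module V (rA i)" and b'': "b'' \<in> free_module V (rA (Suc i))"
          and c'': "c'' \<in> free_module V (rB (Suc i))" and yabc: "y = a' @\<^sub>v (b'' @\<^sub>v c'')"
          using splitS[OF yr] by (elim bexE)
        have zy: "z = \<theta> (Suc i) *\<^sub>v (a' @\<^sub>v (b'' @\<^sub>v c''))" unfolding y yabc ..
        have ca: "\<phi> i *\<^sub>v a' \<in> carrier_vec (rA k)"
          using mult_mat_vec_carrier[OF carA(2)[of k], of a'] fmc[OF a'] Suc by simp
        have cb: "indet x \<cdot>\<^sub>v a' - \<phi> (Suc i) *\<^sub>v b'' \<in> carrier_vec (rA i)"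
          using mult_mat_vec_carrier[OF carA(2)[of i], of b''] fmc[OF a'] fmc[OF b''] by simp
        have abc: "a = \<phi> i *\<^sub>v a'" "b = indet x \<cdot>\<^sub>v a' - \<phi> (Suc i) *\<^sub>v b''" "c = \<alpha> i *\<^sub>v a' - \<psi> (Suc i) *\<^sub>v c''"
          using zy[unfolded zabc eq[OF a' b'' c''] append_vec_eq[OF fmc[OF a] ca] append_vec_eq[OF fmc[OF b] cb]]
          by blast+
        show "\<theta> i *\<^sub>v z = 0\<^sub>v (dim_row (\<theta> i))"
          unfolding ker' abc
        proof (intro conjI)
          show "\<phi> k *\<^sub>v (\<phi> i *\<^sub>v a') = 0\<^sub>v (dim_row (\<phi> k))" using compA[of a' k] a' Suc by simp
          show "indet x \<cdot>\<^sub>v (\<phi> i *\<^sub>v a') = \<phi> i *\<^sub>v (indet x \<cdot>\<^sub>v a' - \<phi> (Suc i) *\<^sub>v b'')"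
            using backA[OF a' b''] by simp
          show "\<alpha> k *\<^sub>v (\<phi> i *\<^sub>v a') = \<psi> i *\<^sub>v (\<alpha> i *\<^sub>v a' - \<psi> (Suc i) *\<^sub>v c'')"
            using backB[OF a' c''] \<alpha>S'[of a' k] fmc[OF a'] Suc by simp
        qed
      qed
    qed
  qed
  then show ?thesis by blast
qed

section \<open>Linear resolutions of squarefree monomial ideals\<close>

lemma linear_resolution_zero:
  "\<exists>r \<phi>. linear_free_resolution V t ({0} :: ('v, 'k::comm_ring_1) mpoly set) r \<phi>"
proof (intro exI)
  define \<phi> :: "nat \<Rightarrow> ('v, 'k) mpoly mat" where "\<phi> i = 0\<^sub>m (if i = 0 then 1 else 0) 0" for i
  have z: "\<phi> 0 *\<^sub>v 0\<^sub>v 0 = 0\<^sub>v 1" using zero_mat_mult_vec[OF zero_carrier_vec, of 1 0] by (simp add: \<phi>_def)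
  show "linear_free_resolution V t ({0} :: ('v, 'k) mpoly set) (\<lambda>_. 0) \<phi>"
  proof (rule linear_free_resolutionI)
    show "\<forall>i>0. (0::nat) = 0" by simp
    show "homog_mat V t 1 0 (\<phi> 0)" "homog_mat V 1 0 0 (\<phi> (Suc i))" for i
      by (simp_all add: \<phi>_def)
    show "p \<in> {0} \<longleftrightarrow> (\<exists>x\<in>free_module V 0. p = (\<phi> 0 *\<^sub>v x) $ 0)" for p
      unfolding free_module_0 using z by simp
    fix i and x :: "('v, 'k) mpoly vec" assume "x \<in> free_module V 0"
    then have x: "x = 0\<^sub>v 0" by (simp only: free_module_0 singleton_iff)
    have "\<phi> i *\<^sub>v 0\<^sub>v 0 = 0\<^sub>v (dim_row (\<phi> i))" "\<phi> (Suc i) *\<^sub>v 0\<^sub>v 0 = 0\<^sub>v 0"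
      using zero_mat_mult_vec[OF zero_carrier_vec, of 0 0, where ?'a = "('v, 'k) mpoly"]
        zero_mat_mult_vec[OF zero_carrier_vec, of 1 0, where ?'a = "('v, 'k) mpoly"]
      by (simp_all add: \<phi>_def)
    then show "\<phi> i *\<^sub>v x = 0\<^sub>v (dim_row (\<phi> i)) \<longleftrightarrow> (\<exists>y\<in>free_module V 0. x = \<phi> (Suc i) *\<^sub>v y)"
      unfolding x free_module_0 by simp
  qed
qed

lemma linear_resolution_unit_ideal:
  "\<exists>r \<phi>. linear_free_resolution V 0 (poly_ring V :: ('v, 'k::comm_ring_1) mpoly set) r \<phi>"
proof (intro exI)
  define r :: "nat \<Rightarrow> nat" where "r i = (if i = 0 then 1 else 0)" for i
  define \<phi> :: "nat \<Rightarrow> ('v, 'k) mpoly mat" where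
    "\<phi> i = (case i of 0 \<Rightarrow> 1\<^sub>m 1 | Suc k \<Rightarrow> 0\<^sub>m (r k) 0)" for i
  have p0: "\<phi> 0 *\<^sub>v x = x" if "x \<in> free_module V 1" for x
    unfolding \<phi>_def nat.case by (rule one_mult_mat_vec[OF free_module_carrier[OF that]])
  have pS: "\<phi> (Suc k) *\<^sub>v 0\<^sub>v 0 = 0\<^sub>v (r k)" for k
    unfolding \<phi>_def nat.case by (rule zero_mat_mult_vec) simp
  show "linear_free_resolution V 0 (poly_ring V :: ('v, 'k) mpoly set) r \<phi>"
  proof (rule linear_free_resolutionI)
    show "\<forall>i>0. r i = 0" by (simp add: r_def)
    show "homog_mat V 0 1 (r 0) (\<phi> 0)" "homog_mat V 1 (r i) (r (Suc i)) (\<phi> (Suc i))" for i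
      using homog_mat_one by (simp_all add: \<phi>_def r_def)
    show "p \<in> poly_ring V \<longleftrightarrow> (\<exists>x\<in>free_module V (r 0). p = (\<phi> 0 *\<^sub>v x) $ 0)" for p
    proof
      assume "p \<in> poly_ring V"
      then have x: "vec 1 (\<lambda>_. p) \<in> free_module V 1" by (simp add: free_module_def)
      have "p = (\<phi> 0 *\<^sub>v vec 1 (\<lambda>_. p)) $ 0" unfolding p0[OF x] by simp
      then show "\<exists>x\<in>free_module V (r 0). p = (\<phi> 0 *\<^sub>v x) $ 0" using x r_def by metis
    next
      assume "\<exists>x\<in>free_module V (r 0). p = (\<phi> 0 *\<^sub>v x) $ 0"
      then obtain x where x: "x \<in> free_module V 1" "p = (\<phi> 0 *\<^sub>v x) $ 0" by (auto simp: r_def)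
      show "p \<in> poly_ring V" unfolding x(2) p0[OF x(1)] using x(1) by (simp add: free_module_def)
    qed
    fix i and x :: "('v, 'k) mpoly vec" assume x: "x \<in> free_module V (r i)"
    have rS: "r (Suc i) = 0" by (simp add: r_def)
    have "\<phi> i *\<^sub>v x = 0\<^sub>v (dim_row (\<phi> i)) \<longleftrightarrow> x = 0\<^sub>v (r i)"
    proof (cases i)
      case 0
      then show ?thesis using x p0[of x] by (simp add: r_def \<phi>_def)
    next
      case (Suc k)
      then have x0: "x = 0\<^sub>v 0" using x by (simp add: r_def)
      show ?thesis unfolding x0 Suc pS by (simp add: \<phi>_def r_def)
    qed
    then show "\<phi> i *\<^sub>v x = 0\<^sub>v (dim_row (\<phi> i)) \<longleftrightarrow> (\<exists>y\<in>free_module V (r (Suc i)). x = \<phi> (Suc i) *\<^sub>v y)"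
      unfolding rS free_module_0 using pS[of i] by simp
  qed
qed

lemma keys_indet_mult:
  "Poly_Mapping.keys (indet x * p) = (\<lambda>m. Poly_Mapping.single x 1 + m) ` Poly_Mapping.keys p"
proof (intro equalityI subsetI)
  fix m assume "m \<in> Poly_Mapping.keys (indet x * p)"
  then show "m \<in> (\<lambda>m. Poly_Mapping.single x 1 + m) ` Poly_Mapping.keys p"
    using keys_mult[of "indet x" p] by (auto simp: indet_def split: if_splits)
next
  fix m assume "m \<in> (\<lambda>m. Poly_Mapping.single x 1 + m) ` Poly_Mapping.keys p"
  then show "m \<in> Poly_Mapping.keys (indet x * p)"
    using lookup_indet_mult_single[of x p] by (auto simp: in_keys_iff)
qed

text \<open>The predicates ignore \<open>x\<close>, so dividing a monomial by \<open>x\<close> does not affect them.  A polynomial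
  on the right is split into its monomials satisfying \<open>Q\<^sub>J\<close> and the remaining ones, all of which are
  divisible by \<open>x\<close>.\<close>

lemma support_ideal_add_indet_mult:
  fixes Q\<^sub>J Q\<^sub>P :: "'v set \<Rightarrow> bool"
  assumes x: "x \<in> V" and J: "\<And>A. Q\<^sub>J (insert x A) = Q\<^sub>J A" and P: "\<And>A. Q\<^sub>P (insert x A) = Q\<^sub>P A"
  shows "{j - indet x * p | j p. j \<in> support_ideal V Q\<^sub>J \<and> p \<in> support_ideal V Q\<^sub>P} =
    (support_ideal V (\<lambda>A. Q\<^sub>J A \<or> x \<in> A \<and> Q\<^sub>P A) :: ('v, 'k::comm_ring_1) mpoly set)"
    (is "?L = ?R")
proof (intro equalityI subsetI)
  fix q :: "('v, 'k) mpoly" assume "q \<in> ?L"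
  then obtain j p where jp: "j \<in> support_ideal V Q\<^sub>J" "p \<in> support_ideal V Q\<^sub>P" "q = j - indet x * p" by blast
  have j: "j \<in> ?R" using jp(1) by (auto simp: support_ideal_def)
  have xp: "indet x * p \<in> ?R"
    using jp(2) x P by (auto simp: support_ideal_def keys_indet_mult keys_add_nat)
  show "q \<in> ?R"
    using j xp keys_diff[of j "indet x * p"] poly_ring_add[of j V "- (indet x * p)"]
    unfolding jp(3) support_ideal_def by auto
next
  fix q :: "('v, 'k) mpoly" assume q: "q \<in> ?R"
  define j where "j = restrict_monoms (\<lambda>m. Q\<^sub>J (Poly_Mapping.keys m)) q"
  define s where "s = restrict_monoms (\<lambda>m. \<not> Q\<^sub>J (Poly_Mapping.keys m)) q"
  define p where "p = - (\<Sum>m\<in>Poly_Mapping.keys s.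
    Poly_Mapping.single (m - Poly_Mapping.single x 1) (Poly_Mapping.lookup s m))"
  have s: "x \<in> Poly_Mapping.keys m" "Q\<^sub>P (Poly_Mapping.keys m)" "Poly_Mapping.keys m \<subseteq> V"
    if "m \<in> Poly_Mapping.keys s" for m
    using that q by (auto simp: s_def keys_restrict_monoms support_ideal_def poly_ring_def)
  have m: "Poly_Mapping.single x 1 + (m - Poly_Mapping.single x 1) = m"
    if "m \<in> Poly_Mapping.keys s" for m
    using single_add_minus_single[OF s(1)[OF that]] .
  have "j \<in> support_ideal V Q\<^sub>J" using q by (auto simp: j_def support_ideal_def keys_restrict_monoms)
  moreover have "p \<in> support_ideal V Q\<^sub>P"
  proof -
    have "Poly_Mapping.keys a \<subseteq> V \<and> Q\<^sub>P (Poly_Mapping.keys a)" if a: "a \<in> Poly_Mapping.keys p" for a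
    proof -
      obtain b where b: "b \<in> Poly_Mapping.keys s" "a = b - Poly_Mapping.single x 1"
        using a keys_sum[of "\<lambda>m. Poly_Mapping.single (m - Poly_Mapping.single x 1) (Poly_Mapping.lookup s m)"
            "Poly_Mapping.keys s"]
        unfolding p_def by (auto split: if_splits)
      have "insert x (Poly_Mapping.keys a) = Poly_Mapping.keys b"
        using arg_cong[OF m[OF b(1)], of Poly_Mapping.keys] unfolding keys_add_nat b(2) by simp
      then show ?thesis using s[OF b(1)] P[of "Poly_Mapping.keys a"] by auto
    qed
    then show ?thesis by (auto simp: support_ideal_def poly_ring_def)
  qed
  moreover have "q = j - indet x * p"
  proof -
    have "indet x * p = - (\<Sum>m\<in>Poly_Mapping.keys s. Poly_Mapping.single m (Poly_Mapping.lookup s m))"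
      unfolding p_def mult_minus_right sum_distrib_left indet_def mult_single
      using m by (intro arg_cong[of _ _ uminus] sum.cong) auto
    also have "(\<Sum>m\<in>Poly_Mapping.keys s. Poly_Mapping.single m (Poly_Mapping.lookup s m)) = s"
      by (rule poly_eq_sum_single[symmetric])
    finally have "j - indet x * p = j + s" by simp
    also have "\<dots> = q" unfolding j_def s_def
      by (intro poly_mapping_eqI) (auto simp: lookup_add lookup_restrict_monoms when_def)
    finally show ?thesis by simp
  qed
  ultimately show "q \<in> ?L" by blast
qed

lemma linear_resolution_support_cone:
  fixes Q\<^sub>J Q\<^sub>P :: "'v set \<Rightarrow> bool"
  assumes "\<exists>r \<phi>. linear_free_resolution V (Suc t) (support_ideal V Q\<^sub>J :: ('v, 'k::comm_ring_1) mpoly set) r \<phi>"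
    and "\<exists>r \<phi>. linear_free_resolution V t (support_ideal V Q\<^sub>P :: ('v, 'k) mpoly set) r \<phi>"
    and x: "x \<in> V" and J: "\<And>A. Q\<^sub>J (insert x A) = Q\<^sub>J A" and P: "\<And>A. Q\<^sub>P (insert x A) = Q\<^sub>P A"
    and JP: "\<And>A. Q\<^sub>J A \<Longrightarrow> Q\<^sub>P A"
  shows "\<exists>r \<phi>. linear_free_resolution V (Suc t)
    (support_ideal V (\<lambda>A. Q\<^sub>J A \<or> x \<in> A \<and> Q\<^sub>P A) :: ('v, 'k) mpoly set) r \<phi>"
proof -
  obtain r \<phi> where 1: "linear_free_resolution V (Suc t) (support_ideal V Q\<^sub>J :: ('v, 'k) mpoly set) r \<phi>"
    using assms(1) by blast
  obtain r' \<psi> where 2: "linear_free_resolution V t (support_ideal V Q\<^sub>P :: ('v, 'k) mpoly set) r' \<psi>"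
    using assms(2) by blast
  have sub: "support_ideal V Q\<^sub>J \<subseteq> (support_ideal V Q\<^sub>P :: ('v, 'k) mpoly set)"
    using JP by (auto simp: support_ideal_def)
  have colon: "p \<in> support_ideal V Q\<^sub>J"
    if "p \<in> poly_ring V" "indet x * p \<in> support_ideal V Q\<^sub>J" for p :: "('v, 'k) mpoly"
    using that J by (auto simp: support_ideal_def keys_indet_mult keys_add_nat)
  show ?thesis
    using linear_resolution_cone[OF 1 2 x sub colon]
    unfolding support_ideal_add_indet_mult[of x V Q\<^sub>J Q\<^sub>P, OF x J P] .
qed

text \<open>The Koszul resolution of an ideal of variables, obtained by adding one variable at a time:
  the cone construction applies with the unit ideal as \<open>P\<close>.\<close>

lemma linear_resolution_variables:
  assumes "finite W" "W \<subseteq> V"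
  shows "\<exists>r \<phi>. linear_free_resolution V 1
    (support_ideal V (\<lambda>A. A \<inter> W \<noteq> {}) :: ('v, 'k::comm_ring_1) mpoly set) r \<phi>"
  using assms
proof (induction W rule: finite_induct)
  case empty
  then show ?case using linear_resolution_zero by (simp add: support_ideal_False)
next
  case (insert w W)
  have e: "(\<lambda>A. A \<inter> insert w W \<noteq> {}) = (\<lambda>A. A \<inter> W \<noteq> {} \<or> w \<in> A \<and> True)" by auto
  show ?case
    unfolding e One_nat_def
  proof (rule linear_resolution_support_cone)
    show "\<exists>r \<phi>. linear_free_resolution V (Suc 0) (support_ideal V (\<lambda>A. A \<inter> W \<noteq> {}) :: ('v, 'k) mpoly set) r \<phi>"
      using insert by simp
    show "\<exists>r \<phi>. linear_free_resolution V 0 (support_ideal V (\<lambda>_. True) :: ('v, 'k) mpoly set) r \<phi>"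
      unfolding support_ideal_True by (rule linear_resolution_unit_ideal)
  qed (use insert in auto)
qed

lemma stanley_reisner_ideal_eq:
  assumes "finite V"
  shows "stanley_reisner_ideal V \<Gamma> =
    (support_ideal V (\<lambda>A. \<exists>F. F \<subseteq> V \<and> F \<notin> \<Gamma> \<and> F \<subseteq> A) :: ('v, 'k::comm_ring_1) mpoly set)"
proof -
  have "(stanley_reisner_ideal V \<Gamma> :: ('v, 'k) mpoly set) =
    ideal_gen V {squarefree_monom F | F. F \<in> {F. F \<subseteq> V \<and> F \<notin> \<Gamma>}}"
    unfolding stanley_reisner_ideal_def by simp
  also have "\<dots> = support_ideal V (\<lambda>A. \<exists>F\<in>{F. F \<subseteq> V \<and> F \<notin> \<Gamma>}. F \<subseteq> A)"
    by (rule ideal_gen_squarefree) (use assms finite_subset in auto)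
  finally show ?thesis by (simp add: Bex_def conj_assoc)
qed

section \<open>Simplicial vertices of chordal graphs\<close>

lemma shortest_path:
  assumes "(a, b) \<in> R\<^sup>*"
  obtains n f where "f 0 = a" "f n = b" "\<And>i. i < n \<Longrightarrow> (f i, f (Suc i)) \<in> R"
    "\<And>i j. i < j \<Longrightarrow> j \<le> n \<Longrightarrow> f i \<noteq> f j"
    "\<And>i j. Suc i < j \<Longrightarrow> j \<le> n \<Longrightarrow> (f i, f j) \<notin> R"
proof -
  define n where "n = (LEAST n. (a, b) \<in> R ^^ n)"
  have ex: "\<exists>n. (a, b) \<in> R ^^ n" using assms by (simp add: rtrancl_power)
  have n: "(a, b) \<in> R ^^ n" unfolding n_def by (rule LeastI_ex[OF ex])
  have least: "n \<le> m" if "(a, b) \<in> R ^^ m" for m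
    unfolding n_def using that by (rule Least_le)
  obtain f where f: "f 0 = a" "f n = b" "\<And>i. i < n \<Longrightarrow> (f i, f (Suc i)) \<in> R"
    using n unfolding relpow_fun_conv by blast
  have seg: "(f i, f j) \<in> R ^^ (j - i)" if "i \<le> j" "j \<le> n" for i j
    unfolding relpow_fun_conv using that f(3) by (intro exI[of _ "\<lambda>k. f (i + k)"]) auto
  have "f i \<noteq> f j" if "i < j" "j \<le> n" for i j
  proof
    assume "f i = f j"
    then have "(a, b) \<in> R ^^ (i + (n - j))"
      using seg[of 0 i] seg[of j n] that f(1,2) unfolding relpow_add by auto
    then show False using least that by fastforce
  qed
  moreover have "(f i, f j) \<notin> R" if "Suc i < j" "j \<le> n" for i j
  proof
    assume "(f i, f j) \<in> R"
    then have "(f i, f j) \<in> R ^^ 1" by simp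
    then have "(a, b) \<in> R ^^ (i + 1 + (n - j))"
      using seg[of 0 i] seg[of j n] that f(1,2) unfolding relpow_add by auto
    then show False using least that by fastforce
  qed
  ultimately show thesis using that f by blast
qed

lemma cycle_edges_path:
  "cycle_edges (v # map f [0..<Suc n]) =
     insert {v, f 0} (insert {f n, v} {{f i, f (Suc i)} | i. i < n})" (is "cycle_edges ?c = ?R")
proof -
  have len: "length ?c = n + 2" by simp
  have c0: "?c ! 0 = v" and cS: "\<And>i. i \<le> n \<Longrightarrow> ?c ! Suc i = f i"
    by (auto simp del: upt_Suc)
  have e: "{?c ! i, ?c ! (Suc i mod (n + 2))} =
    (if i = 0 then {v, f 0} else if i = Suc n then {f n, v} else {f (i - 1), f i})"
    if i: "i < n + 2" for i
  proof (cases i)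
    case 0
    then show ?thesis using c0 cS[of 0] by simp
  next
    case (Suc k)
    then show ?thesis using i c0 cS[of k] cS[of "Suc k"] by (cases "k = n") auto
  qed
  show ?thesis
  proof (intro equalityI subsetI)
    fix s assume "s \<in> cycle_edges ?c"
    then obtain i where i: "i < n + 2" "s = {?c ! i, ?c ! (Suc i mod (n + 2))}"
      unfolding cycle_edges_def len by blast
    show "s \<in> ?R"
    proof (cases "i = 0 \<or> i = Suc n")
      case True
      then show ?thesis using i e[OF i(1)] by (auto simp del: upt_Suc)
    next
      case False
      then have "s = {f (i - 1), f (Suc (i - 1))}" "i - 1 < n" using i e[OF i(1)] by auto
      then show ?thesis by blast
    qed
  next
    fix s assume "s \<in> ?R"
    then consider "s = {v, f 0}" | "s = {f n, v}" | i where "i < n" "s = {f i, f (Suc i)}" by blast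
    then obtain i where "i < n + 2" "s = {?c ! i, ?c ! (Suc i mod (n + 2))}"
    proof cases
      case 1
      then show ?thesis using that[of 0] e[of 0] by (simp del: upt_Suc)
    next
      case 2
      then show ?thesis using that[of "Suc n"] e[of "Suc n"] by (simp del: upt_Suc)
    next
      case 3
      then show ?thesis using that[of "Suc i"] e[of "Suc i"] by (simp del: upt_Suc)
    qed
    then show "s \<in> cycle_edges ?c" unfolding cycle_edges_def len by blast
  qed
qed

text \<open>Close a shortest path from \<open>a\<close> to \<open>b\<close> through \<open>C\<close> by the vertex \<open>v\<close>.  A chord at \<open>v\<close> would end
  in \<open>C\<close>, and any other chord would shorten the path; so if \<open>a\<close> and \<open>b\<close> were not adjacent, this would
  be a chordless cycle of length at least 4.\<close>

lemma chordal_neighbours_adjacent: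
  assumes E: "\<forall>e\<in>E. card e = 2" and ch: "chordal E"
    and v: "v \<notin> C" "\<And>c. c \<in> C \<Longrightarrow> {v, c} \<notin> E" and ab: "{v, a} \<in> E" "{v, b} \<in> E" "a \<noteq> b"
    and conn: "(a, b) \<in> {(p, q). p \<in> insert a (insert b C) \<and> q \<in> insert a (insert b C) \<and> {p, q} \<in> E}\<^sup>*"
  shows "{a, b} \<in> E"
proof (rule ccontr)
  assume nab: "{a, b} \<notin> E"
  let ?T = "insert a (insert b C)"
  define R where "R = {(p, q). p \<in> ?T \<and> q \<in> ?T \<and> {p, q} \<in> E}"
  obtain n f where f: "f 0 = a" "f n = b" "\<And>i. i < n \<Longrightarrow> (f i, f (Suc i)) \<in> R"
    and dist: "\<And>i j. i < j \<Longrightarrow> j \<le> n \<Longrightarrow> f i \<noteq> f j"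
    and short: "\<And>i j. Suc i < j \<Longrightarrow> j \<le> n \<Longrightarrow> (f i, f j) \<notin> R"
    using shortest_path[OF conn[folded R_def]] by blast
  have RD: "p \<in> ?T" "q \<in> ?T" "{p, q} \<in> E" if "(p, q) \<in> R" for p q
    using that by (auto simp: R_def)
  have loop: "{p, p} \<notin> E" for p using E by force
  have va: "v \<noteq> a" "v \<noteq> b" using ab loop by auto
  have fT: "f i \<in> ?T" if "i \<le> n" for i
    using f(2) RD(1)[OF f(3)[of i]] that by (cases "i = n") auto
  have "n \<noteq> 0" using f(1,2) ab(3) by metis
  moreover have "n \<noteq> 1" using RD(3)[OF f(3)[of 0]] f(1,2) nab by auto
  ultimately have n2: "n \<ge> 2" by simp
  let ?c = "v # map f [0..<Suc n]"
  have setc: "set ?c = insert v (f ` {..n})"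
    by (simp only: list.set set_map set_upt atLeast0LessThan lessThan_Suc_atMost)
  have cyc: "is_cycle E ?c"
    unfolding is_cycle_def
  proof (intro conjI)
    show "3 \<le> length ?c" using n2 by simp
    have "v \<notin> f ` {..n}" using fT va v(1) by auto
    moreover have "inj_on f {0..<Suc n}"
    proof (rule inj_onI)
      fix i j assume "i \<in> {0..<Suc n}" "j \<in> {0..<Suc n}" "f i = f j"
      then show "i = j" using dist[of i j] dist[of j i] by (cases i j rule: linorder_cases) auto
    qed
    ultimately show "distinct ?c" by (auto simp: distinct_map simp del: upt_Suc)
    show "cycle_edges ?c \<subseteq> E"
      unfolding cycle_edges_path using f(1,2) RD(3)[OF f(3)] ab by (auto simp: insert_commute)
  qed
  moreover have "length ?c > 3" using n2 by simp
  ultimately obtain e where e: "e \<in> E" "e \<subseteq> set ?c" "e \<notin> cycle_edges ?c"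
    using ch unfolding chordal_def has_chord_def by blast
  obtain p q where pq: "e = {p, q}" "p \<noteq> q"
    using E e(1) by (meson card_2_iff)
  have no_v: False if ev: "e = {v, y}" "y \<noteq> v" for y
  proof -
    obtain i where i: "i \<le> n" "y = f i" using e(2) ev unfolding setc by auto
    have "y \<notin> C" using v(2) e(1) ev by blast
    then have "y = f 0 \<or> y = f n" using fT[OF i(1)] i f(1,2) by auto
    then show False using e(3) ev(1) unfolding cycle_edges_path by (auto simp: insert_commute)
  qed
  have no_path: False if "i < j" "j \<le> n" "e = {f i, f j}" for i j
  proof -
    have "(f i, f j) \<in> R" using fT[of i] fT[of j] that e(1) by (auto simp: R_def)
    then have "j = Suc i" using short[of i j] that by (cases "Suc i < j") auto
    then show False using e(3) that unfolding cycle_edges_path by auto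
  qed
  consider "p = v" | "q = v" | i j where "i \<le> n" "j \<le> n" "p = f i" "q = f j"
    using e(2) pq(1) unfolding setc by auto
  then show False
  proof cases
    case 1 then show ?thesis using no_v[of q] pq by auto
  next
    case 2 then show ?thesis using no_v[of p] pq by (auto simp: insert_commute)
  next
    case 3 then show ?thesis using no_path[of i j] no_path[of j i] pq
      by (cases i j rule: linorder_cases) (auto simp: insert_commute)
  qed
qed

definition simplicial_in :: "'v set \<Rightarrow> 'v set set \<Rightarrow> 'v \<Rightarrow> bool" where
  "simplicial_in U E s \<longleftrightarrow>
     (\<forall>a\<in>U. \<forall>b\<in>U. {s, a} \<in> E \<longrightarrow> {s, b} \<in> E \<longrightarrow> a \<noteq> b \<longrightarrow> {a, b} \<in> E)"

text \<open>A form of Dirac's theorem on simplicial vertices that is strong enough for induction.  Let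
  \<open>C\<close> be a connected component of the graph on the non-neighbours of \<open>v\<close>, and \<open>S\<close> the set of
  neighbours of \<open>v\<close> that are adjacent to \<open>C\<close>.  By the previous lemma \<open>S\<close> is a clique, and all
  neighbours of vertices of \<open>C\<close> lie in \<open>C \<union> S\<close>, so it suffices to find a simplicial vertex of
  \<open>C \<union> S\<close> in \<open>C\<close>.  Unless \<open>C \<union> S\<close> is a clique, the induction hypothesis gives one among the
  non-neighbours of a vertex \<open>u\<close>, and \<open>u\<close> is chosen adjacent to all other vertices of \<open>S\<close>.\<close>

lemma chordal_simplicial_nonneighbour:
  assumes E: "\<forall>e\<in>E. card e = 2" and ch: "chordal E"
    and "finite U" "v \<in> U" "w \<in> U" "w \<noteq> v" "{v, w} \<notin> E"
  shows "\<exists>s\<in>U. s \<noteq> v \<and> {v, s} \<notin> E \<and> simplicial_in U E s"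
  using assms(3-)
proof (induction "card U" arbitrary: U v w rule: less_induct)
  case less
  have loop: "{p, p} \<notin> E" for p using E by force
  define W where "W = {u \<in> U. u \<noteq> v \<and> {v, u} \<notin> E}"
  define R where "R = {(p, q). p \<in> W \<and> q \<in> W \<and> {p, q} \<in> E}"
  define C where "C = {y. (w, y) \<in> R\<^sup>*}"
  define S where "S = {n \<in> U. {v, n} \<in> E \<and> (\<exists>c\<in>C. {n, c} \<in> E)}"
  have w: "w \<in> W" using less.prems by (simp add: W_def)
  have wC: "w \<in> C" by (simp add: C_def)
  have CW: "C \<subseteq> W"
  proof
    fix y assume "y \<in> C"
    then have "(w, y) \<in> R\<^sup>*" by (simp add: C_def)
    then show "y \<in> W" by (induction rule: rtrancl_induct) (auto simp: w R_def)
  qed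
  have Cv: "v \<notin> C" "\<And>c. c \<in> C \<Longrightarrow> {v, c} \<notin> E" using CW by (auto simp: W_def)
  have nbr: "u \<in> C \<union> S" if "c \<in> C" "u \<in> U" "{c, u} \<in> E" for c u
  proof (cases "{v, u} \<in> E")
    case True
    then show ?thesis using that by (auto simp: S_def insert_commute)
  next
    case False
    have "u \<noteq> v" using that Cv(2)[of c] by (auto simp: insert_commute)
    then have "(c, u) \<in> R" using that False CW by (auto simp: R_def W_def)
    then show ?thesis using that(1) unfolding C_def by (auto intro: rtrancl_into_rtrancl)
  qed
  have symR: "sym R" unfolding R_def sym_def by (auto simp: insert_commute)
  have clique: "{a, b} \<in> E" if ab: "a \<in> S" "b \<in> S" "a \<noteq> b" for a b
  proof -
    let ?T = "insert a (insert b C)"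
    let ?R = "{(p, q). p \<in> ?T \<and> q \<in> ?T \<and> {p, q} \<in> E}"
    obtain c d where cd: "c \<in> C" "{a, c} \<in> E" "d \<in> C" "{b, d} \<in> E"
      using ab by (auto simp: S_def)
    have toC: "(w, y) \<in> ?R\<^sup>*" if "y \<in> C" for y
    proof -
      have "(w, y) \<in> R\<^sup>*" using that by (simp add: C_def)
      then show ?thesis
      proof (induction rule: rtrancl_induct)
        case (step y z)
        have "y \<in> C" "z \<in> C" using step(1,2) by (auto simp: C_def intro: rtrancl_into_rtrancl)
        then have "(y, z) \<in> ?R" using step(2) by (auto simp: R_def)
        then show ?case using step(3) by (rule rtrancl_into_rtrancl[rotated])
      qed simp
    qed
    have sym: "sym (?R\<^sup>*)" by (intro sym_rtrancl) (auto simp: sym_def insert_commute)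
    have "(a, c) \<in> ?R" "(d, b) \<in> ?R" using cd by (auto simp: insert_commute)
    moreover have "(c, w) \<in> ?R\<^sup>*" using toC[OF cd(1)] sym by (rule symD[rotated])
    ultimately have "(a, b) \<in> ?R\<^sup>*"
      using toC[OF cd(3)] by (meson converse_rtrancl_into_rtrancl rtrancl_into_rtrancl rtrancl_trans)
    then show ?thesis
      using chordal_neighbours_adjacent[OF E ch Cv _ _ ab(3)] ab by (auto simp: S_def)
  qed
  let ?H = "C \<union> S"
  have HU: "?H \<subseteq> U" using CW by (auto simp: W_def S_def)
  have finH: "finite ?H" using HU less.prems(1) finite_subset by blast
  have "v \<notin> ?H" using Cv(1) loop by (auto simp: S_def)
  then have cardH: "card ?H < card U"
    using HU less.prems by (intro psubset_card_mono) auto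
  have up: "simplicial_in U E s" if "s \<in> C" "simplicial_in ?H E s" for s
    using that nbr[of s] unfolding simplicial_in_def by blast
  have inW: "s \<in> U \<and> s \<noteq> v \<and> {v, s} \<notin> E" if "s \<in> C" for s
    using that CW by (auto simp: W_def)
  show ?case
  proof (cases "\<forall>p\<in>?H. \<forall>q\<in>?H. p \<noteq> q \<longrightarrow> {p, q} \<in> E")
    case True
    then have "simplicial_in ?H E w" unfolding simplicial_in_def by blast
    then show ?thesis using up[OF wC] inW[OF wC] by blast
  next
    case False
    have "\<exists>u\<in>?H. (\<exists>q\<in>?H. q \<noteq> u \<and> {u, q} \<notin> E) \<and> (\<forall>s\<in>S. s \<noteq> u \<longrightarrow> {u, s} \<in> E)"
    proof (cases "\<exists>u\<in>S. \<exists>q\<in>?H. q \<noteq> u \<and> {u, q} \<notin> E")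
      case True
      then obtain u q where u: "u \<in> S" "q \<in> ?H" "q \<noteq> u" "{u, q} \<notin> E" by blast
      show ?thesis
      proof (rule bexI[of _ u], intro conjI ballI impI)
        show "\<exists>q\<in>?H. q \<noteq> u \<and> {u, q} \<notin> E" using u by blast
        show "{u, s} \<in> E" if "s \<in> S" "s \<noteq> u" for s using clique[of u s] u(1) that by simp
      qed (use u in simp)
    next
      case F: False
      obtain p q where pq: "p \<in> ?H" "q \<in> ?H" "p \<noteq> q" "{p, q} \<notin> E" using False by blast
      show ?thesis
      proof (rule bexI[of _ p], intro conjI ballI impI)
        show "\<exists>q\<in>?H. q \<noteq> p \<and> {p, q} \<notin> E" using pq by (intro bexI[of _ q]) auto
        show "{p, s} \<in> E" if "s \<in> S" "s \<noteq> p" for s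
        proof -
          have "{s, p} \<in> E" using F pq(1) that by metis
          then show ?thesis by (simp add: insert_commute)
        qed
      qed (fact pq(1))
    qed
    then obtain u q where u: "u \<in> ?H" "q \<in> ?H" "q \<noteq> u" "{u, q} \<notin> E" "\<forall>s\<in>S. s \<noteq> u \<longrightarrow> {u, s} \<in> E"
      by (elim bexE conjE)
    obtain s where s: "s \<in> ?H" "s \<noteq> u" "{u, s} \<notin> E" "simplicial_in ?H E s"
      using less.hyps[OF cardH finH u(1-4)] by (elim bexE conjE)
    then have "s \<in> C" using u(5) by (metis UnE)
    then show ?thesis using up[OF _ s(4)] inW[of s] by (intro bexI[of _ s]) simp_all
  qed
qed

lemma chordal_simplicial_vertex:
  assumes E: "\<forall>e\<in>E. card e = 2" and ch: "chordal E" and U: "finite U" "U \<noteq> {}"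
  shows "\<exists>s\<in>U. simplicial_in U E s"
proof (cases "\<exists>v\<in>U. \<exists>w\<in>U. w \<noteq> v \<and> {v, w} \<notin> E")
  case True
  then show ?thesis using chordal_simplicial_nonneighbour[OF E ch U(1)] by blast
next
  case False
  obtain s where s: "s \<in> U" using U(2) by blast
  have "simplicial_in U E s"
    unfolding simplicial_in_def
  proof (intro ballI impI)
    fix a b assume "a \<in> U" "b \<in> U" "a \<noteq> b"
    then show "{a, b} \<in> E" using False by metis
  qed
  with s show ?thesis by blast
qed

section \<open>Chordal graphs give linear resolutions\<close>

text \<open>Remove a simplicial vertex \<open>s\<close> of the graph on \<open>U\<close>, and let \<open>W\<close> be the set of the other
  vertices not adjacent to \<open>s\<close>.  The non-edges in \<open>U\<close> are those in \<open>U - {s}\<close> and the pairs \<open>{s, w}\<close> with \<open>w \<in> W\<close>,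
  so the ideal is \<open>J + x\<^sub>s (W)\<close>.  Since two vertices of \<open>U - {s}\<close> outside \<open>W\<close> are neighbours of
  \<open>s\<close> and hence adjacent, every non-edge in \<open>U - {s}\<close> meets \<open>W\<close>; that is, \<open>J \<subseteq> (W)\<close>, as the cone requires.\<close>

lemma chordal_linear_resolution:
  assumes E: "\<forall>e\<in>E. card e = 2" and ch: "chordal E" and V: "finite V" and UV: "U \<subseteq> V"
  shows "\<exists>r \<phi>. linear_free_resolution V 2
    (support_ideal V (\<lambda>A. \<exists>a\<in>A \<inter> U. \<exists>b\<in>A \<inter> U. a \<noteq> b \<and> {a, b} \<notin> E) :: ('v, 'k::comm_ring_1) mpoly set) r \<phi>"
  using finite_subset[OF UV V] UV
proof (induction U rule: finite_psubset_induct)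
  case (psubset U)
  define Q where "Q U A \<longleftrightarrow> (\<exists>a\<in>A \<inter> U. \<exists>b\<in>A \<inter> U. a \<noteq> b \<and> {a, b} \<notin> E)" for U A
  show ?case
  proof (cases "U = {}")
    case True
    then show ?thesis using linear_resolution_zero by (simp add: support_ideal_False)
  next
    case False
    obtain s where s: "s \<in> U" "simplicial_in U E s"
      using chordal_simplicial_vertex[OF E ch psubset.hyps False] by blast
    define W where "W = {u \<in> U. u \<noteq> s \<and> {s, u} \<notin> E}"
    have step: "Q U A \<longleftrightarrow> Q (U - {s}) A \<or> s \<in> A \<and> A \<inter> W \<noteq> {}" for A
    proof
      assume "Q U A"
      then obtain a b where ab: "a \<in> A" "b \<in> A" "a \<in> U" "b \<in> U" "a \<noteq> b" "{a, b} \<notin> E"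
        by (auto simp: Q_def)
      consider "a = s" | "b = s" | "a \<noteq> s" "b \<noteq> s" by blast
      then show "Q (U - {s}) A \<or> s \<in> A \<and> A \<inter> W \<noteq> {}"
      proof cases
        case 1 then have "b \<in> A \<inter> W" using ab by (simp add: W_def)
        then show ?thesis using 1 ab by blast
      next
        case 2 then have "a \<in> A \<inter> W" using ab by (simp add: W_def insert_commute)
        then show ?thesis using 2 ab by blast
      next
        case 3
        have "Q (U - {s}) A" unfolding Q_def
          by (rule bexI[of _ a], rule bexI[of _ b]) (use ab 3 in simp_all)
        then show ?thesis ..
      qed
    next
      assume "Q (U - {s}) A \<or> s \<in> A \<and> A \<inter> W \<noteq> {}"
      then show "Q U A"
      proof
        assume "Q (U - {s}) A"
        then show ?thesis by (auto simp: Q_def)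
      next
        assume "s \<in> A \<and> A \<inter> W \<noteq> {}"
        then obtain u where u: "s \<in> A" "u \<in> A" "u \<in> U" "u \<noteq> s" "{s, u} \<notin> E" by (auto simp: W_def)
        show ?thesis unfolding Q_def
          by (rule bexI[of _ s], rule bexI[of _ u]) (use u s(1) in auto)
      qed
    qed
    have "\<exists>r \<phi>. linear_free_resolution V (Suc 1)
      (support_ideal V (\<lambda>A. Q (U - {s}) A \<or> s \<in> A \<and> A \<inter> W \<noteq> {}) :: ('v, 'k) mpoly set) r \<phi>"
    proof (rule linear_resolution_support_cone)
      have "U - {s} \<subset> U" using s(1) by blast
      then have "\<exists>r \<phi>. linear_free_resolution V 2 (support_ideal V (Q (U - {s})) :: ('v, 'k) mpoly set) r \<phi>"
        unfolding Q_def using psubset.prems by (intro psubset.IH) auto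
      then show "\<exists>r \<phi>. linear_free_resolution V (Suc 1) (support_ideal V (Q (U - {s})) :: ('v, 'k) mpoly set) r \<phi>"
        by (simp only: Suc_1)
      show "\<exists>r \<phi>. linear_free_resolution V 1 (support_ideal V (\<lambda>A. A \<inter> W \<noteq> {}) :: ('v, 'k) mpoly set) r \<phi>"
        by (rule linear_resolution_variables) (use psubset.hyps psubset.prems in \<open>auto simp: W_def\<close>)
      show "s \<in> V" using s(1) psubset.prems by blast
      show "Q (U - {s}) (insert s A) = Q (U - {s}) A" for A by (simp add: Q_def)
      show "(insert s A \<inter> W \<noteq> {}) = (A \<inter> W \<noteq> {})" for A by (simp add: W_def)
      show "A \<inter> W \<noteq> {}" if QA: "Q (U - {s}) A" for A
      proof
        assume e: "A \<inter> W = {}"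
        obtain a b where ab: "a \<in> A" "b \<in> A" "a \<in> U" "b \<in> U" "a \<noteq> s" "b \<noteq> s" "a \<noteq> b" "{a, b} \<notin> E"
          using QA by (auto simp: Q_def)
        have "a \<notin> W" "b \<notin> W" using e ab(1,2) by blast+
        then have "{s, a} \<in> E" "{s, b} \<in> E" using ab by (simp_all add: W_def)
        then show False using s(2) ab unfolding simplicial_in_def by blast
      qed
    qed
    then show ?thesis unfolding step[symmetric] Suc_1 unfolding Q_def .
  qed
qed

lemma not_in_one_closure_iff:
  assumes V: "finite V" and F: "F \<subseteq> V"
  shows "F \<notin> one_closure V E \<longleftrightarrow> (\<exists>a\<in>F. \<exists>b\<in>F. a \<noteq> b \<and> {a, b} \<notin> E)"
proof
  have fin: "finite F" using F V finite_subset by blast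
  assume n: "F \<notin> one_closure V E"
  then have c2: "\<not> card F \<le> 1" using F by (simp add: one_closure_def)
  have "\<exists>e. e \<subseteq> F \<and> card e = 2 \<and> e \<notin> E"
  proof (cases "card F = 2")
    case True
    then have "F \<notin> E" using n F by (simp add: one_closure_def)
    then show ?thesis using True by blast
  next
    case False
    then have "card F > 2" using c2 by simp
    then show ?thesis using n F unfolding one_closure_def by blast
  qed
  then obtain e where e: "e \<subseteq> F" "card e = 2" "e \<notin> E" by blast
  obtain a b where "e = {a, b}" "a \<noteq> b" using e(2) by (auto simp: card_2_iff)
  then show "\<exists>a\<in>F. \<exists>b\<in>F. a \<noteq> b \<and> {a, b} \<notin> E" using e by blast
next
  have fin: "finite F" using F V finite_subset by blast
  assume "\<exists>a\<in>F. \<exists>b\<in>F. a \<noteq> b \<and> {a, b} \<notin> E"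
  then obtain a b where ab: "a \<in> F" "b \<in> F" "a \<noteq> b" "{a, b} \<notin> E" by blast
  have sub: "{a, b} \<subseteq> F" and c: "card {a, b} = 2" using ab by simp_all
  have "2 \<le> card F" using card_mono[OF fin sub] c by simp
  moreover have "F = {a, b}" if "card F = 2"
    using card_subset_eq[OF fin sub] c that by simp
  ultimately show "F \<notin> one_closure V E"
    using ab sub c unfolding one_closure_def by force
qed

lemma chordal_imp_linear_resolution:
  assumes "simple_graph V E" "chordal E"
  shows "has_linear_resolution 2 V
    (stanley_reisner_ideal V (one_closure V E) :: ('v, 'k::comm_ring_1) mpoly set)"
proof -
  have V: "finite V" and E: "\<forall>e\<in>E. card e = 2" using assms(1) by (auto simp: simple_graph_def)
  have Q: "(\<exists>F. F \<subseteq> V \<and> F \<notin> one_closure V E \<and> F \<subseteq> A) \<longleftrightarrow>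
    (\<exists>a\<in>A \<inter> V. \<exists>b\<in>A \<inter> V. a \<noteq> b \<and> {a, b} \<notin> E)" for A
  proof
    assume "\<exists>F. F \<subseteq> V \<and> F \<notin> one_closure V E \<and> F \<subseteq> A"
    then obtain F where F: "F \<subseteq> V" "F \<notin> one_closure V E" "F \<subseteq> A" by blast
    then show "\<exists>a\<in>A \<inter> V. \<exists>b\<in>A \<inter> V. a \<noteq> b \<and> {a, b} \<notin> E"
      unfolding not_in_one_closure_iff[OF V F(1)] by blast
  next
    assume "\<exists>a\<in>A \<inter> V. \<exists>b\<in>A \<inter> V. a \<noteq> b \<and> {a, b} \<notin> E"
    then have "A \<inter> V \<notin> one_closure V E" unfolding not_in_one_closure_iff[OF V Int_lower2] .
    then show "\<exists>F. F \<subseteq> V \<and> F \<notin> one_closure V E \<and> F \<subseteq> A" by (intro exI[of _ "A \<inter> V"]) simp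
  qed
  show ?thesis
    unfolding has_linear_resolution_iff stanley_reisner_ideal_eq[OF V] Q
    by (rule chordal_linear_resolution[OF E assms(2) V order_refl])
qed

section \<open>Koszul chains in characteristic 2\<close>

lemma char_2_add_self:
  assumes "CHAR('k::comm_ring_1) = 2"
  shows "(p :: ('v, 'k) mpoly) + p = 0"
proof -
  have "of_nat 2 = (0::'k)" using of_nat_CHAR[where ?'a = 'k] assms by simp
  then have two: "(1::'k) + 1 = 0" by simp
  have cc: "c + c = 0" for c :: 'k
    using arg_cong[OF two, of "\<lambda>x. c * x"] by (simp only: distrib_left mult_1_right mult_zero_right)
  show ?thesis by (rule poly_mapping_eqI, unfold lookup_add lookup_zero) (rule cc)
qed

lemma char_2_eq_iff:
  assumes "CHAR('k::comm_ring_1) = 2"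
  shows "(p :: ('v, 'k) mpoly) + q = 0 \<longleftrightarrow> p = q"
  by (metis add_left_cancel char_2_add_self[OF assms])

lemma sum_off_diagonal_eq_0:
  fixes h :: "'a \<Rightarrow> 'a \<Rightarrow> 'b::comm_monoid_add"
  assumes "finite A" and two: "\<And>x::'b. x + x = 0" and sym: "\<And>a b. h a b = h b a"
  shows "(\<Sum>a\<in>A. \<Sum>b\<in>A - {a}. h a b) = 0"
  using assms(1)
proof (induction A rule: finite_induct)
  case (insert x A)
  have "(\<Sum>a\<in>A. \<Sum>b\<in>insert x A - {a}. h a b) = (\<Sum>a\<in>A. h a x + (\<Sum>b\<in>A - {a}. h a b))"
  proof (intro sum.cong refl)
    fix a assume "a \<in> A"
    then have "insert x A - {a} = insert x (A - {a})" using insert by auto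
    then show "(\<Sum>b\<in>insert x A - {a}. h a b) = h a x + (\<Sum>b\<in>A - {a}. h a b)"
      using insert by simp
  qed
  also have "\<dots> = (\<Sum>a\<in>A. h x a)" using insert by (simp add: sum.distrib sym)
  finally show ?case using insert two by simp
qed simp

text \<open>The Koszul differential on families of vectors indexed by subsets of \<open>V\<close>; the value at \<open>S\<close> is
  the coefficient of the basis element \<open>e\<^sub>S\<close>.  It carries no signs: in
  \<open>koszul_diff_koszul_diff\<close> the terms cancel in equal pairs, by characteristic 2.\<close>

definition koszul_diff ::
  "'v set \<Rightarrow> nat \<Rightarrow> ('v set \<Rightarrow> ('v, 'k::comm_ring_1) mpoly vec) \<Rightarrow> 'v set \<Rightarrow> ('v, 'k) mpoly vec" where
  "koszul_diff V n u S = vec n (\<lambda>j. \<Sum>v\<in>V - S. indet v * u (insert v S) $ j)"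

lemma koszul_diff_carrier [simp]: "koszul_diff V n u S \<in> carrier_vec n"
  by (simp add: koszul_diff_def)

lemma koszul_diff_cong:
  "(\<And>v. v \<in> V - S \<Longrightarrow> u (insert v S) = u' (insert v S)) \<Longrightarrow> koszul_diff V n u S = koszul_diff V n u' S"
  unfolding koszul_diff_def by (intro arg_cong[of _ _ "vec n"] ext sum.cong refl) simp

lemma koszul_diff_free_module:
  "(\<And>v. v \<in> V - S \<Longrightarrow> u (insert v S) \<in> free_module V n) \<Longrightarrow> koszul_diff V n u S \<in> free_module V n"
  by (auto simp: koszul_diff_def free_module_def)

lemma koszul_diff_koszul_diff:
  fixes u :: "'v set \<Rightarrow> ('v, 'k::comm_ring_1) mpoly vec"
  assumes "CHAR('k) = 2" "finite V"
  shows "koszul_diff V n (koszul_diff V n u) S = 0\<^sub>v n"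
proof (rule eq_vecI)
  fix j assume "j < dim_vec (0\<^sub>v n :: ('v, 'k) mpoly vec)"
  then have j: "j < n" by simp
  have "koszul_diff V n (koszul_diff V n u) S $ j =
    (\<Sum>v\<in>V - S. \<Sum>y\<in>(V - S) - {v}. indet v * indet y * u (insert y (insert v S)) $ j)"
  proof -
    have "koszul_diff V n (koszul_diff V n u) S $ j =
      (\<Sum>v\<in>V - S. indet v * (\<Sum>y\<in>V - insert v S. indet y * u (insert y (insert v S)) $ j))"
      using j by (simp add: koszul_diff_def)
    also have "\<dots> = (\<Sum>v\<in>V - S. \<Sum>y\<in>(V - S) - {v}. indet v * indet y * u (insert y (insert v S)) $ j)"
      unfolding sum_distrib_left mult.assoc by (intro sum.cong refl) auto
    finally show ?thesis .
  qed
  also have "\<dots> = 0"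
  proof (rule sum_off_diagonal_eq_0)
    show "finite (V - S)" using assms by simp
    show "x + x = 0" for x :: "('v, 'k) mpoly" by (rule char_2_add_self[OF assms(1)])
    show "indet a * indet b * u (insert b (insert a S)) $ j = indet b * indet a * u (insert a (insert b S)) $ j"
      for a b by (simp only: insert_commute[of a b] mult.commute[of "indet a" "indet b"])
  qed
  finally show "koszul_diff V n (koszul_diff V n u) S $ j = 0\<^sub>v n $ j" using j by simp
qed (simp add: koszul_diff_def)

lemma mult_mat_koszul_diff:
  fixes A :: "('v, 'k::comm_ring_1) mpoly mat"
  assumes A: "A \<in> carrier_mat nr nc" and u: "\<And>v. v \<in> V - S \<Longrightarrow> u (insert v S) \<in> carrier_vec nc"
  shows "A *\<^sub>v koszul_diff V nc u S = koszul_diff V nr (\<lambda>S. A *\<^sub>v u S) S"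
proof (rule eq_vecI)
  fix i assume "i < dim_vec (koszul_diff V nr (\<lambda>S. A *\<^sub>v u S) S)"
  then have i: "i < nr" by (simp add: koszul_diff_def)
  have "(A *\<^sub>v koszul_diff V nc u S) $ i =
      (\<Sum>j<nc. A $$ (i, j) * (\<Sum>v\<in>V - S. indet v * u (insert v S) $ j))"
    unfolding mult_mat_vec_index[OF A koszul_diff_carrier i] by (simp add: koszul_diff_def)
  also have "\<dots> = (\<Sum>v\<in>V - S. \<Sum>j<nc. A $$ (i, j) * (indet v * u (insert v S) $ j))"
    unfolding sum_distrib_left by (rule sum.swap)
  also have "\<dots> = (\<Sum>v\<in>V - S. indet v * (A *\<^sub>v u (insert v S)) $ i)"
  proof (intro sum.cong refl)
    fix v assume v: "v \<in> V - S"
    show "(\<Sum>j<nc. A $$ (i, j) * (indet v * u (insert v S) $ j)) = indet v * (A *\<^sub>v u (insert v S)) $ i"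
      unfolding mult_mat_vec_index[OF A u[OF v] i] sum_distrib_left by (simp add: mult.left_commute)
  qed
  finally show "(A *\<^sub>v koszul_diff V nc u S) $ i = koszul_diff V nr (\<lambda>S. A *\<^sub>v u S) S $ i"
    using i by (simp add: koszul_diff_def)
qed (use A in \<open>simp add: koszul_diff_def\<close>)

text \<open>The Koszul complex of the polynomial ring is exact in positive degrees.  It is the direct sum
  of its multigraded parts, and in the part of a multidegree with nonempty support a contracting
  homotopy is given by removing a fixed variable \<open>v\<close> of the support from the monomial and adding it
  to \<open>S\<close>.  The support of the multidegree of the term \<open>m\<close> at \<open>S\<close> is \<open>keys m \<union> S\<close>, and \<open>g S m\<close> is the
  coefficient of the image of \<open>u\<close> under this homotopy.\<close>

lemma koszul_exact_poly:
  fixes u :: "'v set \<Rightarrow> ('v, 'k::comm_ring_1) mpoly"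
  assumes char: "CHAR('k) = 2" and V: "finite V"
    and u: "\<And>S. S \<subseteq> V \<Longrightarrow> card S = Suc i \<Longrightarrow> u S \<in> poly_ring V"
    and cycle: "\<And>S. S \<subseteq> V \<Longrightarrow> card S = i \<Longrightarrow> (\<Sum>v\<in>V - S. indet v * u (insert v S)) = 0"
  shows "\<exists>w. (\<forall>S. w S \<in> poly_ring V) \<and>
    (\<forall>S. S \<subseteq> V \<longrightarrow> card S = Suc i \<longrightarrow> u S = (\<Sum>v\<in>V - S. indet v * w (insert v S)))"
proof -
  define pick :: "'v set \<Rightarrow> 'v" where "pick A = (SOME v. v \<in> A)" for A
  have pick: "pick A \<in> A" if "A \<noteq> {}" for A
    unfolding pick_def using that by (simp add: some_in_eq)
  let ?e = "\<lambda>v. Poly_Mapping.single v (1::nat)"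
  define g where "g S m = (if S \<subseteq> V \<and> card S = Suc (Suc i) \<and> pick (Poly_Mapping.keys m \<union> S) \<in> S
    then Poly_Mapping.lookup (u (S - {pick (Poly_Mapping.keys m \<union> S)})) (?e (pick (Poly_Mapping.keys m \<union> S)) + m)
    else 0)" for S and m :: "'v \<Rightarrow>\<^sub>0 nat"
  define w where "w S = Abs_poly_mapping (g S)" for S
  have fin: "finite {m. g S m \<noteq> 0}" for S
  proof (cases "S \<subseteq> V")
    case True
    have "{m. g S m \<noteq> 0} \<subseteq> (\<Union>v\<in>S. (\<lambda>m. ?e v + m) -` Poly_Mapping.keys (u (S - {v})))"
      by (auto simp: g_def in_keys_iff split: if_splits)
    moreover have "finite \<dots>"
      using True V by (intro finite_UN_I finite_vimageI) (auto intro: finite_subset injI)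
    ultimately show ?thesis by (rule finite_subset)
  qed (simp add: g_def)
  have lookup_w: "Poly_Mapping.lookup (w S) m = g S m" for S m
    unfolding w_def using fin by (simp add: lookup_Abs_poly_mapping)
  have w: "w S \<in> poly_ring V" for S
    unfolding poly_ring_def
  proof (intro CollectI ballI)
    fix m assume "m \<in> Poly_Mapping.keys (w S)"
    then have g: "g S m \<noteq> 0" by (simp add: in_keys_iff lookup_w)
    define v where "v = pick (Poly_Mapping.keys m \<union> S)"
    have S: "S \<subseteq> V" "card S = Suc (Suc i)" "v \<in> S" "?e v + m \<in> Poly_Mapping.keys (u (S - {v}))"
      using g by (auto simp: g_def v_def in_keys_iff split: if_splits)
    have "card (S - {v}) = Suc i" using S by simp
    then have "Poly_Mapping.keys (?e v + m) \<subseteq> V"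
      using u[of "S - {v}"] S by (auto simp: poly_ring_def)
    then show "Poly_Mapping.keys m \<subseteq> V" by (simp add: keys_add_nat)
  qed
  have "u S = (\<Sum>v\<in>V - S. indet v * w (insert v S))" if S: "S \<subseteq> V" "card S = Suc i" for S
  proof (rule poly_mapping_eqI)
    fix m
    let ?r = "\<Sum>v\<in>V - S. indet v * w (insert v S)"
    show "Poly_Mapping.lookup (u S) m = Poly_Mapping.lookup ?r m"
    proof (cases "Poly_Mapping.keys m \<subseteq> V")
      case False
      have "?r \<in> poly_ring V" using w by (intro poly_ring_sum poly_ring_mult) auto
      then have "m \<notin> Poly_Mapping.keys ?r" "m \<notin> Poly_Mapping.keys (u S)"
        using False u[OF S] by (auto simp: poly_ring_def)
      then show ?thesis by (simp add: in_keys_iff)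
    next
      case m: True
      have finS: "finite S" using S V finite_subset by blast
      define v where "v = pick (Poly_Mapping.keys m \<union> S)"
      have v: "v \<in> Poly_Mapping.keys m \<union> S" unfolding v_def using S by (intro pick) auto
      have r: "Poly_Mapping.lookup ?r m =
        (\<Sum>y\<in>V - S. if y \<in> Poly_Mapping.keys m then
           (if v \<in> insert y S then Poly_Mapping.lookup (u (insert y S - {v})) (?e v + (m - ?e y)) else 0) else 0)"
        unfolding lookup_sum lookup_indet_mult
      proof (intro sum.cong refl if_cong)
        fix y assume y: "y \<in> V - S" "y \<in> Poly_Mapping.keys m"
        have "Poly_Mapping.keys (m - ?e y) \<union> insert y S = Poly_Mapping.keys m \<union> S"
          using y by (auto simp: in_keys_iff lookup_minus lookup_single when_def split: if_splits)
        moreover have "card (insert y S) = Suc (Suc i)" using y S finS by simp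
        ultimately show "Poly_Mapping.lookup (w (insert y S)) (m - ?e y) =
            (if v \<in> insert y S then Poly_Mapping.lookup (u (insert y S - {v})) (?e v + (m - ?e y)) else 0)"
          using y S unfolding lookup_w g_def v_def by simp
      qed
      show ?thesis
      proof (cases "v \<in> S")
        case False
        then have vm: "v \<in> Poly_Mapping.keys m" "v \<in> V - S" using v m by auto
        have em: "?e v + (m - ?e v) = m" by (rule single_add_minus_single[OF vm(1)])
        have "Poly_Mapping.lookup ?r m = (\<Sum>y\<in>V - S. if y = v then Poly_Mapping.lookup (u S) m else 0)"
          unfolding r using False vm em by (intro sum.cong refl) auto
        then show ?thesis using vm V by simp
      next
        case True
        define S' where "S' = S - {v}"
        have S': "S' \<subseteq> V" "card S' = i" using S True by (auto simp: S'_def)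
        have VS: "V - S' = insert v (V - S)" using True S by (auto simp: S'_def)
        have "0 = Poly_Mapping.lookup (\<Sum>y\<in>V - S'. indet y * u (insert y S')) (?e v + m)"
          unfolding cycle[OF S'] by simp
        also have "\<dots> = Poly_Mapping.lookup (indet v * u (insert v S')) (?e v + m) +
            (\<Sum>y\<in>V - S. Poly_Mapping.lookup (indet y * u (insert y S')) (?e v + m))"
          unfolding VS lookup_sum using True V by simp
        also have "Poly_Mapping.lookup (indet v * u (insert v S')) (?e v + m) = Poly_Mapping.lookup (u S) m"
          unfolding lookup_indet_mult_single using True by (simp add: S'_def insert_absorb)
        also have "(\<Sum>y\<in>V - S. Poly_Mapping.lookup (indet y * u (insert y S')) (?e v + m)) =
            Poly_Mapping.lookup ?r m"
          unfolding r
        proof (intro sum.cong refl)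
          fix y assume y: "y \<in> V - S"
          then have yv: "y \<noteq> v" using True by auto
          have i: "insert y S - {v} = insert y S'" using yv by (auto simp: S'_def)
          have k: "y \<in> Poly_Mapping.keys (?e v + m) \<longleftrightarrow> y \<in> Poly_Mapping.keys m"
            using yv by (simp add: keys_add_nat)
          have "?e v + m - ?e y = ?e v + (m - ?e y)"
            using yv by (intro poly_mapping_eqI) (auto simp: lookup_add lookup_minus lookup_single when_def)
          then show "Poly_Mapping.lookup (indet y * u (insert y S')) (?e v + m) =
            (if y \<in> Poly_Mapping.keys m then
              (if v \<in> insert y S then Poly_Mapping.lookup (u (insert y S - {v})) (?e v + (m - ?e y)) else 0) else 0)"
            unfolding lookup_indet_mult k i using True by simp
        qed
        finally have "0 = Poly_Mapping.lookup (u S + ?r) m" by (simp add: lookup_add)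
        moreover have "c + d = 0 \<longleftrightarrow> c = d" for c d :: 'k
          using char_2_eq_iff[OF char, of "Poly_Mapping.single (0 :: 'v \<Rightarrow>\<^sub>0 nat) c" "Poly_Mapping.single 0 d"]
          by (metis inj_single injD single_add single_zero)
        ultimately show ?thesis by (simp add: lookup_add)
      qed
    qed
  qed
  with w show ?thesis by blast
qed

lemma koszul_exact:
  fixes u :: "'v set \<Rightarrow> ('v, 'k::comm_ring_1) mpoly vec"
  assumes char: "CHAR('k) = 2" and V: "finite V"
    and u: "\<And>S. S \<subseteq> V \<Longrightarrow> card S = Suc i \<Longrightarrow> u S \<in> free_module V n"
    and cycle: "\<And>S. S \<subseteq> V \<Longrightarrow> card S = i \<Longrightarrow> koszul_diff V n u S = 0\<^sub>v n"
  shows "\<exists>w. (\<forall>S. w S \<in> free_module V n) \<and>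
    (\<forall>S. S \<subseteq> V \<longrightarrow> card S = Suc i \<longrightarrow> u S = koszul_diff V n w S)"
proof -
  have "\<forall>j\<in>{..<n}. \<exists>w. (\<forall>S. w S \<in> poly_ring V) \<and>
    (\<forall>S. S \<subseteq> V \<longrightarrow> card S = Suc i \<longrightarrow> u S $ j = (\<Sum>v\<in>V - S. indet v * w (insert v S)))"
  proof (intro ballI koszul_exact_poly[OF char V])
    fix j assume "j \<in> {..<n}"
    then have j: "j < n" by simp
    show "u S $ j \<in> poly_ring V" if "S \<subseteq> V" "card S = Suc i" for S
      using u[OF that] j by (simp add: free_module_def)
    show "(\<Sum>v\<in>V - S. indet v * u (insert v S) $ j) = 0" if "S \<subseteq> V" "card S = i" for S
      using arg_cong[OF cycle[OF that], of "\<lambda>x. x $ j"] j by (simp add: koszul_diff_def)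
  qed
  from bchoice[OF this] obtain w' where w': "\<forall>j\<in>{..<n}. (\<forall>S. w' j S \<in> poly_ring V) \<and>
    (\<forall>S. S \<subseteq> V \<longrightarrow> card S = Suc i \<longrightarrow> u S $ j = (\<Sum>v\<in>V - S. indet v * w' j (insert v S)))" ..
  define w where "w = w'"
  have w: "\<And>j S. j < n \<Longrightarrow> w j S \<in> poly_ring V"
    "\<And>j S. j < n \<Longrightarrow> S \<subseteq> V \<Longrightarrow> card S = Suc i \<Longrightarrow> u S $ j = (\<Sum>v\<in>V - S. indet v * w j (insert v S))"
    unfolding w_def using w' by simp_all
  show ?thesis
  proof (intro exI[of _ "\<lambda>S. vec n (\<lambda>j. w j S)"] conjI allI impI)
    show "vec n (\<lambda>j. w j S) \<in> free_module V n" for S using w(1) by (simp add: free_module_def)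
    fix S assume S: "S \<subseteq> V" "card S = Suc i"
    show "u S = koszul_diff V n (\<lambda>S. vec n (\<lambda>j. w j S)) S"
      using w(2)[OF _ S] free_module_carrier[OF u[OF S]]
      by (intro eq_vecI) (auto simp: koszul_diff_def)
  qed
qed

lemma poly_no_constant_term:
  fixes p :: "('v, 'k::comm_ring_1) mpoly"
  assumes V: "finite V" and p: "p \<in> poly_ring V" and z: "homog_comp 0 p = 0"
  shows "\<exists>f. (\<forall>v. f v \<in> poly_ring V) \<and> p = (\<Sum>v\<in>V. indet v * f v)"
proof -
  let ?e = "\<lambda>v. Poly_Mapping.single v (1::nat)"
  have "\<exists>v. v \<in> Poly_Mapping.keys m" if "m \<in> Poly_Mapping.keys p" for m
  proof (rule ccontr)
    assume "\<nexists>v. v \<in> Poly_Mapping.keys m"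
    then have "m = 0" using keys_eq_empty by blast
    then have "Poly_Mapping.lookup (homog_comp 0 p) m \<noteq> 0"
      using that by (simp add: lookup_homog_comp in_keys_iff)
    then show False using z by simp
  qed
  then obtain g where g: "\<And>m. m \<in> Poly_Mapping.keys p \<Longrightarrow> g m \<in> Poly_Mapping.keys m" by metis
  have gV: "g m \<in> V" if "m \<in> Poly_Mapping.keys p" for m
    using g[OF that] p that by (auto simp: poly_ring_def)
  define q where "q m = Poly_Mapping.single (m - ?e (g m)) (Poly_Mapping.lookup p m)" for m
  define f where "f v = (\<Sum>m\<in>{m \<in> Poly_Mapping.keys p. g m = v}. q m)" for v
  have q: "indet (g m) * q m = Poly_Mapping.single m (Poly_Mapping.lookup p m)"
    if "m \<in> Poly_Mapping.keys p" for m
  proof -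
    have "?e (g m) + (m - ?e (g m)) = m"
      by (rule single_add_minus_single[OF g[OF that]])
    then show ?thesis by (simp add: q_def indet_def mult_single)
  qed
  have "p = (\<Sum>m\<in>Poly_Mapping.keys p. Poly_Mapping.single m (Poly_Mapping.lookup p m))"
    by (rule poly_eq_sum_single)
  also have "\<dots> = (\<Sum>m\<in>Poly_Mapping.keys p. indet (g m) * q m)"
    by (intro sum.cong) (simp_all add: q)
  also have "\<dots> = (\<Sum>v\<in>V. \<Sum>m\<in>{m \<in> Poly_Mapping.keys p. g m = v}. indet (g m) * q m)"
    by (rule sum.group[symmetric]) (use V gV in auto)
  also have "\<dots> = (\<Sum>v\<in>V. indet v * f v)"
    unfolding f_def sum_distrib_left by (intro sum.cong) auto
  finally have "p = (\<Sum>v\<in>V. indet v * f v)" .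
  moreover have "f v \<in> poly_ring V" for v
    unfolding f_def
  proof (intro poly_ring_sum)
    fix m assume "m \<in> {m \<in> Poly_Mapping.keys p. g m = v}"
    then have "Poly_Mapping.keys m \<subseteq> V" using p by (simp add: poly_ring_def)
    moreover have "Poly_Mapping.keys (m - ?e (g m)) \<subseteq> Poly_Mapping.keys m"
      by (auto simp: in_keys_iff lookup_minus)
    ultimately show "q m \<in> poly_ring V" by (auto simp: q_def poly_ring_def)
  qed
  ultimately show ?thesis by blast
qed

lemma homog_comp_1_koszul_diff:
  fixes u :: "'v set \<Rightarrow> ('v, 'k::comm_ring_1) mpoly vec"
  assumes u: "\<And>v. v \<in> V - S \<Longrightarrow> u (insert v S) \<in> carrier_vec n"
    and z: "\<And>v. v \<in> V - S \<Longrightarrow> map_vec (homog_comp 0) (u (insert v S)) = 0\<^sub>v n"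
  shows "map_vec (homog_comp 1) (koszul_diff V n u S) = 0\<^sub>v n"
proof (rule eq_vecI)
  fix j assume "j < dim_vec (0\<^sub>v n :: ('v, 'k) mpoly vec)"
  then have j: "j < n" by simp
  have "homog_comp 1 (indet v * u (insert v S) $ j) = 0" if v: "v \<in> V - S" for v
  proof -
    have "homog_comp 0 (u (insert v S) $ j) = 0"
      using arg_cong[OF z[OF v], of "\<lambda>x. x $ j"] u[OF v] j by simp
    then show ?thesis
      using homog_comp_mult[of "indet v" 1 0 "u (insert v S) $ j"] by (simp add: indet_def)
  qed
  then show "map_vec (homog_comp 1) (koszul_diff V n u S) $ j = 0\<^sub>v n $ j"
    using j by (simp add: koszul_diff_def homog_comp_sum)
qed (simp add: koszul_diff_def)

section \<open>Koszul cycles over an ideal with a linear resolution\<close>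

text \<open>The constant part of \<open>x\<close> is mapped to the component of degree \<open>d\<close>, which vanishes, so it can be
  subtracted.\<close>

lemma preimage_without_constant_terms:
  fixes A :: "('v, 'k::comm_ring_1) mpoly mat"
  assumes A: "homog_mat V d nr nc A" and x: "x \<in> free_module V nc"
    and z: "map_vec (homog_comp d) (A *\<^sub>v x) = 0\<^sub>v nr"
  shows "\<exists>y\<in>free_module V nc. map_vec (homog_comp 0) y = 0\<^sub>v nc \<and> A *\<^sub>v y = A *\<^sub>v x"
proof -
  have xc: "x \<in> carrier_vec nc" by (rule free_module_carrier[OF x])
  have dx: "dim_vec x = nc" using xc by (rule carrier_vecD)
  let ?x0 = "map_vec (homog_comp 0) x"
  have x0: "?x0 \<in> free_module V nc" using x dx by (auto simp: free_module_def)
  have "A *\<^sub>v ?x0 = 0\<^sub>v nr"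
    using homog_comp_mult_mat_vec[OF A xc, of 0] z by simp
  then have "A *\<^sub>v (x - ?x0) = A *\<^sub>v x"
    using mult_mat_minus_vec[OF homog_mat_carrier[OF A] xc free_module_carrier[OF x0]]
      mult_mat_vec_carrier[OF homog_mat_carrier[OF A] xc] by simp
  moreover have "x - ?x0 \<in> free_module V nc" using x x0 by (rule free_module_minus)
  moreover have "map_vec (homog_comp 0) (x - ?x0) = 0\<^sub>v nc"
  proof (rule eq_vecI)
    fix j assume "j < dim_vec (0\<^sub>v nc :: ('v, 'k) mpoly vec)"
    then have j: "j < nc" by simp
    then have "map_vec (homog_comp 0) (x - ?x0) $ j = homog_comp 0 (x $ j - homog_comp 0 (x $ j))"
      using dx by simp
    also have "\<dots> = 0" by (intro poly_mapping_eqI) (simp add: lookup_homog_comp lookup_minus when_def)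
    finally show "map_vec (homog_comp 0) (x - ?x0) $ j = 0\<^sub>v nc $ j" using j by simp
  qed (use dx in simp)
  ultimately show ?thesis by metis
qed

text \<open>Let \<open>Z\<^sub>p\<close> be the image of \<open>\<phi> p\<close>, so that \<open>Z\<^sub>0 = I\<close> and \<open>Z\<^sub>p\<^sub>+\<^sub>1\<close> is the kernel of \<open>\<phi> p\<close>.  A Koszul cycle
  with values in \<open>Z\<^sub>p\<close>, all above the degree of the generators, bounds a family with values in \<open>Z\<^sub>p\<close>:
  linearity leaves no Koszul homology outside one degree.  The proof shifts dimensions.  Lifting a
  cycle \<open>z\<close> to a family \<open>y\<close> in \<open>F\<^sub>p\<close>, its differential has values in \<open>Z\<^sub>p\<^sub>+\<^sub>1\<close>, is a cycle, and has index
  sets smaller by one, so by induction it bounds some \<open>u\<close> with values in \<open>Z\<^sub>p\<^sub>+\<^sub>1\<close>.  Then \<open>y - u\<close> is a cycle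
  in the free module \<open>F\<^sub>p\<close>, hence a boundary, and has the same image \<open>z\<close> as \<open>y\<close>.\<close>

lemma koszul_cycle_bounds:
  fixes \<phi> :: "nat \<Rightarrow> ('v, 'k::comm_ring_1) mpoly mat"
  assumes char: "CHAR('k) = 2" and V: "finite V" and L: "linear_free_resolution V t I r \<phi>"
    and z: "\<And>S. S \<subseteq> V \<Longrightarrow> card S = i \<Longrightarrow>
      \<exists>y\<in>free_module V (r p). map_vec (homog_comp 0) y = 0\<^sub>v (r p) \<and> z S = \<phi> p *\<^sub>v y"
    and cycle: "\<And>S. S \<subseteq> V \<Longrightarrow> Suc (card S) = i \<Longrightarrow>
      koszul_diff V (dim_row (\<phi> p)) z S = 0\<^sub>v (dim_row (\<phi> p))"
  shows "\<exists>u. (\<forall>S. S \<subseteq> V \<longrightarrow> card S = Suc i \<longrightarrow> (\<exists>y\<in>free_module V (r p). u S = \<phi> p *\<^sub>v y)) \<and>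
    (\<forall>S. S \<subseteq> V \<longrightarrow> card S = i \<longrightarrow> z S = koszul_diff V (dim_row (\<phi> p)) u S)"
  using z cycle
proof (induction i arbitrary: p z)
  case 0
  have car: "\<phi> p \<in> carrier_mat (dim_row (\<phi> p)) (r p)"
    using linear_free_resolutionD(1,2)[OF L] by (cases p) (auto simp: homog_mat_def)
  obtain y where y: "y \<in> free_module V (r p)" "map_vec (homog_comp 0) y = 0\<^sub>v (r p)" "z {} = \<phi> p *\<^sub>v y"
    using 0(1)[of "{}"] by auto
  have "\<forall>j\<in>{..<r p}. \<exists>f. (\<forall>v. f v \<in> poly_ring V) \<and> y $ j = (\<Sum>v\<in>V. indet v * f v)"
  proof (intro ballI poly_no_constant_term[OF V])
    fix j assume "j \<in> {..<r p}"
    then have that: "j < r p" by simp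
    show "y $ j \<in> poly_ring V" using y(1) that by (simp add: free_module_def)
    show "homog_comp 0 (y $ j) = 0"
      using arg_cong[OF y(2), of "\<lambda>x. x $ j"] that carrier_vecD[OF free_module_carrier[OF y(1)]] by simp
  qed
  from bchoice[OF this] obtain f where
    f': "\<forall>j\<in>{..<r p}. (\<forall>v. f j v \<in> poly_ring V) \<and> y $ j = (\<Sum>v\<in>V. indet v * f j v)" ..
  then have f: "\<And>j v. j < r p \<Longrightarrow> f j v \<in> poly_ring V"
    "\<And>j. j < r p \<Longrightarrow> y $ j = (\<Sum>v\<in>V. indet v * f j v)" by simp_all
  define w where "w S = vec (r p) (\<lambda>j. f j (the_elem S))" for S
  have w: "w S \<in> free_module V (r p)" for S using f(1) by (simp add: w_def free_module_def)
  have yw: "y = koszul_diff V (r p) w {}"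
    using f(2) carrier_vecD[OF free_module_carrier[OF y(1)]] by (intro eq_vecI) (auto simp: koszul_diff_def w_def)
  have "z {} = koszul_diff V (dim_row (\<phi> p)) (\<lambda>S. \<phi> p *\<^sub>v w S) {}"
    unfolding y(3) yw by (rule mult_mat_koszul_diff[OF car free_module_carrier[OF w]])
  moreover have "S = {}" if "S \<subseteq> V" "card S = 0" for S
    using that V finite_subset by (metis card_0_eq)
  ultimately show ?case using w by (intro exI[of _ "\<lambda>S. \<phi> p *\<^sub>v w S"]) blast
next
  case (Suc i)
  have hS: "homog_mat V 1 (r p) (r (Suc p)) (\<phi> (Suc p))" by (rule linear_free_resolutionD(2)[OF L])
  have car: "\<phi> p \<in> carrier_mat (dim_row (\<phi> p)) (r p)"
    using linear_free_resolutionD(1,2)[OF L] by (cases p) (auto simp: homog_mat_def)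
  have dimS: "dim_row (\<phi> (Suc p)) = r p" by (rule homog_mat_dims(1)[OF hS])
  obtain y where y: "\<And>S. S \<subseteq> V \<Longrightarrow> card S = Suc i \<Longrightarrow> y S \<in> free_module V (r p)"
    and y0: "\<And>S. S \<subseteq> V \<Longrightarrow> card S = Suc i \<Longrightarrow> map_vec (homog_comp 0) (y S) = 0\<^sub>v (r p)"
    and zy: "\<And>S. S \<subseteq> V \<Longrightarrow> card S = Suc i \<Longrightarrow> z S = \<phi> p *\<^sub>v y S"
    using Suc.prems(1) by metis
  have ins: "insert v S \<subseteq> V \<and> card (insert v S) = Suc (card S)" if "S \<subseteq> V" "v \<in> V - S" for v S
    using that V finite_subset[OF that(1)] by auto
  let ?t = "koszul_diff V (r p) y"
  \<comment> \<open>The lifts \<open>y\<close> have no constant terms, so their Koszul differential has order at least 2.  As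
      \<open>\<phi> (Suc p)\<close> is linear, its preimages can again be chosen without constant terms.\<close>
  have t_lift: "\<exists>q\<in>free_module V (r (Suc p)). map_vec (homog_comp 0) q = 0\<^sub>v (r (Suc p)) \<and> ?t S = \<phi> (Suc p) *\<^sub>v q"
    if S: "S \<subseteq> V" "card S = i" for S
  proof -
    have yS: "y (insert v S) \<in> free_module V (r p)" "map_vec (homog_comp 0) (y (insert v S)) = 0\<^sub>v (r p)"
      "z (insert v S) = \<phi> p *\<^sub>v y (insert v S)" if "v \<in> V - S" for v
      using y y0 zy ins[OF S(1) that] S(2) by auto
    have t: "?t S \<in> free_module V (r p)" using yS(1) by (intro koszul_diff_free_module)
    have "\<phi> p *\<^sub>v ?t S = koszul_diff V (dim_row (\<phi> p)) (\<lambda>S. \<phi> p *\<^sub>v y S) S"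
      using free_module_carrier[OF yS(1)] by (rule mult_mat_koszul_diff[OF car])
    also have "\<dots> = koszul_diff V (dim_row (\<phi> p)) z S"
      using yS(3) by (intro koszul_diff_cong) simp
    also have "\<dots> = 0\<^sub>v (dim_row (\<phi> p))" using Suc.prems(2)[OF S(1)] S(2) by simp
    finally obtain q where q: "q \<in> free_module V (r (Suc p))" "?t S = \<phi> (Suc p) *\<^sub>v q"
      using linear_free_resolution_exact[OF L t] by blast
    have "map_vec (homog_comp 1) (\<phi> (Suc p) *\<^sub>v q) = 0\<^sub>v (r p)"
      unfolding q(2)[symmetric] using free_module_carrier[OF yS(1)] yS(2) by (rule homog_comp_1_koszul_diff)
    from preimage_without_constant_terms[OF hS q(1) this]
    obtain q' where q': "q' \<in> free_module V (r (Suc p))" "map_vec (homog_comp 0) q' = 0\<^sub>v (r (Suc p))"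
      "\<phi> (Suc p) *\<^sub>v q' = \<phi> (Suc p) *\<^sub>v q" by (elim bexE conjE)
    show ?thesis by (rule bexI[OF _ q'(1)]) (simp only: q'(2,3) q(2))
  qed
  have t_cycle: "koszul_diff V (dim_row (\<phi> (Suc p))) ?t S = 0\<^sub>v (dim_row (\<phi> (Suc p)))" for S
    unfolding dimS by (rule koszul_diff_koszul_diff[OF char V])
  obtain u where u: "\<And>S. S \<subseteq> V \<Longrightarrow> card S = Suc i \<Longrightarrow> \<exists>y\<in>free_module V (r (Suc p)). u S = \<phi> (Suc p) *\<^sub>v y"
    and tu: "\<And>S. S \<subseteq> V \<Longrightarrow> card S = i \<Longrightarrow> ?t S = koszul_diff V (r p) u S"
    using Suc.IH[of "Suc p" ?t, OF t_lift t_cycle] unfolding dimS by metis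
  have uS: "u S \<in> free_module V (r p)" "\<phi> p *\<^sub>v u S = 0\<^sub>v (dim_row (\<phi> p))"
    if S: "S \<subseteq> V" "card S = Suc i" for S
  proof -
    obtain q where q: "q \<in> free_module V (r (Suc p))" "u S = \<phi> (Suc p) *\<^sub>v q" using u[OF S] by blast
    show uf: "u S \<in> free_module V (r p)" unfolding q(2) by (rule homog_mat_mult_vec[OF hS q(1)])
    show "\<phi> p *\<^sub>v u S = 0\<^sub>v (dim_row (\<phi> p))"
      using linear_free_resolution_exact[OF L uf] q by blast
  qed
  define d where "d S = y S - u S" for S
  have "\<exists>w. (\<forall>S. w S \<in> free_module V (r p)) \<and>
    (\<forall>S. S \<subseteq> V \<longrightarrow> card S = Suc i \<longrightarrow> d S = koszul_diff V (r p) w S)"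
  proof (rule koszul_exact[OF char V])
    fix S assume S: "S \<subseteq> V" "card S = Suc i"
    show "d S \<in> free_module V (r p)" unfolding d_def using y[OF S] uS(1)[OF S] by (rule free_module_minus)
  next
    fix S assume S: "S \<subseteq> V" "card S = i"
    show "koszul_diff V (r p) d S = 0\<^sub>v (r p)"
    proof (rule eq_vecI)
      fix j assume "j < dim_vec (0\<^sub>v (r p) :: ('v, 'k) mpoly vec)"
      then have j: "j < r p" by simp
      have "koszul_diff V (r p) d S $ j =
          (\<Sum>v\<in>V - S. indet v * y (insert v S) $ j - indet v * u (insert v S) $ j)"
        unfolding koszul_diff_def using j
      proof (simp, intro sum.cong refl)
        fix v assume v: "v \<in> V - S"
        then have "u (insert v S) \<in> carrier_vec (r p)"
          using ins[OF S(1) v] S(2) by (intro free_module_carrier[OF uS(1)]) auto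
        then show "indet v * d (insert v S) $ j = indet v * y (insert v S) $ j - indet v * u (insert v S) $ j"
          using j by (simp add: d_def right_diff_distrib)
      qed
      also have "\<dots> = ?t S $ j - koszul_diff V (r p) u S $ j"
        using j by (simp add: koszul_diff_def sum_subtractf)
      also have "\<dots> = 0" using tu[OF S] by simp
      finally show "koszul_diff V (r p) d S $ j = 0\<^sub>v (r p) $ j" using j by simp
    qed (simp add: koszul_diff_def)
  qed
  then obtain w where w: "\<And>S. w S \<in> free_module V (r p)"
    and dw: "\<And>S. S \<subseteq> V \<Longrightarrow> card S = Suc i \<Longrightarrow> d S = koszul_diff V (r p) w S" by blast
  have "z S = koszul_diff V (dim_row (\<phi> p)) (\<lambda>S. \<phi> p *\<^sub>v w S) S" if S: "S \<subseteq> V" "card S = Suc i" for S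
  proof -
    have "koszul_diff V (dim_row (\<phi> p)) (\<lambda>S. \<phi> p *\<^sub>v w S) S = \<phi> p *\<^sub>v d S"
      unfolding dw[OF S] by (rule mult_mat_koszul_diff[OF car free_module_carrier[OF w], symmetric])
    also have "\<dots> = z S"
      unfolding d_def zy[OF S]
        mult_mat_minus_vec[OF car free_module_carrier[OF y[OF S]] free_module_carrier[OF uS(1)[OF S]]]
        uS(2)[OF S]
      using mult_mat_vec_carrier[OF car free_module_carrier[OF y[OF S]]] by simp
    finally show ?thesis by simp
  qed
  then show ?case using w by (intro exI[of _ "\<lambda>S. \<phi> p *\<^sub>v w S"]) blast
qed

section \<open>Linear resolutions force flag complexes with chordal skeletons\<close>

lemma squarefree_monom_in_stanley_reisner:
  fixes V :: "'v set"
  assumes V: "finite V" and F: "F \<subseteq> V" "F \<notin> \<Gamma>"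
  shows "(squarefree_monom F :: ('v, 'k::comm_ring_1) mpoly) \<in> stanley_reisner_ideal V \<Gamma>"
proof -
  have fin: "finite F" using F V finite_subset by blast
  have "Poly_Mapping.keys (squarefree_monom F :: ('v, 'k) mpoly) = {set_monom F}"
    by (simp add: squarefree_monom_eq)
  then show ?thesis
    unfolding stanley_reisner_ideal_eq[OF V] support_ideal_def poly_ring_def
    using F fin by (auto intro!: exI[of _ F])
qed

lemma stanley_reisner_keys_nonface:
  fixes q :: "('v, 'k::comm_ring_1) mpoly"
  assumes \<Gamma>: "simplicial_complex V \<Gamma>" and q: "q \<in> stanley_reisner_ideal V \<Gamma>"
    and m: "m \<in> Poly_Mapping.keys q"
  shows "Poly_Mapping.keys m \<notin> \<Gamma>"
proof
  assume k: "Poly_Mapping.keys m \<in> \<Gamma>"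
  have V: "finite V" using \<Gamma> by (simp add: simplicial_complex_def)
  obtain F where "F \<notin> \<Gamma>" "F \<subseteq> Poly_Mapping.keys m"
    using q m unfolding stanley_reisner_ideal_eq[OF V] support_ideal_def by blast
  then show False using k \<Gamma> unfolding simplicial_complex_def by blast
qed

text \<open>The monomial of a nonface \<open>F\<close> is a combination of the generators \<open>\<phi> 0 $$ (0, j)\<close>, so it is
  divisible by a monomial \<open>a\<close> of one of them.  This \<open>a\<close> has degree 2 and is squarefree, hence is the
  monomial of a pair, and that pair is a nonface because \<open>a\<close> occurs in an element of the ideal.\<close>

lemma quadratic_generators_imp_nonedge:
  fixes V :: "'v set"
  assumes \<Gamma>: "simplicial_complex V \<Gamma>"
    and L: "linear_free_resolution V 2 (stanley_reisner_ideal V \<Gamma> :: ('v, 'k::comm_ring_1) mpoly set) r \<phi>"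
    and F: "F \<subseteq> V" "F \<notin> \<Gamma>"
  shows "\<exists>e. e \<subseteq> F \<and> card e = 2 \<and> e \<notin> \<Gamma>"
proof -
  have V: "finite V" using \<Gamma> by (simp add: simplicial_complex_def)
  have fin: "finite F" using F V finite_subset by blast
  note h = linear_free_resolutionD(1)[OF L] and im = linear_free_resolutionD(3)[OF L]
  obtain x where x: "x \<in> free_module V (r 0)" "squarefree_monom F = (\<phi> 0 *\<^sub>v x) $ 0"
    using im[THEN iffD1, OF squarefree_monom_in_stanley_reisner[OF V F]] by (elim bexE)
  have "squarefree_monom F = (\<Sum>j<r 0. \<phi> 0 $$ (0, j) * x $ j)"
    unfolding x(2) by (rule mult_mat_vec_index[OF homog_mat_carrier[OF h] free_module_carrier[OF x(1)]]) simp
  then have "set_monom F \<in> Poly_Mapping.keys (\<Sum>j<r 0. \<phi> 0 $$ (0, j) * x $ j)"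
    by (metis squarefree_monom_eq keys_single singletonI zero_neq_one)
  then obtain j where j: "j < r 0" "set_monom F \<in> Poly_Mapping.keys (\<phi> 0 $$ (0, j) * x $ j)"
    using keys_sum[of "\<lambda>j. \<phi> 0 $$ (0, j) * x $ j" "{..<r 0}"] by auto
  obtain a b where ab: "a \<in> Poly_Mapping.keys (\<phi> 0 $$ (0, j))" "set_monom F = a + b"
    using j(2) keys_mult[of "\<phi> 0 $$ (0, j)" "x $ j"] by auto
  have deg: "mdeg a = 2" using h ab(1) j(1) by (simp add: homog_mat_def)
  have "Poly_Mapping.keys a \<subseteq> F"
    using arg_cong[OF ab(2), of Poly_Mapping.keys] fin by (auto simp: keys_add_nat)
  have "Poly_Mapping.lookup a v = 1" if "v \<in> Poly_Mapping.keys a" for v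
  proof -
    have "Poly_Mapping.lookup a v + Poly_Mapping.lookup b v \<le> 1"
      using arg_cong[OF ab(2), of "\<lambda>m. Poly_Mapping.lookup m v"] lookup_set_monom[OF fin, of v]
      by (simp add: lookup_add split: if_splits)
    moreover have "Poly_Mapping.lookup a v \<noteq> 0" using that by (simp add: in_keys_iff)
    ultimately show ?thesis by simp
  qed
  then have "card (Poly_Mapping.keys a) = 2" using deg by (simp add: mdeg_def)
  moreover have "Poly_Mapping.keys a \<notin> \<Gamma>"
  proof (rule stanley_reisner_keys_nonface[OF \<Gamma> _ ab(1)])
    have "\<phi> 0 $$ (0, j) = (\<phi> 0 *\<^sub>v unit_vec (r 0) j) $ 0"
      using mult_mat_unit_vec[OF homog_mat_carrier[OF h] j(1)] homog_mat_dims[OF h] j(1) by simp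
    then show "\<phi> 0 $$ (0, j) \<in> stanley_reisner_ideal V \<Gamma>"
      by (rule im[THEN iffD2, OF bexI[OF _ free_module_unit]])
  qed
  ultimately show ?thesis using \<open>Poly_Mapping.keys a \<subseteq> F\<close> by blast
qed

lemma flag_if_nonfaces_contain_nonedges:
  assumes \<Gamma>: "simplicial_complex V \<Gamma>"
    and flag: "\<And>F. F \<subseteq> V \<Longrightarrow> F \<notin> \<Gamma> \<Longrightarrow> \<exists>e. e \<subseteq> F \<and> card e = 2 \<and> e \<notin> \<Gamma>"
  shows "\<Gamma> = one_closure V (pure_1_skeleton \<Gamma>)"
proof (intro equalityI subsetI)
  fix F assume F: "F \<in> \<Gamma>"
  then have "F \<subseteq> V" and sub: "\<And>H. H \<subseteq> F \<Longrightarrow> H \<in> \<Gamma>" using \<Gamma> by (auto simp: simplicial_complex_def)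
  then show "F \<in> one_closure V (pure_1_skeleton \<Gamma>)"
    using F unfolding one_closure_def pure_1_skeleton_def by (auto simp: not_le)
next
  fix F assume F: "F \<in> one_closure V (pure_1_skeleton \<Gamma>)"
  then have FV: "F \<subseteq> V" by (simp add: one_closure_def)
  have fin: "finite F" using FV \<Gamma> finite_subset by (auto simp: simplicial_complex_def)
  show "F \<in> \<Gamma>"
  proof (rule ccontr)
    assume "F \<notin> \<Gamma>"
    then obtain e where e: "e \<subseteq> F" "card e = 2" "e \<notin> \<Gamma>" using flag[OF FV] by blast
    have "2 \<le> card F" using card_mono[OF fin e(1)] e(2) by simp
    moreover have "e = F" if "card F = 2" using card_subset_eq[OF fin e(1)] e(2) that by simp
    ultimately show False using F e unfolding one_closure_def pure_1_skeleton_def by auto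
  qed
qed

lemma ideal_element_lift_no_constant:
  fixes q :: "('v, 'k::comm_ring_1) mpoly"
  assumes L: "linear_free_resolution V t I r \<phi>" and q: "q \<in> I" "homog_comp t q = 0"
  shows "\<exists>y\<in>free_module V (r 0). map_vec (homog_comp 0) y = 0\<^sub>v (r 0) \<and> vec 1 (\<lambda>_. q) = \<phi> 0 *\<^sub>v y"
proof -
  note h = linear_free_resolutionD(1)[OF L]
  obtain x where x: "x \<in> free_module V (r 0)" "q = (\<phi> 0 *\<^sub>v x) $ 0"
    using linear_free_resolutionD(3)[OF L, THEN iffD1, OF q(1)] by (elim bexE)
  have p: "\<phi> 0 *\<^sub>v x = vec 1 (\<lambda>_. q)"
    using x(2) homog_mat_dims[OF h] by (intro eq_vecI) auto
  have "map_vec (homog_comp t) (\<phi> 0 *\<^sub>v x) = 0\<^sub>v 1"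
    unfolding p using q(2) by (intro eq_vecI) auto
  from preimage_without_constant_terms[OF h x(1) this]
  obtain y where y: "y \<in> free_module V (r 0)" "map_vec (homog_comp 0) y = 0\<^sub>v (r 0)"
    "\<phi> 0 *\<^sub>v y = \<phi> 0 *\<^sub>v x" by (elim bexE conjE)
  show ?thesis by (rule bexI[OF _ y(1)]) (simp only: y(2,3) p)
qed

lemma cycle_edges_nth:
  assumes d: "distinct c" and ij: "i < j" "j < length c" and e: "{c ! i, c ! j} \<in> cycle_edges c"
  shows "j = Suc i \<or> i = 0 \<and> Suc j = length c"
proof -
  let ?n = "length c"
  obtain k where k: "k < ?n" "{c ! i, c ! j} = {c ! k, c ! (Suc k mod ?n)}"
    using e unfolding cycle_edges_def by blast
  have l: "Suc k mod ?n < ?n" using k(1) by (intro mod_less_divisor) linarith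
  have "c ! i = c ! k \<and> c ! j = c ! (Suc k mod ?n) \<or> c ! i = c ! (Suc k mod ?n) \<and> c ! j = c ! k"
    using k(2) by (auto simp: doubleton_eq_iff)
  then have "i = k \<and> j = Suc k mod ?n \<or> i = Suc k mod ?n \<and> j = k"
    using d ij k(1) l by (auto simp: nth_eq_iff_index_eq)
  moreover have "Suc k mod ?n = (if Suc k = ?n then 0 else Suc k)" using k(1) by simp
  ultimately show ?thesis using ij by (auto split: if_splits)
qed

lemma cycle_edges_Suc: "Suc i < length c \<Longrightarrow> {c ! i, c ! Suc i} \<in> cycle_edges c"
  unfolding cycle_edges_def by (intro CollectI exI[of _ i]) simp

lemma cycle_edges_last:
  assumes "c \<noteq> []"
  shows "{c ! 0, c ! (length c - 1)} \<in> cycle_edges c"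
  using assms unfolding cycle_edges_def
  by (intro CollectI exI[of _ "length c - 1"]) (auto simp: insert_commute)

text \<open>For a chordless cycle \<open>c\<close> on \<open>n > 3\<close> vertices the first cohomology of the circle appears as
  Koszul homology of the ideal in the multidegree of \<open>c\<close>: a chain on subsets \<open>S\<close> of \<open>c\<close> with
  coefficients \<open>x\<^sup>T\<close>, \<open>T = c - S\<close>, is a cochain on the sets \<open>T\<close>, which must be nonfaces for the
  coefficients to lie in the ideal.  The coboundary of the edge \<open>{c ! 0, c ! 1}\<close> is such a cocycle \<open>q\<close>,
  supported on the triples containing that edge, none of which is a face.  If it bounds, there is a function \<open>w\<close> on pairs,
  zero on the edges of \<open>c\<close>, with the same coboundary.  On the triples \<open>{c ! 0, c ! i, c ! (i + 1)}\<close>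
  this gives \<open>w {c ! 0, c ! i} + w {c ! 0, c ! (i + 1)} = 0\<close> for \<open>i > 1\<close> but \<open>1\<close> for \<open>i = 1\<close>, so that
  \<open>w {c ! 0, c ! (n - 1)} = 1\<close>, although this pair is an edge.\<close>

lemma linear_resolution_no_induced_cycle:
  fixes V :: "'v set" and \<phi> :: "nat \<Rightarrow> ('v, 'k::comm_ring_1) mpoly mat"
  assumes char: "CHAR('k) = 2" and \<Gamma>: "simplicial_complex V \<Gamma>"
    and L: "linear_free_resolution V 2 (stanley_reisner_ideal V \<Gamma>) r \<phi>"
    and cyc: "is_cycle (pure_1_skeleton \<Gamma>) c" "length c > 3" and chordless: "\<not> has_chord (pure_1_skeleton \<Gamma>) c"
  shows False
proof -
  let ?n = "length c"
  let ?C = "set c"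
  let ?I = "stanley_reisner_ideal V \<Gamma> :: ('v, 'k) mpoly set"
  have V: "finite V" using \<Gamma> by (simp add: simplicial_complex_def)
  have down: "H \<in> \<Gamma>" if "F \<in> \<Gamma>" "H \<subseteq> F" for F H using that \<Gamma> unfolding simplicial_complex_def by blast
  have faces: "F \<subseteq> V" if "F \<in> \<Gamma>" for F using that \<Gamma> unfolding simplicial_complex_def by blast
  have d: "distinct c" using cyc by (simp add: is_cycle_def)
  have cardC: "card ?C = ?n" by (rule distinct_card[OF d])
  have edge: "e \<in> \<Gamma>" "card e = 2" if "e \<in> cycle_edges c" for e
    using cyc(1) that by (auto simp: is_cycle_def pure_1_skeleton_def)
  have adj: "{a, b} \<in> cycle_edges c" if "a \<in> ?C" "b \<in> ?C" "a \<noteq> b" "{a, b} \<in> \<Gamma>" for a b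
    using chordless that unfolding has_chord_def pure_1_skeleton_def by auto
  have CV: "?C \<subseteq> V"
  proof
    fix x assume "x \<in> ?C"
    then obtain i where "i < ?n" "x = c ! i" by (auto simp: in_set_conv_nth)
    then have "{c ! i, c ! (Suc i mod ?n)} \<in> cycle_edges c" unfolding cycle_edges_def by blast
    then have "{c ! i, c ! (Suc i mod ?n)} \<subseteq> V" by (rule faces[OF edge(1)])
    then show "x \<in> V" using \<open>x = c ! i\<close> by simp
  qed
  have cne: "c \<noteq> []" using cyc(2) by auto
  have inC: "c ! i \<in> ?C" if "i < ?n" for i using that by simp
  have neq: "c ! i \<noteq> c ! j" if "i < ?n" "j < ?n" "i \<noteq> j" for i j
    using d that by (simp add: nth_eq_iff_index_eq)
  have c01: "c ! 0 \<in> ?C" "c ! 1 \<in> ?C" "c ! 0 \<noteq> c ! 1" using cne cyc(2) inC[of 0] inC[of 1] neq[of 0 1] by auto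
  have no_triangle: "{c ! 0, c ! 1, v} \<notin> \<Gamma>" if v: "v \<in> ?C" "v \<noteq> c ! 0" "v \<noteq> c ! 1" for v
  proof
    assume t: "{c ! 0, c ! 1, v} \<in> \<Gamma>"
    obtain j where j: "j < ?n" "v = c ! j" using v(1) by (auto simp: in_set_conv_nth)
    have "j \<noteq> 0" "j \<noteq> 1" using v j by metis+
    have "{c ! 0, c ! j} \<in> cycle_edges c" "{c ! 1, c ! j} \<in> cycle_edges c"
      using adj[OF c01(1) v(1)] adj[OF c01(2) v(1)] v down[OF t] j(2) by auto
    then have "j = Suc 0 \<or> Suc j = ?n" "j = Suc 1"
      using cycle_edges_nth[OF d, of 0 j] cycle_edges_nth[OF d, of 1 j] j(1) \<open>j \<noteq> 0\<close> \<open>j \<noteq> 1\<close> by auto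
    then show False using cyc(2) by simp
  qed

  define q :: "'v set \<Rightarrow> ('v, 'k) mpoly" where
    "q S = (if S \<subseteq> ?C \<and> c ! 0 \<notin> S \<and> c ! 1 \<notin> S then squarefree_monom (?C - S) else 0)" for S
  define z where "z S = vec 1 (\<lambda>_. q S)" for S
  have d0: "dim_row (\<phi> 0) = 1" using homog_mat_dims[OF linear_free_resolutionD(1)[OF L]] by simp
  have card_diff: "card (?C - S) = ?n - card S" if "S \<subseteq> ?C" for S
    using that cardC by (simp add: card_Diff_subset finite_subset)
  have zero: "0 \<in> ?I" unfolding stanley_reisner_ideal_eq[OF V] support_ideal_def by simp
  have zI: "\<exists>y\<in>free_module V (r 0). map_vec (homog_comp 0) y = 0\<^sub>v (r 0) \<and> z S = \<phi> 0 *\<^sub>v y"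
    if S: "S \<subseteq> V" "card S = ?n - 3" for S
    unfolding z_def
  proof (rule ideal_element_lift_no_constant[OF L])
    show "q S \<in> ?I"
    proof (cases "S \<subseteq> ?C \<and> c ! 0 \<notin> S \<and> c ! 1 \<notin> S")
      case True
      have card3: "card (?C - S) = 3" using card_diff True S(2) cyc(2) by simp
      have "\<not> ?C - S \<subseteq> {c ! 0, c ! 1}"
      proof
        assume "?C - S \<subseteq> {c ! 0, c ! 1}"
        then have "card (?C - S) \<le> card {c ! 0, c ! 1}" by (intro card_mono) simp
        then show False using card3 c01(3) by simp
      qed
      then obtain v where v: "v \<in> ?C" "v \<notin> S" "v \<noteq> c ! 0" "v \<noteq> c ! 1" by blast
      have "{c ! 0, c ! 1, v} \<subseteq> ?C - S" using True v c01 by blast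
      then have "?C - S \<notin> \<Gamma>" using no_triangle[OF v(1,3,4)] down by blast
      moreover have "?C - S \<subseteq> V" using CV by blast
      ultimately show ?thesis using True squarefree_monom_in_stanley_reisner[OF V] by (simp add: q_def)
    next
      case False
      then show ?thesis using zero by (simp only: q_def if_False)
    qed
    show "homog_comp 2 (q S) = 0"
    proof (cases "S \<subseteq> ?C \<and> c ! 0 \<notin> S \<and> c ! 1 \<notin> S")
      case True
      have "mdeg (set_monom (?C - S)) = 3" using card_diff True S(2) cyc(2) by (simp add: mdeg_set_monom)
      then show ?thesis using True
        by (intro poly_mapping_eqI)
          (auto simp: q_def squarefree_monom_eq lookup_homog_comp lookup_single when_def)
    next
      case False
      then show ?thesis by (simp only: q_def if_False homog_comp_0)
    qed
  qed
  have zcycle: "koszul_diff V (dim_row (\<phi> 0)) z S = 0\<^sub>v (dim_row (\<phi> 0))"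
    if S: "S \<subseteq> V" "Suc (card S) = ?n - 3" for S
  proof -
    have "(\<Sum>v\<in>V - S. indet v * q (insert v S)) = 0"
    proof (cases "S \<subseteq> ?C \<and> c ! 0 \<notin> S \<and> c ! 1 \<notin> S")
      case False
      then have "q (insert v S) = 0" for v by (auto simp: q_def)
      then show ?thesis by simp
    next
      case True
      \<comment> \<open>Only the two vertices of \<open>D\<close> can be added to \<open>S\<close>, and both give the same monomial.\<close>
      define D where "D = ?C - S - {c ! 0, c ! 1}"
      have "card (?C - S) = 4" using card_diff True S(2) cyc(2) by simp
      then have D: "card D = 2" unfolding D_def using True c01 by (simp add: card_Diff_subset)
      have "indet v * q (insert v S) = (if v \<in> D then squarefree_monom (?C - S) else 0)" if "v \<in> V - S" for v
      proof (cases "v \<in> D")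
        case vD: True
        have e: "?C - S = insert v (?C - insert v S)" using vD by (auto simp: D_def)
        have "q (insert v S) = squarefree_monom (?C - insert v S)"
          using True vD unfolding q_def D_def by auto
        moreover have "set_monom (?C - S) = Poly_Mapping.single v 1 + set_monom (?C - insert v S)"
          by (subst e, rule set_monom_insert) auto
        ultimately show ?thesis using vD by (simp add: squarefree_monom_eq indet_def mult_single)
      next
        case False
        then have "q (insert v S) = 0" using that by (auto simp: q_def D_def)
        then show ?thesis using False by simp
      qed
      then have "(\<Sum>v\<in>V - S. indet v * q (insert v S)) =
          (\<Sum>v\<in>V - S. if v \<in> D then squarefree_monom (?C - S) else 0)" by (intro sum.cong refl)
      also have "\<dots> = (\<Sum>v\<in>D. squarefree_monom (?C - S))"
        using CV V by (intro sum.mono_neutral_cong_right) (auto simp: D_def)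
      also have "\<dots> = squarefree_monom (?C - S) + squarefree_monom (?C - S)"
        using D by (auto simp: card_2_iff)
      also have "\<dots> = 0" by (rule char_2_add_self[OF char])
      finally show ?thesis .
    qed
    then show ?thesis unfolding d0 koszul_diff_def z_def by (intro eq_vecI) auto
  qed

  have "\<exists>u. (\<forall>S. S \<subseteq> V \<longrightarrow> card S = Suc (?n - 3) \<longrightarrow> (\<exists>y\<in>free_module V (r 0). u S = \<phi> 0 *\<^sub>v y)) \<and>
    (\<forall>S. S \<subseteq> V \<longrightarrow> card S = ?n - 3 \<longrightarrow> z S = koszul_diff V (dim_row (\<phi> 0)) u S)"
    using zI zcycle by (rule koszul_cycle_bounds[OF char V L])
  then obtain u where
    u_im: "\<forall>S. S \<subseteq> V \<longrightarrow> card S = Suc (?n - 3) \<longrightarrow> (\<exists>y\<in>free_module V (r 0). u S = \<phi> 0 *\<^sub>v y)" and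
    zu: "\<forall>S. S \<subseteq> V \<longrightarrow> card S = ?n - 3 \<longrightarrow> z S = koszul_diff V (dim_row (\<phi> 0)) u S"
    by (elim exE conjE)
  define w where "w T = Poly_Mapping.lookup (u (?C - T) $ 0) (set_monom T)" for T
  have w0: "w T = 0" if T: "T \<subseteq> ?C" "card T = 2" "T \<in> \<Gamma>" for T
  proof -
    have "card (?C - T) = Suc (?n - 3)" using card_diff[OF T(1)] T(2) cyc(2) by simp
    moreover have "?C - T \<subseteq> V" using CV by blast
    ultimately obtain y where y: "y \<in> free_module V (r 0)" "u (?C - T) = \<phi> 0 *\<^sub>v y" using u_im by blast
    have "u (?C - T) $ 0 \<in> ?I"
      by (rule linear_free_resolutionD(3)[OF L, THEN iffD2], rule bexI[OF _ y(1)], simp only: y(2))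
    moreover have "finite T" using T(1) finite_subset by blast
    ultimately have "set_monom T \<notin> Poly_Mapping.keys (u (?C - T) $ 0)"
      using stanley_reisner_keys_nonface[OF \<Gamma>, of "u (?C - T) $ 0" "set_monom T"] T(3) by auto
    then show ?thesis by (simp add: w_def in_keys_iff)
  qed
  have coboundary: "(\<Sum>v\<in>T. w (T - {v})) = (if c ! 0 \<in> T \<and> c ! 1 \<in> T then 1 else 0)"
    if T: "T \<subseteq> ?C" "card T = 3" for T
  proof -
    define S where "S = ?C - T"
    have fT: "finite T" using T(1) finite_subset by blast
    have S: "S \<subseteq> V" "card S = ?n - 3" using CV card_diff[OF T(1)] T(2) by (auto simp: S_def)
    have CS: "?C - S = T" using T(1) by (auto simp: S_def)
    have "q S = (\<Sum>v\<in>V - S. indet v * u (insert v S) $ 0)"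
      using arg_cong[OF zu[rule_format, OF S, unfolded d0], of "\<lambda>x. x $ 0"] by (simp add: z_def koszul_diff_def)
    then have "Poly_Mapping.lookup (q S) (set_monom T) =
        (\<Sum>v\<in>V - S. Poly_Mapping.lookup (indet v * u (insert v S) $ 0) (set_monom T))"
      by (simp add: lookup_sum)
    also have "\<dots> = (\<Sum>v\<in>V - S. if v \<in> T then w (T - {v}) else 0)"
    proof (intro sum.cong refl)
      fix v
      show "Poly_Mapping.lookup (indet v * u (insert v S) $ 0) (set_monom T) = (if v \<in> T then w (T - {v}) else 0)"
      proof (cases "v \<in> T")
        case True
        then have "insert v S = ?C - (T - {v})" using T(1) by (auto simp: S_def)
        then show ?thesis unfolding lookup_indet_mult keys_set_monom[OF fT]
          using True set_monom_minus_single[OF fT True] by (simp add: w_def)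
      qed (simp add: lookup_indet_mult fT)
    qed
    also have "\<dots> = (\<Sum>v\<in>T. w (T - {v}))"
      using T(1) CV V by (intro sum.mono_neutral_cong_right) (auto simp: S_def)
    finally have "(\<Sum>v\<in>T. w (T - {v})) = Poly_Mapping.lookup (q S) (set_monom T)" by (rule sym)
    moreover have "q S = (if c ! 0 \<in> T \<and> c ! 1 \<in> T then squarefree_monom T else 0)"
      unfolding q_def CS using c01 by (auto simp: S_def)
    ultimately show ?thesis by (simp add: squarefree_monom_eq)
  qed
  have step: "w {c ! 0, c ! i} + w {c ! 0, c ! Suc i} = (if i = 1 then 1 else 0)"
    if i: "0 < i" "Suc i < ?n" for i
  proof -
    let ?a = "c ! 0" and ?b = "c ! i" and ?e = "c ! Suc i"
    have ne: "?a \<noteq> ?b" "?a \<noteq> ?e" "?b \<noteq> ?e" using i cne neq[of 0 i] neq[of 0 "Suc i"] neq[of i "Suc i"] by auto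
    have sub: "{?a, ?b, ?e} \<subseteq> ?C" using i cne inC[of 0] inC[of i] inC[of "Suc i"] by simp
    have "w {?b, ?e} = 0"
      using edge[OF cycle_edges_Suc[OF i(2)]] sub by (intro w0) auto
    moreover have "(\<Sum>v\<in>{?a, ?b, ?e}. w ({?a, ?b, ?e} - {v})) = w {?b, ?e} + (w {?a, ?e} + w {?a, ?b})"
    proof -
      have "{?a, ?b, ?e} - {?a} = {?b, ?e}" "{?a, ?b, ?e} - {?b} = {?a, ?e}" "{?a, ?b, ?e} - {?e} = {?a, ?b}"
        using ne by auto
      then show ?thesis using ne by simp
    qed
    moreover have "c ! 1 \<in> {?a, ?b, ?e} \<longleftrightarrow> i = 1"
      using i cne neq[of 1 0] neq[of 1 i] neq[of 1 "Suc i"] by auto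
    ultimately show ?thesis
      using coboundary[OF sub] ne by (simp add: add.commute)
  qed
  have two: "x + x = 0" for x :: 'k
    using arg_cong[OF char_2_add_self[OF char, of "Poly_Mapping.single (0 :: 'v \<Rightarrow>\<^sub>0 nat) x"],
        of "\<lambda>p. Poly_Mapping.lookup p 0"] by (simp only: lookup_add lookup_single_eq lookup_zero)
  have "w {c ! 0, c ! 1} = 0"
    using edge[OF cycle_edges_Suc[of 0 c]] c01 cyc(2) by (intro w0) auto
  then have w2: "w {c ! 0, c ! 2} = 1" using step[of 1] cyc(2) by (simp add: numeral_2_eq_2)
  have "w {c ! 0, c ! (2 + k)} = 1" if "2 + k < ?n" for k
    using that
  proof (induction k)
    case 0
    then show ?case using w2 by simp
  next
    case (Suc k)
    then have 1: "w {c ! 0, c ! (2 + k)} = 1" by simp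
    have "w {c ! 0, c ! (2 + k)} + w {c ! 0, c ! (2 + Suc k)} = 0"
      using step[of "2 + k"] Suc.prems by simp
    then show ?case using two[of 1] unfolding 1 by (metis add_left_cancel)
  qed
  from this[of "?n - 3"] have "w {c ! 0, c ! (?n - 1)} = 1"
    using cyc(2) by (simp add: numeral_eq_Suc Suc_diff_Suc)
  moreover have "w {c ! 0, c ! (?n - 1)} = 0"
    using edge[OF cycle_edges_last[OF cne]] cne inC[of 0] inC[of "?n - 1"] by (intro w0) auto
  ultimately show False by simp
qed

lemma linear_resolution_imp_flag_chordal:
  fixes V :: "'v set"
  assumes char: "CHAR('k::comm_ring_1) = 2" and \<Gamma>: "simplicial_complex V \<Gamma>"
    and lin: "has_linear_resolution 2 V (stanley_reisner_ideal V \<Gamma> :: ('v, 'k) mpoly set)"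
  shows "\<Gamma> = one_closure V (pure_1_skeleton \<Gamma>)" "chordal (pure_1_skeleton \<Gamma>)"
proof -
  obtain r \<phi> where L: "linear_free_resolution V 2 (stanley_reisner_ideal V \<Gamma> :: ('v, 'k) mpoly set) r \<phi>"
    using lin unfolding has_linear_resolution_iff by blast
  show "\<Gamma> = one_closure V (pure_1_skeleton \<Gamma>)"
    by (rule flag_if_nonfaces_contain_nonedges[OF \<Gamma>]) (rule quadratic_generators_imp_nonedge[OF \<Gamma> L])
  show "chordal (pure_1_skeleton \<Gamma>)"
    unfolding chordal_def using linear_resolution_no_induced_cycle[OF char \<Gamma> L] by blast
qed

theorem theorem4p2:
  assumes "CHAR('k::field) = 2"
  shows "(\<forall>(V::'v set) E. simple_graph V E \<and> chordal E \<longrightarrow>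
            has_linear_resolution 2 V
              (stanley_reisner_ideal V (one_closure V E) :: ('v, 'k) mpoly set)) \<and>
         (\<forall>(V::'v set) \<Gamma>. simplicial_complex V \<Gamma> \<and>
            has_linear_resolution 2 V (stanley_reisner_ideal V \<Gamma> :: ('v, 'k) mpoly set) \<longrightarrow>
            \<Gamma> = one_closure V (pure_1_skeleton \<Gamma>) \<and> chordal (pure_1_skeleton \<Gamma>))"
proof (intro conjI allI impI)
  fix V :: "'v set" and E
  assume "simple_graph V E \<and> chordal E"
  then show "has_linear_resolution 2 V
      (stanley_reisner_ideal V (one_closure V E) :: ('v, 'k) mpoly set)"
    using chordal_imp_linear_resolution by blast
next
  fix V :: "'v set" and \<Gamma>
  assume "simplicial_complex V \<Gamma> \<and>
    has_linear_resolution 2 V (stanley_reisner_ideal V \<Gamma> :: ('v, 'k) mpoly set)"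
  then show "\<Gamma> = one_closure V (pure_1_skeleton \<Gamma>)" "chordal (pure_1_skeleton \<Gamma>)"
    using linear_resolution_imp_flag_chordal[OF assms] by blast+
qed

end
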